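(* Let $a\in L^2(\Omega)$ satisfy $a>0$ a.e. in $\Omega$, let $F\in L^\infty(0,\infty;L^2(\Omega))$ be non-negative, and let $u$ be the solution to $$\left\{\begin{array}{ll}\displaystyle\sum_{j=1}^m q_j\,\partial_t^{\alpha_j}u(x,t)+\mathcal A u(x,t)=F(x,t) & (x\in\Omega,\ t>0),\\ u(x,0)=a(x) & (x\in\Omega),\\ u(x,t)=0 & (x\in\partial\Omega,\ t>0).\end{array}\right.$$ Then $u>0$ a.e. in $\Omega\times(0,\infty)$.
   Context: Setting. $d\in\{1,2,3\}$ and $\Omega\subset\mathbb R^d$ is an open bounded domain (connected) with smooth (e.g. $C^\infty$) boundary. $m\ge 1$ is an integer and $\alpha_j,q_j$ ($j=1,\dots,m$) are positive constants with $1>\alpha_1>\cdots>\alpha_m>0$ and $q_1=1$. The Caputo derivative is $\partial_t^{\alpha_j}f(t)=\frac1{\Gamma(1-\alpha_j)}\int_0^t\frac{f'(s)}{(t-s)^{\alpha_j}}\,ds$. The operator $\mathcal A$ has domain $\mathcal D(\mathcal A)=H^2(\Omega)\cap H^1_0(\Omega)$ and is given by $\mathcal A f=-\sum_{i,j=1}^d\partial_j(a_{ij}\partial_i f)+cf$, where $a_{ij}=a_{ji}\in C^1(\overline\Omega)$ and $c\in C(\overline\Omega)$ are real-valued, $c\ge 0$ in $\overline\Omega$, and there is $\delta>0$ with $\sum_{i,j}a_{ij}(x)\xi_i\xi_j\ge\delta\sum_i\xi_i^2$ for all $x\in\overline\Omega$, $\xi\in\mathbb R^d$. Let $(\cdot,\cdot)$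 be the $L^2(\Omega)$ inner product and $\{(\lambda_n,\varphi_n)\}_{n\ge1}$ the eigensystem of $\mathcal A$: $0<\lambda_1<\lambda_2\le\cdots$, $\lambda_n\to\infty$, $\{\varphi_n\}\subset H^2(\Omega)\cap H^1_0(\Omega)$ a complete orthonormal basis of $L^2(\Omega)$. Multinomial Mittag-Leffler function. For $\beta_0>0$, $\boldsymbol\beta\in(0,1)^m$, $\boldsymbol z\in\mathbb C^m$, $$E_{\boldsymbol\beta,\beta_0}(\boldsymbol z)=\sum_{k=0}^\infty\ \sum_{k_1+\cdots+k_m=k}\frac{k!}{k_1!\cdots k_m!}\,\frac{\prod_{j=1}^m z_j^{k_j}}{\Gamma\big(\beta_0+\sum_{j=1}^m k_j\beta_j\big)},$$ with $k_j\ge0$ integers. For $\beta>0$ set $$E^{(n)}_{\boldsymbol\alpha',\beta}(t)=E_{(\alpha_1,\alpha_1-\alpha_2,\dots,\alpha_1-\alpha_m),\beta}\big(-\lambda_n t^{\alpha_1},-q_2t^{\alpha_1-\alpha_2},\dots,-q_mt^{\alpha_1-\alpha_m}\big).$$ Solution. By linearity $u=v+w$. Here $v$ is the solution with initial value $a$ and zero source, namely $$v(\cdot,t)=\sum_{n=1}^\infty\big(1-\lambda_n t^{\alpha_1}E^{(n)}_{\boldsymbol\alpha',1+\alpha_1}(t)\big)(a,\varphi_n)\varphi_n,$$ which belongs to $C([0,\infty);L^2(\Omega))\cap C((0,\infty);H^2(\Omega)\cap H^1_0(\Omega))$. The function $w$ is the solution with zero initial value and source $F$: for every $T>0$ it is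 the unique solution in $L^2(0,T;H^2(\Omega)\cap H^1_0(\Omega))$ with $\lim_{t\to0}\|w(\cdot,t)\|_{L^2(\Omega)}=0$, explicitly $$w(\cdot,t)=\int_0^t\sum_{n=1}^\infty s^{\alpha_1-1}E^{(n)}_{\boldsymbol\alpha',\alpha_1}(s)\,(F(\cdot,t-s),\varphi_n)\,\varphi_n\,ds.$$ *)

theory Defs
  imports "HOL-Analysis.Analysis"
begin

section \<open>Smooth functions and domains\<close>

definition pd :: "'n::finite \<Rightarrow> (real^'n \<Rightarrow> real) \<Rightarrow> real^'n \<Rightarrow> real" where
  "pd j f x = frechet_derivative f (at x) (axis j 1)"

fun iter_pd :: "'n::finite list \<Rightarrow> (real^'n \<Rightarrow> real) \<Rightarrow> real^'n \<Rightarrow> real" where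
  "iter_pd [] f = f"
| "iter_pd (j # js) f = pd j (iter_pd js f)"

text \<open>Used for open \<open>U\<close> only: a function is \<open>C\<^sup>\<infinity>\<close> iff all its iterated partial
  derivatives exist and are (Frechet) differentiable.\<close>

definition smooth_on :: "(real^'n) set \<Rightarrow> (real^'n::finite \<Rightarrow> real) \<Rightarrow> bool" where
  "smooth_on U f \<longleftrightarrow> (\<forall>js. \<forall>x\<in>U. iter_pd js f differentiable (at x))"

text \<open>Smoothness of the boundary: near each boundary point, the set is the negativity region of a
  \<open>C\<^sup>\<infinity>\<close> function whose gradient does not vanish at that point.\<close>

definition smooth_boundary :: "(real^'n::finite) set \<Rightarrow> bool" where
  "smooth_boundary \<Omega> \<longleftrightarrow>
     (\<forall>p \<in> frontier \<Omega>. \<exists>U \<rho>. open U \<and> p \<in> U \<and> smooth_on U \<rho> \<and>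
        (\<exists>j. pd j \<rho> p \<noteq> 0) \<and> \<Omega> \<inter> U = {x \<in> U. \<rho> x < 0})"

definition smooth_bounded_domain :: "(real^'n::finite) set \<Rightarrow> bool" where
  "smooth_bounded_domain \<Omega> \<longleftrightarrow>
     open \<Omega> \<and> connected \<Omega> \<and> \<Omega> \<noteq> {} \<and> bounded \<Omega> \<and> smooth_boundary \<Omega>"

text \<open>\<open>C\<^sup>1\<close> up to the boundary: the gradient extends continuously to the closure.\<close>

definition C1_closure :: "(real^'n) set \<Rightarrow> (real^'n::finite \<Rightarrow> real) \<Rightarrow> bool" where
  "C1_closure \<Omega> f \<longleftrightarrow>
     continuous_on (closure \<Omega>) f \<and>
     (\<exists>g. continuous_on (closure \<Omega>) g \<and> (\<forall>x\<in>\<Omega>. (f has_derivative (\<lambda>h. g x \<bullet> h)) (at x)))"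

section \<open>The space of square integrable functions\<close>

text \<open>Elements of \<open>L\<^sup>2(\<Omega>)\<close> are represented by functions, compared up to null sets.\<close>

definition L2 :: "'a::euclidean_space set \<Rightarrow> ('a \<Rightarrow> real) set" where
  "L2 \<Omega> = {f. f \<in> borel_measurable (lebesgue_on \<Omega>) \<and> integrable (lebesgue_on \<Omega>) (\<lambda>x. (f x)\<^sup>2)}"

definition L2_inner :: "'a::euclidean_space set \<Rightarrow> ('a \<Rightarrow> real) \<Rightarrow> ('a \<Rightarrow> real) \<Rightarrow> real" where
  "L2_inner \<Omega> f g = (LINT x|lebesgue_on \<Omega>. f x * g x)"

definition L2_norm :: "'a::euclidean_space set \<Rightarrow> ('a \<Rightarrow> real) \<Rightarrow> real" where
  "L2_norm \<Omega> f = sqrt (L2_inner \<Omega> f f)"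

definition L2_tendsto ::
  "'a::euclidean_space set \<Rightarrow> (nat \<Rightarrow> 'a \<Rightarrow> real) \<Rightarrow> ('a \<Rightarrow> real) \<Rightarrow> bool" where
  "L2_tendsto \<Omega> f g \<longleftrightarrow> (\<forall>k. f k \<in> L2 \<Omega>) \<and> g \<in> L2 \<Omega> \<and>
     (\<lambda>k. L2_norm \<Omega> (\<lambda>x. f k x - g x)) \<longlonglongrightarrow> 0"

definition L2_sums ::
  "'a::euclidean_space set \<Rightarrow> (nat \<Rightarrow> 'a \<Rightarrow> real) \<Rightarrow> ('a \<Rightarrow> real) \<Rightarrow> bool" where
  "L2_sums \<Omega> f g \<longleftrightarrow> L2_tendsto \<Omega> (\<lambda>N x. \<Sum>n<N. f n x) g"

text \<open>\<open>w\<close> is the integral over \<open>s \<in> S\<close> of the \<open>L\<^sup>2(\<Omega>)\<close>-valued function \<open>g\<close>. Vector-valued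
  integration is defined by duality; the value is unique up to null sets, and it is the Bochner
  integral whenever \<open>g\<close> is Bochner integrable.\<close>

definition has_L2_integral ::
  "'a::euclidean_space set \<Rightarrow> (real \<Rightarrow> 'a \<Rightarrow> real) \<Rightarrow> real set \<Rightarrow> ('a \<Rightarrow> real) \<Rightarrow> bool" where
  "has_L2_integral \<Omega> g S w \<longleftrightarrow>
     (AE s in lebesgue_on S. g s \<in> L2 \<Omega>) \<and> w \<in> L2 \<Omega> \<and>
     (\<forall>\<psi> \<in> L2 \<Omega>. has_bochner_integral (lebesgue_on S) (\<lambda>s. L2_inner \<Omega> (g s) \<psi>) (L2_inner \<Omega> w \<psi>))"

section \<open>Sobolev spaces and the elliptic operator\<close>

definition test_fun :: "(real^'n::finite) set \<Rightarrow> (real^'n \<Rightarrow> real) set" where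
  "test_fun \<Omega> = {\<psi>. smooth_on UNIV \<psi> \<and> compact (closure {x. \<psi> x \<noteq> 0}) \<and>
                     closure {x. \<psi> x \<noteq> 0} \<subseteq> \<Omega>}"

definition loc_integrable :: "(real^'n::finite) set \<Rightarrow> (real^'n \<Rightarrow> real) \<Rightarrow> bool" where
  "loc_integrable \<Omega> f \<longleftrightarrow> (\<forall>K. compact K \<and> K \<subseteq> \<Omega> \<longrightarrow> f absolutely_integrable_on K)"

definition has_weak_pd ::
  "(real^'n::finite) set \<Rightarrow> 'n \<Rightarrow> (real^'n \<Rightarrow> real) \<Rightarrow> (real^'n \<Rightarrow> real) \<Rightarrow> bool" where
  "has_weak_pd \<Omega> j f g \<longleftrightarrow> loc_integrable \<Omega> f \<and> loc_integrable \<Omega> g \<and>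
     (\<forall>\<psi> \<in> test_fun \<Omega>.
        (LINT x|lebesgue_on \<Omega>. f x * pd j \<psi> x) = - (LINT x|lebesgue_on \<Omega>. g x * \<psi> x))"

text \<open>Weak derivatives are unique up to null sets, so the choice is immaterial.\<close>

definition weak_pd ::
  "(real^'n::finite) set \<Rightarrow> 'n \<Rightarrow> (real^'n \<Rightarrow> real) \<Rightarrow> real^'n \<Rightarrow> real" where
  "weak_pd \<Omega> j f = (SOME g. has_weak_pd \<Omega> j f g)"

definition H1 :: "(real^'n::finite) set \<Rightarrow> (real^'n \<Rightarrow> real) set" where
  "H1 \<Omega> = {f \<in> L2 \<Omega>. \<forall>j. has_weak_pd \<Omega> j f (weak_pd \<Omega> j f) \<and> weak_pd \<Omega> j f \<in> L2 \<Omega>}"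

definition H2 :: "(real^'n::finite) set \<Rightarrow> (real^'n \<Rightarrow> real) set" where
  "H2 \<Omega> = {f \<in> H1 \<Omega>. \<forall>j. weak_pd \<Omega> j f \<in> H1 \<Omega>}"

text \<open>\<open>H\<^sup>1\<^sub>0(\<Omega>)\<close>, the functions vanishing on the boundary: the \<open>H\<^sup>1\<close>-closure of the test functions.\<close>

definition H10 :: "(real^'n::finite) set \<Rightarrow> (real^'n \<Rightarrow> real) set" where
  "H10 \<Omega> = {f \<in> H1 \<Omega>. \<exists>\<psi>. (\<forall>k. \<psi> k \<in> test_fun \<Omega>) \<and> L2_tendsto \<Omega> \<psi> f \<and>
                 (\<forall>j. L2_tendsto \<Omega> (\<lambda>k. pd j (\<psi> k)) (weak_pd \<Omega> j f))}"

definition elliptic_coeffs ::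
  "(real^'n::finite) set \<Rightarrow> ('n \<Rightarrow> 'n \<Rightarrow> real^'n \<Rightarrow> real) \<Rightarrow> (real^'n \<Rightarrow> real) \<Rightarrow> bool" where
  "elliptic_coeffs \<Omega> A c \<longleftrightarrow>
     (\<forall>i j. C1_closure \<Omega> (A i j)) \<and>
     (\<forall>i j. \<forall>x \<in> closure \<Omega>. A i j x = A j i x) \<and>
     continuous_on (closure \<Omega>) c \<and> (\<forall>x \<in> closure \<Omega>. c x \<ge> 0) \<and>
     (\<exists>\<delta>>0. \<forall>x \<in> closure \<Omega>. \<forall>\<xi>::real^'n.
        (\<Sum>i\<in>UNIV. \<Sum>j\<in>UNIV. A i j x * \<xi> $ i * \<xi> $ j) \<ge> \<delta> * (\<Sum>i\<in>UNIV. (\<xi> $ i)\<^sup>2))"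

definition op_domain :: "(real^'n::finite) set \<Rightarrow> (real^'n \<Rightarrow> real) set" where
  "op_domain \<Omega> = H2 \<Omega> \<inter> H10 \<Omega>"

text \<open>Meaningful for arguments in \<^term>\<open>op_domain \<Omega>\<close>.\<close>

definition elliptic_op ::
  "(real^'n::finite) set \<Rightarrow> ('n \<Rightarrow> 'n \<Rightarrow> real^'n \<Rightarrow> real) \<Rightarrow> (real^'n \<Rightarrow> real) \<Rightarrow>
   (real^'n \<Rightarrow> real) \<Rightarrow> real^'n \<Rightarrow> real" where
  "elliptic_op \<Omega> A c f x =
     - (\<Sum>i\<in>UNIV. \<Sum>j\<in>UNIV. weak_pd \<Omega> j (\<lambda>y. A i j y * weak_pd \<Omega> i f y) x) + c x * f x"

text \<open>Indices start from \<open>0\<close>: \<open>\<mu> n\<close> and \<open>\<phi> n\<close> are the \<open>(n+1)\<close>-st eigenvalue and eigenfunction.\<close>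

definition eigensystem ::
  "(real^'n::finite) set \<Rightarrow> ('n \<Rightarrow> 'n \<Rightarrow> real^'n \<Rightarrow> real) \<Rightarrow> (real^'n \<Rightarrow> real) \<Rightarrow>
   (nat \<Rightarrow> real) \<Rightarrow> (nat \<Rightarrow> real^'n \<Rightarrow> real) \<Rightarrow> bool" where
  "eigensystem \<Omega> A c \<mu> \<phi> \<longleftrightarrow>
     0 < \<mu> 0 \<and> \<mu> 0 < \<mu> 1 \<and> incseq \<mu> \<and> filterlim \<mu> at_top sequentially \<and>
     (\<forall>n. \<phi> n \<in> op_domain \<Omega> \<and> (AE x in lebesgue_on \<Omega>. elliptic_op \<Omega> A c (\<phi> n) x = \<mu> n * \<phi> n x)) \<and>
     (\<forall>n k. L2_inner \<Omega> (\<phi> n) (\<phi> k) = (if n = k then 1 else 0)) \<and>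
     (\<forall>f \<in> L2 \<Omega>. L2_sums \<Omega> (\<lambda>n x. L2_inner \<Omega> f (\<phi> n) * \<phi> n x) f)"

section \<open>The multinomial Mittag-Leffler function\<close>

definition multi_indices :: "nat \<Rightarrow> nat \<Rightarrow> (nat \<Rightarrow> nat) set" where
  "multi_indices m k = {\<kappa>. (\<forall>j. j \<notin> {1..m} \<longrightarrow> \<kappa> j = 0) \<and> (\<Sum>j=1..m. \<kappa> j) = k}"

text \<open>The type class covers both real and complex arguments \<open>z\<close>.\<close>

definition multinomial_ML ::
  "nat \<Rightarrow> (nat \<Rightarrow> real) \<Rightarrow> real \<Rightarrow> (nat \<Rightarrow> 'a::{real_normed_field,banach}) \<Rightarrow> 'a" where
  "multinomial_ML m \<beta> \<beta>0 z =
     (\<Sum>k. \<Sum>\<kappa>\<in>multi_indices m k.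
        (fact k / (\<Prod>j=1..m. fact (\<kappa> j))) *
        ((\<Prod>j=1..m. z j ^ \<kappa> j) / of_real (Gamma (\<beta>0 + (\<Sum>j=1..m. real (\<kappa> j) * \<beta> j)))))"

text \<open>The function of \<open>t\<close> attached to the eigenvalue \<open>\<nu>\<close> of the elliptic operator.\<close>

definition mode_ML ::
  "nat \<Rightarrow> (nat \<Rightarrow> real) \<Rightarrow> (nat \<Rightarrow> real) \<Rightarrow> real \<Rightarrow> real \<Rightarrow> real \<Rightarrow> real" where
  "mode_ML m \<alpha> q \<nu> \<beta> t =
     multinomial_ML m (\<lambda>j. if j = 1 then \<alpha> 1 else \<alpha> 1 - \<alpha> j) \<beta>
       (\<lambda>j. if j = 1 then - \<nu> * t powr \<alpha> 1 else - q j * t powr (\<alpha> 1 - \<alpha> j))"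

section \<open>The solution of the initial-boundary value problem\<close>

text \<open>For a source that is merely bounded in time, \<open>w(t)\<close> need not be absolutely continuous, so the
  formula \<open>1/\<Gamma>(1-\<alpha>) \<integral>\<^sub>0\<^sup>t f'(s) (t-s)\<^sup>-\<^sup>\<alpha> ds\<close> for the Caputo derivative does not
  apply to it literally. The solution \<open>u = v + w\<close> is therefore given by its eigenfunction
  expansion: \<open>v\<close> solves the problem with initial value \<open>a\<close> and zero source, and \<open>w\<close> the problem with
  zero initial value and source \<open>F\<close>. The equation and the boundary condition enter through the
  eigensystem of the operator with domain \<open>H\<^sup>2(\<Omega>) \<inter> H\<^sup>1\<^sub>0(\<Omega>)\<close>.\<close>

definition homogeneous_solution ::
  "(real^'n::finite) set \<Rightarrow> nat \<Rightarrow> (nat \<Rightarrow> real) \<Rightarrow> (nat \<Rightarrow> real) \<Rightarrow>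
   (nat \<Rightarrow> real) \<Rightarrow> (nat \<Rightarrow> real^'n \<Rightarrow> real) \<Rightarrow>
   (real^'n \<Rightarrow> real) \<Rightarrow> (real^'n \<Rightarrow> real \<Rightarrow> real) \<Rightarrow> bool" where
  "homogeneous_solution \<Omega> m \<alpha> q \<mu> \<phi> a v \<longleftrightarrow>
     (\<lambda>(x, t). v x t) \<in> borel_measurable (lebesgue_on (\<Omega> \<times> {0<..})) \<and>
     (\<forall>t>0. L2_sums \<Omega>
        (\<lambda>n x. (1 - \<mu> n * t powr \<alpha> 1 * mode_ML m \<alpha> q (\<mu> n) (1 + \<alpha> 1) t) *
               L2_inner \<Omega> a (\<phi> n) * \<phi> n x)
        (\<lambda>x. v x t))"

definition source_solution ::
  "(real^'n::finite) set \<Rightarrow> nat \<Rightarrow> (nat \<Rightarrow> real) \<Rightarrow> (nat \<Rightarrow> real) \<Rightarrow>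
   (nat \<Rightarrow> real) \<Rightarrow> (nat \<Rightarrow> real^'n \<Rightarrow> real) \<Rightarrow>
   (real^'n \<Rightarrow> real \<Rightarrow> real) \<Rightarrow> (real^'n \<Rightarrow> real \<Rightarrow> real) \<Rightarrow> bool" where
  "source_solution \<Omega> m \<alpha> q \<mu> \<phi> F w \<longleftrightarrow>
     (\<lambda>(x, t). w x t) \<in> borel_measurable (lebesgue_on (\<Omega> \<times> {0<..})) \<and>
     (\<forall>t>0. \<exists>g.
        (AE s in lebesgue_on {0<..<t}. L2_sums \<Omega>
           (\<lambda>n x. s powr (\<alpha> 1 - 1) * mode_ML m \<alpha> q (\<mu> n) (\<alpha> 1) s *
                  L2_inner \<Omega> (\<lambda>y. F y (t - s)) (\<phi> n) * \<phi> n x)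
           (g s)) \<and>
        has_L2_integral \<Omega> g {0<..<t} (\<lambda>x. w x t))"

text \<open>A solution is a function on \<open>\<Omega> \<times> (0,\<infinity>)\<close> determined up to null sets.\<close>

definition ibvp_solution ::
  "(real^'n::finite) set \<Rightarrow> nat \<Rightarrow> (nat \<Rightarrow> real) \<Rightarrow> (nat \<Rightarrow> real) \<Rightarrow>
   (nat \<Rightarrow> real) \<Rightarrow> (nat \<Rightarrow> real^'n \<Rightarrow> real) \<Rightarrow>
   (real^'n \<Rightarrow> real) \<Rightarrow> (real^'n \<Rightarrow> real \<Rightarrow> real) \<Rightarrow> (real^'n \<Rightarrow> real \<Rightarrow> real) \<Rightarrow> bool" where
  "ibvp_solution \<Omega> m \<alpha> q \<mu> \<phi> a F u \<longleftrightarrow>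
     (\<exists>v w. homogeneous_solution \<Omega> m \<alpha> q \<mu> \<phi> a v \<and> source_solution \<Omega> m \<alpha> q \<mu> \<phi> F w \<and>
        (AE (x, t) in lebesgue_on (\<Omega> \<times> {0<..}). u x t = v x t + w x t))"

text \<open>The space \<open>L\<^sup>\<infinity>(0,\<infinity>;L\<^sup>2(\<Omega>))\<close>. Since \<open>L\<^sup>2(\<Omega>)\<close> is separable, strong measurability amounts to
  having a jointly measurable representative.\<close>

definition Linf_L2 :: "(real^'n::finite) set \<Rightarrow> (real^'n \<Rightarrow> real \<Rightarrow> real) set" where
  "Linf_L2 \<Omega> = {F. (\<lambda>(x, t). F x t) \<in> borel_measurable (lebesgue_on (\<Omega> \<times> {0<..})) \<and>
     (\<exists>C. AE t in lebesgue_on {0<..}. (\<lambda>x. F x t) \<in> L2 \<Omega> \<and> L2_norm \<Omega> (\<lambda>x. F x t) \<le> C)}"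

end

theory Submission
  imports Defs
begin

text \<open>
  Every multiplier of the eigenfunction expansion, \<open>\<rho>(\<nu>) = 1 - \<nu> t\<^sup>\<alpha>\<^sup>1 E(t)\<close> for the initial value and
  \<open>\<rho>(\<nu>) = t\<^sup>\<alpha>\<^sup>1\<^sup>-\<^sup>1 E(t)\<close> for the source, is for fixed \<open>t\<close> a pointwise limit of positive combinations of
  \<open>(p + \<nu>)\<^sup>-\<^sup>l\<^sup>-\<^sup>1\<close>: approximate the powers of \<open>t\<close> by the coefficients of \<open>(1 - X)\<^sup>-\<^sup>b\<close> (the convolution
  quadrature of the backward Euler method); the generating functions then are resolvents
  \<open>(\<nu> + g0 - N(X))\<^sup>-\<^sup>1\<close>, where \<open>N\<close> has non-negative coefficients. Such \<open>\<rho>\<close> are log-convex in the sense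
  \<open>\<rho>(\<nu>/2)\<^sup>2 \<le> \<rho>(0) \<rho>(\<nu>)\<close>, so the first of them cannot vanish.

  The resolvents of the elliptic operator preserve non-negativity: test the equation with a smooth
  truncation of the negative part of the solution. Hence so do all multipliers \<open>\<rho>\<close>, which gives
  \<open>v \<ge> 0\<close> and, by duality, \<open>w \<ge> 0\<close>. Strict positivity of \<open>v(t)\<close> needs no strong maximum principle: let
  \<open>\<eta>\<close> be the indicator of its zero set. As \<open>a > 0\<close> and the solution operator is symmetric and
  positive, it annihilates \<open>\<eta>\<close>; but it is injective, since its multiplier has no zeros.
\<close>

section \<open>Multinomial expansions and negative binomial series\<close>


text \<open>The quadrature stands in for Laplace transforms. The series
  \<open>neg_binomial b\<close> multiply by adding exponents, just as the kernels
  t^(b-1)/\<Gamma>(b) convolve, so for each step size the multinomial series becomes a geometric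
  series of power series, and its sign can be read off coefficients. Analysis enters through
  dominated limits: over the step size for fixed \<nu>, and over the eigenvalues for fixed
  functions. On the elliptic side the operator is known on the eigenfunctions only. The resolvent of
  f is never realised as a function; there are only partial sums of its expansion, which have no
  sign. So positivity is stated for series of products of coefficients of two functions, and the
  failure of the partial sums is measured by the norm of their negative parts. Mollification is
  developed because a coefficient of class C^1 times a test function is no longer a test function.
  The positivity of u is obtained at each single time. Null sets at all times combine into a null
  set of space-time only for a measurable set, so the joint measurability of v and w matters at the
  end.\<close>

notation fps_nth (infixl "$$" 75)

section \<open>The multinomial theorem over \<open>multi_indices\<close>\<close>

lemma multi_indices_0: "multi_indices 0 k = (if k = 0 then {\<lambda>_. 0} else {})"
  by (auto simp: multi_indices_def)

lemma multi_indices_Suc: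
  "multi_indices (Suc m) k =
     (\<lambda>(i, \<kappa>). \<kappa>(Suc m := i)) ` (SIGMA i:{..k}. multi_indices m (k - i))"
proof (intro equalityI subsetI)
  fix \<kappa> assume k: "\<kappa> \<in> multi_indices (Suc m) k"
  define i where "i = \<kappa> (Suc m)"
  have s: "(\<Sum>j=1..m. \<kappa> j) + i = k" using k by (auto simp: multi_indices_def i_def)
  have e: "(\<Sum>j=1..m. (\<kappa>(Suc m := 0)) j) = (\<Sum>j=1..m. \<kappa> j)" by (rule sum.cong) auto
  have "\<kappa>(Suc m := 0) \<in> multi_indices m (k - i)"
    using k s e by (auto simp: multi_indices_def)
  moreover have "i \<le> k" using s by simp
  ultimately show "\<kappa> \<in> (\<lambda>(i, \<kappa>). \<kappa>(Suc m := i)) ` (SIGMA i:{..k}. multi_indices m (k - i))"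
    by (intro image_eqI[where x="(i, \<kappa>(Suc m := 0))"]) (auto simp: i_def)
next
  fix \<kappa> assume "\<kappa> \<in> (\<lambda>(i, \<kappa>). \<kappa>(Suc m := i)) ` (SIGMA i:{..k}. multi_indices m (k - i))"
  then obtain i \<kappa>' where *: "i \<le> k" "\<kappa>' \<in> multi_indices m (k - i)" "\<kappa> = \<kappa>'(Suc m := i)" by auto
  have e: "(\<Sum>j=1..m. (\<kappa>'(Suc m := i)) j) = (\<Sum>j=1..m. \<kappa>' j)" by (rule sum.cong) auto
  show "\<kappa> \<in> multi_indices (Suc m) k" using * e by (auto simp: multi_indices_def)
qed

lemma finite_multi_indices [simp]: "finite (multi_indices m k)"
  by (induction m arbitrary: k) (auto simp: multi_indices_0 multi_indices_Suc)

text \<open>The coefficients are real quotients of factorials, and \<open>c\<close> carries them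
  into the ring: it is the identity in \<open>multinomial_sum_bound\<close> and
  \<open>fps_const\<close> in \<open>mittag_leffler_symbol_power_nth\<close>. Induction on
  \<open>m\<close> splits off the last summand by the binomial theorem, with
  \<open>multi_indices_Suc\<close> recording its exponent.\<close>

lemma multinomial_theorem:
  fixes x :: "nat \<Rightarrow> 'a::comm_ring_1" and c :: "real \<Rightarrow> 'a"
  assumes c1: "\<And>a b. c (a * b) = c a * c b" and c2: "\<And>n. c (of_nat n) = of_nat n"
  shows "(\<Sum>j=1..m. x j) ^ k =
    (\<Sum>\<kappa>\<in>multi_indices m k. c (fact k / (\<Prod>j=1..m. fact (\<kappa> j))) * (\<Prod>j=1..m. x j ^ \<kappa> j))"
proof (induction m arbitrary: k)
  case 0
  show ?case using c2[of 1] by (simp add: multi_indices_0 power_0_left)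
next
  case (Suc m)
  have inj: "inj_on (\<lambda>(i, \<kappa>). \<kappa>(Suc m := i)) (SIGMA i:{..k}. multi_indices m (k - i))"
  proof (rule inj_onI, clarsimp)
    fix i i' \<kappa> \<kappa>' assume a: "\<kappa> \<in> multi_indices m (k - i)" "\<kappa>' \<in> multi_indices m (k - i')"
      and e: "\<kappa>(Suc m := i) = \<kappa>'(Suc m := i')"
    have i: "i = i'" using fun_cong[OF e, of "Suc m"] by simp
    have "\<kappa> j = \<kappa>' j" for j
      using fun_cong[OF e, of j] a by (cases "j = Suc m") (auto simp: multi_indices_def)
    with i show "i = i' \<and> \<kappa> = \<kappa>'" by auto
  qed
  have "(\<Sum>j=1..Suc m. x j) ^ k = (x (Suc m) + (\<Sum>j=1..m. x j)) ^ k"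
    by (simp add: add.commute)
  also have "\<dots> = (\<Sum>i\<le>k. of_nat (k choose i) * x (Suc m) ^ i * (\<Sum>j=1..m. x j) ^ (k - i))"
    by (rule binomial_ring)
  also have "\<dots> = (\<Sum>i\<le>k. \<Sum>\<kappa>\<in>multi_indices m (k - i).
      of_nat (k choose i) * x (Suc m) ^ i * (c (fact (k - i) / (\<Prod>j=1..m. fact (\<kappa> j))) * (\<Prod>j=1..m. x j ^ \<kappa> j)))"
    by (simp only: Suc sum_distrib_left)
  also have "\<dots> = (\<Sum>(i, \<kappa>)\<in>(SIGMA i:{..k}. multi_indices m (k - i)).
      of_nat (k choose i) * x (Suc m) ^ i * (c (fact (k - i) / (\<Prod>j=1..m. fact (\<kappa> j))) * (\<Prod>j=1..m. x j ^ \<kappa> j)))"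
    by (rule sum.Sigma) auto
  also have "\<dots> = (\<Sum>(i, \<kappa>)\<in>(SIGMA i:{..k}. multi_indices m (k - i)).
      c (fact k / (\<Prod>j=1..Suc m. fact ((\<kappa>(Suc m := i)) j))) * (\<Prod>j=1..Suc m. x j ^ (\<kappa>(Suc m := i)) j))"
  proof (rule sum.cong[OF refl], goal_cases)
    case (1 p)
    then obtain i \<kappa> where p: "p = (i, \<kappa>)" and i: "i \<in> {..k}" "\<kappa> \<in> multi_indices m (k - i)"
      by (cases p) auto
    have p1: "(\<Prod>j=1..m. fact ((\<kappa>(Suc m := i)) j)) = (\<Prod>j=1..m. fact (\<kappa> j) :: real)"
      by (rule prod.cong) auto
    have p2: "(\<Prod>j=1..m. x j ^ (\<kappa>(Suc m := i)) j) = (\<Prod>j=1..m. x j ^ \<kappa> j)"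
      by (rule prod.cong) auto
    have "fact k / (\<Prod>j=1..Suc m. fact ((\<kappa>(Suc m := i)) j)) =
      of_nat (k choose i) * (fact (k - i) / (\<Prod>j=1..m. fact (\<kappa> j)) :: real)"
      using i p1 by (simp add: binomial_fact)
    then have ceq: "c (fact k / (\<Prod>j=1..Suc m. fact ((\<kappa>(Suc m := i)) j))) =
      of_nat (k choose i) * c (fact (k - i) / (\<Prod>j=1..m. fact (\<kappa> j)))"
      by (simp only: c1 c2)
    have e3: "(\<Prod>j=1..Suc m. x j ^ (\<kappa>(Suc m := i)) j) = (\<Prod>j=1..m. x j ^ \<kappa> j) * x (Suc m) ^ i"
      using p2 by simp
    show ?case
      unfolding p prod.case e3 ceq by (simp only: mult_ac)
  qed
  also have "\<dots> = (\<Sum>\<kappa>\<in>multi_indices (Suc m) k.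
      c (fact k / (\<Prod>j=1..Suc m. fact (\<kappa> j))) * (\<Prod>j=1..Suc m. x j ^ \<kappa> j))"
    unfolding multi_indices_Suc sum.reindex[OF inj] by (simp add: case_prod_unfold o_def)
  finally show ?case .
qed

text \<open>The expansion of \<open>(1 - X)\<^sup>-\<^sup>b\<close>.\<close>

definition neg_binomial :: "real \<Rightarrow> real fps" where
  "neg_binomial b = Abs_fps (\<lambda>n. pochhammer b n / fact n)"

lemma neg_binomial_nth: "neg_binomial b $$ n = (-1) ^ n * ((- b) gchoose n)"
  by (simp add: neg_binomial_def gbinomial_pochhammer)

lemma neg_binomial_nth_0 [simp]: "neg_binomial b $$ 0 = 1"
  by (simp add: neg_binomial_def)

text \<open>Vandermonde's convolution at the upper indices -a and -b, the signs combining to (-1)^n.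
  This is the discrete form of the semigroup law for fractional integrals.\<close>

lemma neg_binomial_mult: "neg_binomial a * neg_binomial b = neg_binomial (a + b)"
proof (rule fps_ext)
  fix n
  have "(neg_binomial a * neg_binomial b) $$ n = (\<Sum>i=0..n. ((-1) ^ i * ((- a) gchoose i)) * ((-1) ^ (n - i) * ((- b) gchoose (n - i))))"
    by (simp add: fps_mult_nth neg_binomial_nth)
  also have "\<dots> = (\<Sum>i=0..n. (-1) ^ n * (((- a) gchoose i) * ((- b) gchoose (n - i))))"
  proof (rule sum.cong[OF refl])
    fix i assume "i \<in> {0..n}"
    then have "(-1::real) ^ n = (-1) ^ i * (-1) ^ (n - i)" by (simp flip: power_add)
    then show "((-1) ^ i * ((- a) gchoose i)) * ((-1) ^ (n - i) * ((- b) gchoose (n - i)))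
      = (-1) ^ n * (((- a) gchoose i) * ((- b) gchoose (n - i)))" by simp
  qed
  also have "\<dots> = neg_binomial (a + b) $$ n"
    using gbinomial_Vandermonde[of "- a" "- b" n]
    by (simp add: neg_binomial_nth atLeast0AtMost flip: sum_distrib_left)
  finally show "(neg_binomial a * neg_binomial b) $$ n = neg_binomial (a + b) $$ n" .
qed

lemma neg_binomial_0 [simp]: "neg_binomial 0 = 1"
  by (rule fps_ext) (auto simp: neg_binomial_def pochhammer_0_left)

lemma neg_binomial_1_nth: "neg_binomial 1 $$ n = 1"
  by (simp add: neg_binomial_def pochhammer_fact[symmetric])

lemma neg_binomial_power: "neg_binomial b ^ n = neg_binomial (of_nat n * b)"
  by (induction n) (auto simp: neg_binomial_mult algebra_simps)

lemma neg_binomial_prod: "finite A \<Longrightarrow> (\<Prod>j\<in>A. neg_binomial (b j)) = neg_binomial (\<Sum>j\<in>A. b j)"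
  by (induction A rule: finite_induct) (auto simp: neg_binomial_mult)

lemma neg_binomial_nonneg: "b \<ge> 0 \<Longrightarrow> neg_binomial b $$ n \<ge> 0"
  by (cases "b = 0") (auto simp: neg_binomial_def pochhammer_0_left pochhammer_nonneg)

text \<open>The product \<open>pochhammer (- a) n\<close> has exactly one negative factor, the
  first, because 1 - a > 0. So (1 - X)^a is 1 minus a series with non-negative coefficients; the
  sign of \<open>N\<close> below rests on this.\<close>

lemma neg_binomial_neg_nonpos:
  assumes "0 < a" "a < 1" "n > 0" shows "neg_binomial (- a) $$ n \<le> 0"
proof -
  obtain k where n: "n = Suc k" using assms by (cases n) auto
  have "pochhammer (- a) n = - a * pochhammer (1 - a) k"
    by (simp add: n pochhammer_rec)
  moreover have "pochhammer (1 - a) k \<ge> 0" using assms by (intro pochhammer_nonneg) auto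
  ultimately show ?thesis using assms by (simp add: neg_binomial_def divide_le_0_iff mult_nonneg_nonneg)
qed

section \<open>Bounds and asymptotics for the coefficients of (1 - X)^(-b)\<close>

lemma neg_binomial_partial_sum_le:
  assumes "b \<ge> 0" "0 < x" "x < 1"
  shows "(\<Sum>i\<le>n. neg_binomial b $$ i * x ^ i) \<le> (1 - x) powr (- b)"
proof -
  have "(\<lambda>n. ((- b) gchoose n) * (- x) ^ n) sums (1 + (- x)) powr (- b)"
    using assms by (intro gen_binomial_real) auto
  also have "(\<lambda>n. ((- b) gchoose n) * (- x) ^ n) = (\<lambda>n. neg_binomial b $$ n * x ^ n)"
    by (rule ext) (simp add: neg_binomial_nth power_minus[of x] mult_ac)
  finally have s: "(\<lambda>n. neg_binomial b $$ n * x ^ n) sums (1 - x) powr (- b)" by simp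
  show ?thesis
    using sum_le_suminf[OF sums_summable[OF s], of "{..n}"] sums_unique[OF s] assms
    by (auto simp: neg_binomial_nonneg)
qed

text \<open>A Cauchy estimate: one non-negative term of the series at \<open>x\<close> is at most
  the whole sum. Dividing by x^n instead of x^i makes the bound uniform over
  \<open>i \<le> n\<close>.\<close>

lemma neg_binomial_nth_le:
  assumes "b \<ge> 0" "0 < x" "x < 1" "i \<le> n"
  shows "neg_binomial b $$ i \<le> (1 - x) powr (- b) / x ^ n"
proof -
  have "neg_binomial b $$ i * x ^ n \<le> neg_binomial b $$ i * x ^ i"
    using assms by (intro mult_left_mono power_decreasing neg_binomial_nonneg) auto
  also have "\<dots> \<le> (\<Sum>i\<le>n. neg_binomial b $$ i * x ^ i)"
    using assms by (intro member_le_sum) (auto simp: neg_binomial_nonneg)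
  also have "\<dots> \<le> (1 - x) powr (- b)" using assms by (intro neg_binomial_partial_sum_le) auto
  finally show ?thesis using assms by (simp add: field_simps)
qed

lemma neg_binomial_Suc: "neg_binomial b $$ (Suc n) = b / real (Suc n) * neg_binomial (b + 1) $$ n"
  by (simp add: neg_binomial_def pochhammer_rec field_simps)

lemma neg_binomial_plus1_nth: "neg_binomial (b + 1) $$ n = (\<Sum>i\<le>n. neg_binomial b $$ i)"
  by (simp add: fps_mult_nth neg_binomial_1_nth atLeast0AtMost flip: neg_binomial_mult)

text \<open>The plain Cauchy estimate is too weak by a factor n. Here the coefficient is b/(n+1)
  times a partial sum of the coefficients of (1 - X)^(-b), and that whole partial sum still obeys
  the Cauchy bound.\<close>

lemma neg_binomial_Suc_le:
  assumes "b \<ge> 0" "0 < x" "x < 1"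
  shows "neg_binomial b $$ (Suc n) \<le> b / real (Suc n) * ((1 - x) powr (- b) / x ^ n)"
proof -
  have "neg_binomial (b + 1) $$ n * x ^ n \<le> (\<Sum>i\<le>n. neg_binomial b $$ i * x ^ i)"
    unfolding neg_binomial_plus1_nth sum_distrib_right using assms
    by (intro sum_mono mult_left_mono power_decreasing neg_binomial_nonneg) auto
  also have "\<dots> \<le> (1 - x) powr (- b)" using assms by (intro neg_binomial_partial_sum_le) auto
  finally have "neg_binomial (b + 1) $$ n \<le> (1 - x) powr (- b) / x ^ n"
    using assms by (simp add: field_simps)
  then show ?thesis unfolding neg_binomial_Suc using assms
    by (intro mult_left_mono) auto
qed

lemma exp_le_inverse_one_minus:
  assumes "0 \<le> (y::real)" "y \<le> 1/2" shows "1 \<le> exp (2 * y) * (1 - y)"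
proof -
  have "1 \<le> (1 + 2 * y) * (1 - y)" using assms by (simp add: algebra_simps mult_left_mono) 
     (use assms mult_left_mono[of y "1/2" y] in linarith)
  also have "\<dots> \<le> exp (2 * y) * (1 - y)" using assms exp_ge_add_one_self[of "2*y"]
    by (intro mult_right_mono) auto
  finally show ?thesis .
qed

text \<open>The series is evaluated at 1 - \<theta>/n. The dependence on \<open>b\<close> has to be
  explicit, since \<open>b\<close> later grows with the order of the series term; the free parameter
  \<theta> then turns \<theta>^(-b) into geometric decay.\<close>

lemma neg_binomial_growth:
  assumes "b > 0" "\<theta> > 0" "n > 0" "2 * \<theta> \<le> real n"
  shows "neg_binomial b $$ n \<le> b * \<theta> powr (- b) * exp (2 * \<theta>) * real n powr (b - 1)"
proof -
  define y where "y = \<theta> / real n"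
  have y: "0 < y" "y \<le> 1/2" using assms by (auto simp: y_def field_simps)
  obtain k where n: "n = Suc k" using assms by (cases n) auto
  have "1 \<le> (exp (2 * y) * (1 - y)) ^ n"
    using exp_le_inverse_one_minus[of y] y by (intro one_le_power) auto
  also have "\<dots> = exp (2 * \<theta>) * (1 - y) ^ n"
    using assms by (simp add: power_mult_distrib exp_of_nat_mult[symmetric] y_def)
  also have "\<dots> \<le> exp (2 * \<theta>) * (1 - y) ^ k"
    using y by (intro mult_left_mono power_decreasing) (auto simp: n)
  finally have e: "1 / (1 - y) ^ k \<le> exp (2 * \<theta>)" using y by (simp add: field_simps)
  have "neg_binomial b $$ n \<le> b / real n * ((1 - (1 - y)) powr (- b) / (1 - y) ^ k)"
    unfolding n using assms y by (intro neg_binomial_Suc_le) auto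
  also have "\<dots> = b / real n * (y powr (- b) * (1 / (1 - y) ^ k))" by simp
  also have "\<dots> \<le> b / real n * (y powr (- b) * exp (2 * \<theta>))"
    using assms by (intro mult_left_mono e) auto
  also have "\<dots> = b * \<theta> powr (- b) * exp (2 * \<theta>) * real n powr (b - 1)"
    using assms by (simp add: y_def powr_divide powr_minus powr_diff field_simps)
  finally show ?thesis .
qed

lemma neg_binomial_asymp:
  assumes "b > 0"
  shows "(\<lambda>n. neg_binomial b $$ n * real n powr (1 - b)) \<longlonglongrightarrow> 1 / Gamma b"
proof -
  have 1: "(\<lambda>n. inverse (Gamma_series b n)) \<longlonglongrightarrow> inverse (Gamma b)"
    using Gamma_real_pos[OF assms] by (intro tendsto_intros) simp
  \<comment> \<open>\<open>Gamma_series\<close> contains the Pochhammer symbol of length n + 1; this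
    factor cancels its last factor b + n.\<close>
  have 2: "(\<lambda>n. real n / (real n + b)) \<longlonglongrightarrow> 1" 
  proof -
    have "(\<lambda>n. 1 / (1 + b * inverse (real n))) \<longlonglongrightarrow> 1 / (1 + b * 0)"
      by (intro tendsto_intros lim_inverse_n) auto
    moreover have "eventually (\<lambda>n. 1 / (1 + b * inverse (real n)) = real n / (real n + b)) sequentially"
      using eventually_gt_at_top[of 0] by eventually_elim (simp add: field_simps)
    ultimately show ?thesis by (simp add: tendsto_cong)
  qed
  have "(\<lambda>n. inverse (Gamma_series b n) * (real n / (real n + b))) \<longlonglongrightarrow> inverse (Gamma b) * 1"
    by (intro tendsto_mult 1 2)
  moreover have "eventually (\<lambda>n. inverse (Gamma_series b n) * (real n / (real n + b)) =
     neg_binomial b $$ n * real n powr (1 - b)) sequentially"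
    using eventually_gt_at_top[of 0]
  proof eventually_elim
    case (elim n)
    define f E P where "f = (fact n :: real)" and "E = exp (b * ln (real n))" and "P = pochhammer b n"
    have "E > 0" "f > 0" by (auto simp: E_def f_def)
    then have "inverse (f * E / (P * (b + real n))) * (real n / (real n + b)) = P / f * (real n / E)"
      using assms elim by (simp add: divide_simps)
    moreover have "real n powr (1 - b) = real n / E"
      using elim by (simp add: powr_def E_def left_diff_distrib exp_diff)
    ultimately show ?case
      by (simp add: Gamma_series_def neg_binomial_def pochhammer_Suc f_def E_def P_def)
  qed
  ultimately show ?thesis by (simp add: inverse_eq_divide tendsto_cong)
qed

section \<open>The Mittag-Leffler function as a limit of power series coefficients\<close>


definition multinomial_weight :: "nat \<Rightarrow> nat \<Rightarrow> (nat \<Rightarrow> nat) \<Rightarrow> real" where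
  "multinomial_weight m k \<kappa> = fact k / (\<Prod>j=1..m. fact (\<kappa> j))"

definition index_weight :: "nat \<Rightarrow> (nat \<Rightarrow> real) \<Rightarrow> (nat \<Rightarrow> nat) \<Rightarrow> real" where
  "index_weight m \<beta> \<kappa> = (\<Sum>j=1..m. real (\<kappa> j) * \<beta> j)"

text \<open>With \<open>h = t / n\<close>, the \<open>n\<close>-th coefficient of \<open>h\<^sup>b\<^sup>-\<^sup>1 (1 - X)\<^sup>-\<^sup>b\<close> tends to \<open>t\<^sup>b\<^sup>-\<^sup>1 / \<Gamma>(b)\<close>. So the multinomial
  Mittag-Leffler series is the limit of a geometric series in the following power series.\<close>

definition mittag_leffler_symbol :: "nat \<Rightarrow> (nat \<Rightarrow> real) \<Rightarrow> (nat \<Rightarrow> real) \<Rightarrow> real \<Rightarrow> real fps" where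
  "mittag_leffler_symbol m \<beta> z h = (\<Sum>j=1..m. fps_const (z j * h powr \<beta> j) * neg_binomial (\<beta> j))"

lemma fps_const_power_prod:
  "finite A \<Longrightarrow> (\<Prod>j\<in>A. fps_const (w j) ^ k j) = fps_const (\<Prod>j\<in>A. w j ^ k j :: real)"
  by (induction A rule: finite_induct) auto

text \<open>The k-th power of the symbol yields the order-k block of the Mittag-Leffler series: for
  each multi-index the factors merge by \<open>neg_binomial_mult\<close> into one series, whose
  exponent \<open>b + index_weight m \<beta> \<kappa>\<close> is the argument of Gamma in that
  block.\<close>

lemma mittag_leffler_symbol_power_nth:
  "(neg_binomial b * mittag_leffler_symbol m \<beta> z h ^ k) $$ i =
    (\<Sum>\<kappa>\<in>multi_indices m k. multinomial_weight m k \<kappa> *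
       ((\<Prod>j=1..m. (z j * h powr \<beta> j) ^ \<kappa> j) * neg_binomial (b + index_weight m \<beta> \<kappa>) $$ i))"
proof -
  have "mittag_leffler_symbol m \<beta> z h ^ k = (\<Sum>\<kappa>\<in>multi_indices m k. fps_const (multinomial_weight m k \<kappa>) *
      (\<Prod>j=1..m. (fps_const (z j * h powr \<beta> j) * neg_binomial (\<beta> j)) ^ \<kappa> j))"
    unfolding mittag_leffler_symbol_def multinomial_weight_def
    by (rule multinomial_theorem) (auto simp: fps_of_nat)
  also have "\<dots> = (\<Sum>\<kappa>\<in>multi_indices m k. fps_const (multinomial_weight m k \<kappa>) *
      (fps_const (\<Prod>j=1..m. (z j * h powr \<beta> j) ^ \<kappa> j) * neg_binomial (index_weight m \<beta> \<kappa>)))"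
  proof (intro sum.cong refl arg_cong2[where f="(*)"])
    fix \<kappa>
    show "(\<Prod>j=1..m. (fps_const (z j * h powr \<beta> j) * neg_binomial (\<beta> j)) ^ \<kappa> j) =
      fps_const (\<Prod>j=1..m. (z j * h powr \<beta> j) ^ \<kappa> j) * neg_binomial (index_weight m \<beta> \<kappa>)"
    proof -
      define w where "w = (\<lambda>j. z j * h powr \<beta> j)"
      show ?thesis unfolding w_def[symmetric]
        by (simp only: power_mult_distrib prod.distrib neg_binomial_power fps_const_power_prod
            neg_binomial_prod finite_atLeastAtMost index_weight_def)
    qed
  qed
  finally have e: "neg_binomial b * mittag_leffler_symbol m \<beta> z h ^ k = (\<Sum>\<kappa>\<in>multi_indices m k.
      fps_const (multinomial_weight m k \<kappa> * (\<Prod>j=1..m. (z j * h powr \<beta> j) ^ \<kappa> j)) *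
      neg_binomial (b + index_weight m \<beta> \<kappa>))"
    by (simp add: sum_distrib_left mult_ac flip: neg_binomial_mult fps_const_mult)
  show ?thesis unfolding e by (simp add: fps_sum_nth mult_ac)
qed

lemma multinomial_weight_nonneg: "multinomial_weight m k \<kappa> \<ge> 0"
  by (simp add: multinomial_weight_def prod_nonneg)

text \<open>A product bound for each multi-index resums, by the multinomial theorem, to a geometric
  bound in \<open>k\<close>.\<close>

lemma multinomial_sum_bound:
  assumes "\<And>\<kappa>. \<kappa> \<in> multi_indices m k \<Longrightarrow> \<bar>\<Phi> \<kappa>\<bar> \<le> C * (\<Prod>j=1..m. y j ^ \<kappa> j)"
  shows "\<bar>\<Sum>\<kappa>\<in>multi_indices m k. multinomial_weight m k \<kappa> * \<Phi> \<kappa>\<bar> \<le> C * (\<Sum>j=1..m. y j) ^ k"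
proof -
  have "(\<Sum>j=1..m. y j) ^ k = (\<Sum>\<kappa>\<in>multi_indices m k. multinomial_weight m k \<kappa> * (\<Prod>j=1..m. y j ^ \<kappa> j))"
    unfolding multinomial_weight_def using multinomial_theorem[of "\<lambda>x. x" y m k] by simp
  then have *: "C * (\<Sum>j=1..m. y j) ^ k =
      (\<Sum>\<kappa>\<in>multi_indices m k. multinomial_weight m k \<kappa> * (C * (\<Prod>j=1..m. y j ^ \<kappa> j)))"
    by (simp add: sum_distrib_left mult_ac)
  show ?thesis unfolding *
    using assms by (intro order_trans[OF sum_abs] sum_mono)
      (auto simp: abs_mult multinomial_weight_nonneg intro!: mult_left_mono)
qed

lemma prod_powr_index_weight:
  assumes "h > 0"
  shows "(\<Prod>j=1..m. (z j * h powr \<beta> j) ^ \<kappa> j) = (\<Prod>j=1..m. z j ^ \<kappa> j) * h powr index_weight m \<beta> \<kappa>"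
proof -
  have "(\<Prod>j=1..m. (h powr \<beta> j) ^ \<kappa> j) = h powr index_weight m \<beta> \<kappa>"
    using assms by (simp add: index_weight_def powr_sum mult.commute flip: powr_powr powr_realpow)
  then show ?thesis by (simp add: power_mult_distrib prod.distrib)
qed

lemma index_weight_nonneg: "(\<And>j. j \<in> {1..m} \<Longrightarrow> \<beta> j \<ge> 0) \<Longrightarrow> index_weight m \<beta> \<kappa> \<ge> 0"
  by (auto simp: index_weight_def intro!: sum_nonneg)

lemma index_weight_le:
  assumes "\<And>j. j \<in> {1..m} \<Longrightarrow> \<beta> j \<le> 1" "\<kappa> \<in> multi_indices m k"
  shows "index_weight m \<beta> \<kappa> \<le> real k"
proof -
  have "index_weight m \<beta> \<kappa> \<le> (\<Sum>j=1..m. real (\<kappa> j) * 1)"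
    unfolding index_weight_def using assms by (intro sum_mono mult_left_mono) auto
  then show ?thesis using assms(2) by (auto simp: multi_indices_def)
qed

text \<open>Each power of t/\<theta> tends to 0 as \<theta> grows, its exponent being positive. The
  value 1/2 becomes the ratio of the geometric majorants below, however large the \<open>z j\<close>
  are.\<close>

lemma ex_contraction_scale:
  fixes t :: real
  assumes "t > 0" "\<And>j. j \<in> {1..m} \<Longrightarrow> \<beta> j > 0"
  obtains \<theta> where "\<theta> > 0" "(\<Sum>j=1..m. \<bar>z j\<bar> * (t / \<theta>) powr \<beta> j) \<le> 1 / 2"
proof -
  have "((\<lambda>\<theta>. \<Sum>j=1..m. \<bar>z j\<bar> * (t powr \<beta> j * \<theta> powr (- \<beta> j))) \<longlongrightarrow> (\<Sum>j=1..m. \<bar>z j\<bar> * (t powr \<beta> j * 0))) at_top"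
    using assms by (intro tendsto_intros tendsto_neg_powr filterlim_ident) auto
  then have "eventually (\<lambda>\<theta>. (\<Sum>j=1..m. \<bar>z j\<bar> * (t powr \<beta> j * \<theta> powr (- \<beta> j))) < 1 / 2) at_top"
    by (intro order_tendstoD) auto
  then have "eventually (\<lambda>\<theta>. \<theta> > 0 \<and> (\<Sum>j=1..m. \<bar>z j\<bar> * (t powr \<beta> j * \<theta> powr (- \<beta> j))) < 1 / 2) at_top"
    using eventually_gt_at_top[of 0] by eventually_elim auto
  then obtain \<theta> where *: "\<theta> > 0" "(\<Sum>j=1..m. \<bar>z j\<bar> * (t powr \<beta> j * \<theta> powr (- \<beta> j))) < 1 / 2"
    using eventually_happens'[OF trivial_limit_at_top_linorder] by blast
  have "(\<Sum>j=1..m. \<bar>z j\<bar> * (t / \<theta>) powr \<beta> j) = (\<Sum>j=1..m. \<bar>z j\<bar> * (t powr \<beta> j * \<theta> powr (- \<beta> j)))"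
    using * assms by (intro sum.cong refl) (simp add: powr_divide powr_minus field_simps)
  with * that show ?thesis by simp
qed

text \<open>The right-hand side is independent of \<open>n\<close> and summable over
  \<open>k\<close>: it is the majorant for Tannery's theorem in
  \<open>mittag_leffler_limit\<close>.\<close>

lemma mittag_leffler_term_bound:
  fixes t :: real
  assumes t: "t > 0" and \<beta>: "\<And>j. j \<in> {1..m} \<Longrightarrow> 0 < \<beta> j \<and> \<beta> j \<le> 1"
    and b: "b > 0" and \<theta>: "\<theta> > 0" "(\<Sum>j=1..m. \<bar>z j\<bar> * (t / \<theta>) powr \<beta> j) \<le> 1 / 2"
    and n: "n > 0" "2 * \<theta> \<le> real n"
  shows "\<bar>(t / real n) powr (b - 1) * (neg_binomial b * mittag_leffler_symbol m \<beta> z (t / real n) ^ k) $$ n\<bar>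
     \<le> exp (2 * \<theta>) / t * (t / \<theta>) powr b * (b + real k) * (1 / 2) ^ k"
proof -
  define h where "h = t / real n"
  have h: "h > 0" using t n by (simp add: h_def)
  define C where "C = exp (2 * \<theta>) / t * (t / \<theta>) powr b * (b + real k)"
  have C: "C \<ge> 0" using t b by (auto simp: C_def)
  have e: "h powr (b - 1) * (neg_binomial b * mittag_leffler_symbol m \<beta> z h ^ k) $$ n =
      (\<Sum>\<kappa>\<in>multi_indices m k. multinomial_weight m k \<kappa> *
       (h powr (b - 1) * ((\<Prod>j=1..m. (z j * h powr \<beta> j) ^ \<kappa> j) * neg_binomial (b + index_weight m \<beta> \<kappa>) $$ n)))"
    unfolding mittag_leffler_symbol_power_nth by (simp add: sum_distrib_left mult_ac)
  have "\<bar>h powr (b - 1) * (neg_binomial b * mittag_leffler_symbol m \<beta> z h ^ k) $$ n\<bar>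
     \<le> C * (\<Sum>j=1..m. \<bar>z j\<bar> * (t / \<theta>) powr \<beta> j) ^ k"
    unfolding e
  proof (rule multinomial_sum_bound)
    fix \<kappa> assume k: "\<kappa> \<in> multi_indices m k"
    define w where "w = index_weight m \<beta> \<kappa>"
    have w: "0 \<le> w" "w \<le> real k"
      using index_weight_nonneg[of m \<beta> \<kappa>] index_weight_le[of m \<beta> \<kappa> k] \<beta> k unfolding w_def by force+
    define p where "p = (\<Prod>j=1..m. \<bar>z j\<bar> ^ \<kappa> j)"
    have p: "p \<ge> 0" by (auto simp: p_def intro!: prod_nonneg)
    have "\<bar>h powr (b - 1) * ((\<Prod>j=1..m. (z j * h powr \<beta> j) ^ \<kappa> j) * neg_binomial (b + w) $$ n)\<bar>
      = p * (h powr (b + w - 1) * neg_binomial (b + w) $$ n)"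
      unfolding prod_powr_index_weight[OF h]
      using b w h neg_binomial_nonneg[of "b + w" n] by (simp add: abs_mult p_def abs_prod power_abs w_def powr_add powr_diff)
    also have "\<dots> \<le> p * (h powr (b + w - 1) * ((b + w) * \<theta> powr (- (b + w)) * exp (2 * \<theta>) * real n powr (b + w - 1)))"
      using b w n p \<theta> by (intro mult_left_mono neg_binomial_growth) auto
    \<comment> \<open>Since h = t/n, the powers of n cancel exactly and leave t^(b+w-1).\<close>
    also have "h powr (b + w - 1) * ((b + w) * \<theta> powr (- (b + w)) * exp (2 * \<theta>) * real n powr (b + w - 1))
       = exp (2 * \<theta>) / t * (t / \<theta>) powr (b + w) * (b + w)"
    proof -
      define v where "v = b + w"
      show ?thesis unfolding v_def[symmetric]
        using n t \<theta> by (simp add: h_def powr_divide powr_diff powr_minus field_simps)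
    qed
    also have "p * (exp (2 * \<theta>) / t * (t / \<theta>) powr (b + w) * (b + w)) \<le>
       p * (exp (2 * \<theta>) / t * (t / \<theta>) powr (b + w) * (b + real k))"
      using t p w by (intro mult_left_mono) auto
    also have "\<dots> = C * (p * (t / \<theta>) powr w)" by (simp add: C_def powr_add)
    also have "p * (t / \<theta>) powr w = (\<Prod>j=1..m. (\<bar>z j\<bar> * (t / \<theta>) powr \<beta> j) ^ \<kappa> j)"
      unfolding p_def w_def using t \<theta> by (intro prod_powr_index_weight[symmetric]) auto
    finally show "\<bar>h powr (b - 1) * ((\<Prod>j=1..m. (z j * h powr \<beta> j) ^ \<kappa> j) *
         neg_binomial (b + index_weight m \<beta> \<kappa>) $$ n)\<bar>
      \<le> C * (\<Prod>j=1..m. (\<bar>z j\<bar> * (t / \<theta>) powr \<beta> j) ^ \<kappa> j)"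
      by (simp add: w_def)
  qed
  also have "\<dots> \<le> C * (1 / 2) ^ k"
    using \<theta> C by (intro mult_left_mono power_mono sum_nonneg) auto
  finally show ?thesis by (simp add: C_def h_def)
qed

lemma mittag_leffler_term_tendsto:
  fixes t :: real
  assumes t: "t > 0" and \<beta>: "\<And>j. j \<in> {1..m} \<Longrightarrow> 0 < \<beta> j" and b: "b > 0"
  shows "(\<lambda>n. (t / real n) powr (b - 1) * (neg_binomial b * mittag_leffler_symbol m \<beta> z (t / real n) ^ k) $$ n)
    \<longlonglongrightarrow> (\<Sum>\<kappa>\<in>multi_indices m k. multinomial_weight m k \<kappa> *
       ((\<Prod>j=1..m. (z j * t powr \<beta> j) ^ \<kappa> j) * (t powr (b - 1) / Gamma (b + index_weight m \<beta> \<kappa>))))"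
proof -
  have "(\<lambda>n. \<Sum>\<kappa>\<in>multi_indices m k. multinomial_weight m k \<kappa> *
        ((\<Prod>j=1..m. (z j * t powr \<beta> j) ^ \<kappa> j) * (t powr (b - 1) *
          (neg_binomial (b + index_weight m \<beta> \<kappa>) $$ n * real n powr (1 - (b + index_weight m \<beta> \<kappa>))))))
    \<longlonglongrightarrow> (\<Sum>\<kappa>\<in>multi_indices m k. multinomial_weight m k \<kappa> *
       ((\<Prod>j=1..m. (z j * t powr \<beta> j) ^ \<kappa> j) * (t powr (b - 1) * (1 / Gamma (b + index_weight m \<beta> \<kappa>)))))"
  proof (intro tendsto_sum tendsto_mult tendsto_const neg_binomial_asymp)
    fix \<kappa> show "b + index_weight m \<beta> \<kappa> > 0"
      using b index_weight_nonneg[of m \<beta> \<kappa>] \<beta> by (simp add: add_pos_nonneg less_imp_le)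
  qed
  moreover have "eventually (\<lambda>n. (\<Sum>\<kappa>\<in>multi_indices m k. multinomial_weight m k \<kappa> *
        ((\<Prod>j=1..m. (z j * t powr \<beta> j) ^ \<kappa> j) * (t powr (b - 1) *
          (neg_binomial (b + index_weight m \<beta> \<kappa>) $$ n * real n powr (1 - (b + index_weight m \<beta> \<kappa>))))))
     = (t / real n) powr (b - 1) * (neg_binomial b * mittag_leffler_symbol m \<beta> z (t / real n) ^ k) $$ n) sequentially"
    using eventually_gt_at_top[of 0]
  proof eventually_elim
    case (elim n)
    then have h: "t / real n > 0" using t by simp
    show ?case
      unfolding mittag_leffler_symbol_power_nth sum_distrib_left prod_powr_index_weight[OF t] prod_powr_index_weight[OF h]
      using elim t by (intro sum.cong refl)
         (simp add: powr_divide powr_add powr_diff powr_minus field_simps)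
  qed
  ultimately show ?thesis by (simp add: tendsto_cong)
qed

text \<open>This is not a formal identity: the symbol may have a non-zero constant term, so every
  power can contribute to the n-th coefficient. For fixed \<open>n\<close> the coefficients up to
  \<open>n\<close> decay like 2^(-k) in the exponent \<open>k\<close>, which makes the series
  converge numerically.\<close>

lemma mittag_leffler_symbol_inverse_sums:
  fixes t :: real
  assumes t: "t > 0" and \<beta>: "\<And>j. j \<in> {1..m} \<Longrightarrow> 0 < \<beta> j \<and> \<beta> j \<le> 1"
    and b: "b > 0" and \<theta>: "\<theta> > 0" "(\<Sum>j=1..m. \<bar>z j\<bar> * (t / \<theta>) powr \<beta> j) \<le> 1 / 2"
    and n: "n > 0" "2 * \<theta> \<le> real n" and z: "\<And>j. j \<in> {1..m} \<Longrightarrow> z j \<le> 0"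
  shows "(\<lambda>k. (neg_binomial b * mittag_leffler_symbol m \<beta> z (t / real n) ^ k) $$ n) sums
     ((neg_binomial b * inverse (1 - mittag_leffler_symbol m \<beta> z (t / real n))) $$ n)"
proof -
  define h where "h = t / real n"
  have h: "h > 0" using t n by (simp add: h_def)
  define Z where "Z = mittag_leffler_symbol m \<beta> z h"
  define I where "I = inverse (1 - Z)"
  have "Z $$ 0 = (\<Sum>j=1..m. z j * h powr \<beta> j)" by (simp add: Z_def mittag_leffler_symbol_def fps_sum_nth)
  \<comment> \<open>As the \<open>z j\<close> are non-positive, \<open>1 - Z\<close> has constant
    term at least 1 and is invertible.\<close>
  also have "\<dots> \<le> 0" using z by (intro sum_nonpos mult_nonpos_nonneg) auto
  finally have "(1 - Z) $$ 0 \<noteq> 0" by simp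
  then have I: "(1 - Z) * I = 1" unfolding I_def by (simp add: inverse_mult_eq_1')
  \<comment> \<open>At this radius (1 - x)^(-w) = (n/\<theta>)^w, which turns h^w into
    (t/\<theta>)^w, the quantity that \<theta> controls.\<close>
  define x where "x = 1 - \<theta> / real n"
  have x: "0 < x" "x < 1" using \<theta> n by (auto simp: x_def field_simps)
  define C where "C = (real n / \<theta>) powr b / x ^ n"
  have C: "C \<ge> 0" using x by (simp add: C_def)
  have bound: "\<bar>(neg_binomial b * Z ^ k) $$ i\<bar> \<le> C * (1 / 2) ^ k" if "i \<le> n" for i k
  proof -
    have "\<bar>(neg_binomial b * Z ^ k) $$ i\<bar> \<le> C * (\<Sum>j=1..m. \<bar>z j\<bar> * (t / \<theta>) powr \<beta> j) ^ k"
      unfolding Z_def mittag_leffler_symbol_power_nth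
    proof (rule multinomial_sum_bound)
      fix \<kappa> assume k: "\<kappa> \<in> multi_indices m k"
      define w where "w = index_weight m \<beta> \<kappa>"
      have w: "0 \<le> w"
        using index_weight_nonneg[of m \<beta> \<kappa>] \<beta> unfolding w_def by force
      define p where "p = (\<Prod>j=1..m. \<bar>z j\<bar> ^ \<kappa> j)"
      have p: "p \<ge> 0" by (auto simp: p_def intro!: prod_nonneg)
      have "\<bar>(\<Prod>j=1..m. (z j * h powr \<beta> j) ^ \<kappa> j) * neg_binomial (b + w) $$ i\<bar>
        = p * h powr w * neg_binomial (b + w) $$ i"
        unfolding prod_powr_index_weight[OF h]
        using b w neg_binomial_nonneg[of "b + w" i] by (simp add: abs_mult p_def abs_prod power_abs w_def)
      also have "\<dots> \<le> p * h powr w * ((1 - x) powr (- (b + w)) / x ^ n)"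
        using b w x p that by (intro mult_left_mono neg_binomial_nth_le) auto
      also have "\<dots> = C * (p * (t / \<theta>) powr w)"
        using n t \<theta> by (simp add: C_def h_def x_def powr_divide powr_minus powr_add powr_diff field_simps)
      also have "p * (t / \<theta>) powr w = (\<Prod>j=1..m. (\<bar>z j\<bar> * (t / \<theta>) powr \<beta> j) ^ \<kappa> j)"
        unfolding p_def w_def using t \<theta> by (intro prod_powr_index_weight[symmetric]) auto
      finally show "\<bar>(\<Prod>j=1..m. (z j * h powr \<beta> j) ^ \<kappa> j) * neg_binomial (b + index_weight m \<beta> \<kappa>) $$ i\<bar>
        \<le> C * (\<Prod>j=1..m. (\<bar>z j\<bar> * (t / \<theta>) powr \<beta> j) ^ \<kappa> j)"
        by (simp add: w_def)
    qed
    also have "\<dots> \<le> C * (1 / 2) ^ k"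
      using \<theta> C by (intro mult_left_mono power_mono sum_nonneg) auto
    finally show ?thesis .
  qed
  have lim: "(\<lambda>k. (neg_binomial b * Z ^ k) $$ i) \<longlonglongrightarrow> 0" if "i \<le> n" for i
  proof (rule Lim_null_comparison)
    show "eventually (\<lambda>k. norm ((neg_binomial b * Z ^ k) $$ i) \<le> C * (1 / 2) ^ k) sequentially"
      using bound[OF that] by simp
    show "(\<lambda>k. C * (1 / 2) ^ k) \<longlonglongrightarrow> 0"
      by (intro tendsto_mult_right_zero LIMSEQ_realpow_zero) auto
  qed
  \<comment> \<open>The remainder of the geometric sum is a finite convolution of coefficients with
    index at most \<open>n\<close>, each of which tends to 0 by \<open>lim\<close>.\<close>
  have "(\<Sum>k<K. (neg_binomial b * Z ^ k) $$ n) =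
     (neg_binomial b * I) $$ n - (\<Sum>i=0..n. I $$ i * (neg_binomial b * Z ^ K) $$ (n - i))" for K
  proof -
    have "(\<Sum>k<K. Z ^ k) = ((1 - Z) * (\<Sum>k<K. Z ^ k)) * I" using I by (simp add: mult_ac)
    also have "(1 - Z) * (\<Sum>k<K. Z ^ k) = 1 - Z ^ K" by (rule one_diff_power_eq[symmetric])
    finally have "neg_binomial b * (\<Sum>k<K. Z ^ k) = neg_binomial b * ((1 - Z ^ K) * I)"
      by simp
    also have "\<dots> = neg_binomial b * I - I * (neg_binomial b * Z ^ K)"
      by (simp only: left_diff_distrib right_diff_distrib mult_1_left mult_ac)
    finally have "neg_binomial b * (\<Sum>k<K. Z ^ k) = neg_binomial b * I - I * (neg_binomial b * Z ^ K)" .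
    then have "(\<Sum>k<K. neg_binomial b * Z ^ k) $$ n = (neg_binomial b * I - I * (neg_binomial b * Z ^ K)) $$ n"
      by (simp add: sum_distrib_left)
    then show ?thesis by (simp add: fps_sum_nth fps_mult_nth[of I])
  qed
  moreover have "(\<lambda>K. (neg_binomial b * I) $$ n - (\<Sum>i=0..n. I $$ i * (neg_binomial b * Z ^ K) $$ (n - i)))
     \<longlonglongrightarrow> (neg_binomial b * I) $$ n - (\<Sum>i=0..n. I $$ i * 0)"
    by (intro tendsto_intros lim) auto
  ultimately show ?thesis by (simp add: sums_def Z_def h_def I_def)
qed

text \<open>Tannery's theorem takes the limit in \<open>n\<close> inside the sum over
  \<open>k\<close>, from the termwise limits and the uniform majorant.\<close>

lemma mittag_leffler_limit:
  fixes t :: real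
  assumes t: "t > 0" and \<beta>: "\<And>j. j \<in> {1..m} \<Longrightarrow> 0 < \<beta> j \<and> \<beta> j \<le> 1"
    and b: "b > 0" and z: "\<And>j. j \<in> {1..m} \<Longrightarrow> z j \<le> 0"
  shows "(\<lambda>n. (t / real n) powr (b - 1) *
       (neg_binomial b * inverse (1 - mittag_leffler_symbol m \<beta> z (t / real n))) $$ n)
     \<longlonglongrightarrow> t powr (b - 1) * multinomial_ML m \<beta> b (\<lambda>j. z j * t powr \<beta> j)"
proof -
  obtain \<theta> where \<theta>: "\<theta> > 0" "(\<Sum>j=1..m. \<bar>z j\<bar> * (t / \<theta>) powr \<beta> j) \<le> 1 / 2"
    using ex_contraction_scale[of t m \<beta> z] t \<beta> by blast
  define C where "C = exp (2 * \<theta>) / t * (t / \<theta>) powr b"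
  define f where "f = (\<lambda>k n. (t / real n) powr (b - 1) * (neg_binomial b * mittag_leffler_symbol m \<beta> z (t / real n) ^ k) $$ n)"
  define L where "L = (\<lambda>k. \<Sum>\<kappa>\<in>multi_indices m k. multinomial_weight m k \<kappa> *
       ((\<Prod>j=1..m. (z j * t powr \<beta> j) ^ \<kappa> j) * (t powr (b - 1) / Gamma (b + index_weight m \<beta> \<kappa>))))"
  have large: "eventually (\<lambda>n. n > 0 \<and> 2 * \<theta> \<le> real n) sequentially"
    using eventually_gt_at_top[of 0] eventually_ge_at_top[of "nat \<lceil>2 * \<theta>\<rceil>"]
    by eventually_elim (auto simp: nat_le_iff ceiling_le_iff)
  have sm: "summable (\<lambda>k. C * (b + real k) * (1 / 2) ^ k)"
  proof -
    have "summable (\<lambda>k. real (Suc k) * (1/2) ^ k)"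
      using geometric_deriv_sums[of "1/2::real"] by (auto simp: sums_iff)
    then have "summable (\<lambda>k. C * (b - 1) * (1 / 2) ^ k + C * (real (Suc k) * (1/2) ^ k))"
      by (intro summable_add summable_mult summable_geometric) auto
    then show ?thesis by (simp add: algebra_simps)
  qed
  have tan: "(\<forall>\<^sub>F n in sequentially. summable (\<lambda>k. norm (f k n))) \<and>
      summable (\<lambda>k. norm (L k)) \<and> ((\<lambda>n. suminf (\<lambda>k. f k n)) \<longlongrightarrow> suminf L) sequentially"
  proof (rule tannerys_theorem[OF _ _ sm])
    show "(f k \<longlongrightarrow> L k) sequentially" for k
      unfolding f_def L_def using t \<beta> b by (intro mittag_leffler_term_tendsto) auto
    have "\<forall>\<^sub>F n in sequentially. \<forall>k. norm (f k n) \<le> C * (b + real k) * (1 / 2) ^ k"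
      using large
      by eventually_elim (use mittag_leffler_term_bound[OF t \<beta> b \<theta>] in \<open>auto simp: f_def C_def\<close>)
    then show "\<forall>\<^sub>F (k, n) in at_top \<times>\<^sub>F sequentially. norm (f k n) \<le> C * (b + real k) * (1 / 2) ^ k"
      unfolding eventually_prod_filter
      by (intro exI[of _ "\<lambda>_. True"] exI[of _ "\<lambda>n. \<forall>k. norm (f k n) \<le> C * (b + real k) * (1 / 2) ^ k"]) auto
  qed auto
  have "suminf L = t powr (b - 1) * multinomial_ML m \<beta> b (\<lambda>j. z j * t powr \<beta> j)"
  proof -
    have L: "L = (\<lambda>k. t powr (b - 1) * (\<Sum>\<kappa>\<in>multi_indices m k.
        (fact k / (\<Prod>j=1..m. fact (\<kappa> j))) *
        ((\<Prod>j=1..m. (z j * t powr \<beta> j) ^ \<kappa> j) / of_real (Gamma (b + (\<Sum>j=1..m. real (\<kappa> j) * \<beta> j))))))"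
      unfolding L_def multinomial_weight_def index_weight_def by (auto simp: sum_distrib_left fun_eq_iff intro!: sum.cong)
    have "summable L" using tan summable_norm_cancel by blast
    moreover have "t powr (b - 1) \<noteq> 0" using t by simp
    ultimately show ?thesis unfolding L multinomial_ML_def
      by (subst suminf_mult) (simp_all add: summable_mult_D)
  qed
  moreover have "eventually (\<lambda>n. (\<Sum>k. f k n) = (t / real n) powr (b - 1) *
       (neg_binomial b * inverse (1 - mittag_leffler_symbol m \<beta> z (t / real n))) $$ n) sequentially"
    using large
  proof eventually_elim
    case (elim n)
    show ?case unfolding f_def
      using sums_mult[OF mittag_leffler_symbol_inverse_sums[OF t \<beta> b \<theta> conjunct1[OF elim] conjunct2[OF elim] z]]
      by (auto simp: sums_iff)
  qed
  ultimately show ?thesis using tan by (simp add: tendsto_cong)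
qed

section \<open>Limits of positive combinations of resolvent powers\<close>


text \<open>As \<open>N\<close> has no constant term, its powers above \<open>n\<close> do not reach
  the n-th coefficient, so the Neumann series of (s - N)^(-1) is a finite sum. With s = p + \<nu>
  the dependence on \<nu> is through the powers (p + \<nu>)^(-l-1) alone.\<close>

lemma geometric_fps_nth:
  fixes K N :: "real fps"
  assumes N: "N $$ 0 = 0" and s: "s > 0"
  shows "(K * inverse (fps_const s - N)) $$ n = (\<Sum>l\<le>n. (K * N ^ l) $$ n / s ^ (l + 1))"
proof -
  define R where "R = fps_const (1 / s) * N"
  define I where "I = inverse (fps_const s - N)"
  have I: "(fps_const s - N) * I = 1" unfolding I_def using N s by (simp add: inverse_mult_eq_1')
  have "fps_const s * R = N" using s by (simp add: R_def flip: mult.assoc)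
  then have fs: "fps_const s - N = fps_const s * (1 - R)" by (simp only: right_diff_distrib mult_1_right)
  have "(\<Sum>l<Suc n. R ^ l) = ((1 - R) * (\<Sum>l<Suc n. R ^ l)) * (fps_const s * I)"
    using I unfolding fs by (simp add: mult_ac)
  also have "(1 - R) * (\<Sum>l<Suc n. R ^ l) = 1 - R ^ Suc n" by (rule one_diff_power_eq[symmetric])
  finally have S: "(\<Sum>l<Suc n. R ^ l) = (1 - R ^ Suc n) * (fps_const s * I)" .
  have "c * (K * I) = K * ((1 - Q) * (c * I)) + (K * (c * I)) * Q" for c Q :: "real fps"
    by (simp add: algebra_simps)
  from this[of "fps_const s" "R ^ Suc n"]
  have "fps_const s * (K * I) = K * (\<Sum>l<Suc n. R ^ l) + (K * (fps_const s * I)) * R ^ Suc n"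
    by (simp only: S)
  then have "(fps_const s * (K * I)) $$ n = (K * (\<Sum>l<Suc n. R ^ l)) $$ n + ((K * (fps_const s * I)) * R ^ Suc n) $$ n"
    by simp
  moreover have "((K * (fps_const s * I)) * R ^ Suc n) $$ n = 0"
  proof -
    have "R $$ 0 = 0" using N by (simp add: R_def)
    then have "R ^ Suc n $$ i = 0" if "i \<le> n" for i
      using that startsby_zero_power_prefix[of R "Suc n"] by auto
    then show ?thesis unfolding fps_mult_nth[of _ "R ^ Suc n"] by (intro sum.neutral) auto
  qed
  moreover have "(K * (\<Sum>l<Suc n. R ^ l)) $$ n = (\<Sum>l\<le>n. (K * N ^ l) $$ n / s ^ l)"
  proof -
    have "R ^ l = fps_const (1 / s ^ l) * N ^ l" for l
      by (simp add: R_def power_mult_distrib fps_const_power power_one_over)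
    then have "K * (\<Sum>l<Suc n. R ^ l) = (\<Sum>l\<le>n. fps_const (1 / s ^ l) * (K * N ^ l))"
      by (simp add: sum_distrib_left lessThan_Suc_atMost mult_ac)
    then show ?thesis by (simp add: fps_sum_nth)
  qed
  ultimately have "s * (K * I) $$ n = (\<Sum>l\<le>n. (K * N ^ l) $$ n / s ^ l)" by simp
  then have "(K * I) $$ n = (\<Sum>l\<le>n. (K * N ^ l) $$ n / s ^ l) / s" using s by (simp add: field_simps)
  also have "\<dots> = (\<Sum>l\<le>n. (K * N ^ l) $$ n / s ^ (l + 1))" by (simp add: sum_divide_distrib mult.commute)
  finally show ?thesis by (simp add: I_def)
qed

text \<open>The finite sums are completely monotone functions of \<nu>. Convergence is required on
  all of \<open>\<nu> \<ge> 0\<close> and not only at the eigenvalues: the value at 0 bounds the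
  others, and log-convexity compares \<nu> with \<nu>/2.\<close>

definition resolvent_sum_limit :: "(real \<Rightarrow> real) \<Rightarrow> bool" where
  "resolvent_sum_limit \<rho> \<longleftrightarrow> (\<exists>p c. (\<forall>n. p n > 0) \<and> (\<forall>n l. c n l \<ge> 0) \<and>
     (\<forall>\<nu>\<ge>0. (\<lambda>n. \<Sum>l\<le>n. c n l / (p n + \<nu>) ^ (l + 1)) \<longlonglongrightarrow> \<rho> \<nu>))"

lemma resolvent_sum_nonneg:
  assumes "p > 0" "\<And>l. c l \<ge> 0" "\<nu> \<ge> 0"
  shows "(\<Sum>l\<le>n. c l / (p + \<nu>) ^ (l + 1)) \<ge> (0::real)"
  using assms by (intro sum_nonneg divide_nonneg_nonneg zero_le_power) auto

lemma resolvent_sum_antimono: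
  assumes "p > 0" "\<And>l. c l \<ge> 0" "\<nu> \<ge> 0"
  shows "(\<Sum>l\<le>n. c l / (p + \<nu>) ^ (l + 1)) \<le> (\<Sum>l\<le>n. c l / (p + 0) ^ (l + 1) :: real)"
  using assms by (intro sum_mono divide_left_mono power_mono mult_pos_pos zero_less_power) auto

text \<open>Cauchy-Schwarz for the sum, after (p + \<nu>/2)^2 \<ge> p (p + \<nu>) in each term.
  Writing \<open>p + 0\<close> keeps the first factor an instance of the general sum, so that the
  limit at \<nu> = 0 applies to it.\<close>

lemma resolvent_sum_log_convex:
  assumes "p > 0" "\<And>l. c l \<ge> 0" "\<nu> \<ge> 0"
  shows "(\<Sum>l\<le>n. c l / (p + \<nu> / 2) ^ (l + 1))\<^sup>2 \<le>
    (\<Sum>l\<le>n. c l / (p + 0) ^ (l + 1)) * (\<Sum>l\<le>n. c l / (p + \<nu>) ^ (l + 1) :: real)"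
proof -
  define f g where "f = (\<lambda>l. sqrt (c l / (p + 0) ^ (l + 1)))" and "g = (\<lambda>l. sqrt (c l / (p + \<nu>) ^ (l + 1)))"
  have f: "(f l)\<^sup>2 = c l / (p + 0) ^ (l + 1)" and g: "(g l)\<^sup>2 = c l / (p + \<nu>) ^ (l + 1)" for l
    using assms by (auto simp: f_def g_def)
  have le: "c l / (p + \<nu> / 2) ^ (l + 1) \<le> f l * g l" for l
  proof (rule power2_le_imp_le)
    have "((p + 0) * (p + \<nu>)) ^ (l + 1) \<le> ((p + \<nu> / 2)\<^sup>2) ^ (l + 1)"
    proof (rule power_mono)
      have "0 \<le> (\<nu> / 2)\<^sup>2" by simp
      then show "(p + 0) * (p + \<nu>) \<le> (p + \<nu> / 2)\<^sup>2" by (simp add: power2_eq_square algebra_simps)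
    qed (use assms in auto)
    then have "(c l)\<^sup>2 / ((p + \<nu> / 2)\<^sup>2) ^ (l + 1) \<le> (c l)\<^sup>2 / ((p + 0) * (p + \<nu>)) ^ (l + 1)"
      using assms by (intro divide_left_mono mult_pos_pos zero_less_power) auto
    then show "(c l / (p + \<nu> / 2) ^ (l + 1))\<^sup>2 \<le> (f l * g l)\<^sup>2"
      unfolding power_mult_distrib[of "f l"] f g power_divide times_divide_times_eq
      by (simp only: power2_eq_square[of "c l"] power_mult_distrib power_mult[symmetric] mult.commute[of 2])
    show "0 \<le> f l * g l" using assms by (simp add: f_def g_def)
  qed
  have "(\<Sum>l\<le>n. c l / (p + \<nu> / 2) ^ (l + 1))\<^sup>2 \<le> (\<Sum>l\<le>n. f l * g l)\<^sup>2"
    using assms by (intro power_mono sum_mono le sum_nonneg divide_nonneg_nonneg zero_le_power) auto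
  also have "\<dots> \<le> (\<Sum>l\<le>n. (f l)\<^sup>2) * (\<Sum>l\<le>n. (g l)\<^sup>2)"
    by (rule Cauchy_Schwarz_ineq_sum)
  finally show ?thesis by (simp only: f g)
qed

lemma resolvent_sum_limit_nonneg:
  assumes "resolvent_sum_limit \<rho>" "\<nu> \<ge> 0" shows "\<rho> \<nu> \<ge> 0"
proof -
  obtain p c where pc: "\<forall>n. p n > 0" "\<forall>n l. c n l \<ge> (0::real)"
    "\<forall>\<nu>\<ge>0. (\<lambda>n. \<Sum>l\<le>n. c n l / (p n + \<nu>) ^ (l + 1)) \<longlonglongrightarrow> \<rho> \<nu>"
    using assms(1) unfolding resolvent_sum_limit_def by (elim exE conjE)
  show ?thesis
    using resolvent_sum_nonneg[OF pc(1)[rule_format] pc(2)[rule_format] assms(2)]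
    by (intro LIMSEQ_le_const[OF pc(3)[rule_format, OF assms(2)]]) auto
qed

lemma resolvent_sum_limit_antimono:
  assumes "resolvent_sum_limit \<rho>" "\<nu> \<ge> 0" shows "\<rho> \<nu> \<le> \<rho> 0"
proof -
  obtain p c where pc: "\<forall>n. p n > 0" "\<forall>n l. c n l \<ge> (0::real)"
    "\<forall>\<nu>\<ge>0. (\<lambda>n. \<Sum>l\<le>n. c n l / (p n + \<nu>) ^ (l + 1)) \<longlonglongrightarrow> \<rho> \<nu>"
    using assms(1) unfolding resolvent_sum_limit_def by (elim exE conjE)
  note * = pc(1)[rule_format] pc(2)[rule_format] pc(3)[rule_format]
  show ?thesis
    using resolvent_sum_antimono[OF *(1,2) assms(2)] by (intro LIMSEQ_le[OF *(3)[OF assms(2)] *(3)[of 0]]) auto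
qed

lemma resolvent_sum_limit_log_convex:
  assumes "resolvent_sum_limit \<rho>" "\<nu> \<ge> 0" shows "(\<rho> (\<nu> / 2))\<^sup>2 \<le> \<rho> 0 * \<rho> \<nu>"
proof -
  obtain p c where pc: "\<forall>n. p n > 0" "\<forall>n l. c n l \<ge> (0::real)"
    "\<forall>\<nu>\<ge>0. (\<lambda>n. \<Sum>l\<le>n. c n l / (p n + \<nu>) ^ (l + 1)) \<longlonglongrightarrow> \<rho> \<nu>"
    using assms(1) unfolding resolvent_sum_limit_def by (elim exE conjE)
  note * = pc(1)[rule_format] pc(2)[rule_format] pc(3)[rule_format]
  show ?thesis
  proof (rule LIMSEQ_le)
    show "(\<lambda>n. (\<Sum>l\<le>n. c n l / (p n + \<nu> / 2) ^ (l + 1))\<^sup>2) \<longlonglongrightarrow> (\<rho> (\<nu> / 2))\<^sup>2"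
      using assms by (intro tendsto_power *) auto
    show "(\<lambda>n. (\<Sum>l\<le>n. c n l / (p n + 0) ^ (l + 1)) * (\<Sum>l\<le>n. c n l / (p n + \<nu>) ^ (l + 1))) \<longlonglongrightarrow> \<rho> 0 * \<rho> \<nu>"
      using assms by (intro tendsto_mult *) auto
  qed (use resolvent_sum_log_convex[OF *(1,2) assms(2)] in auto)
qed

lemma fps_mult_nonneg:
  "(\<And>n. a $$ n \<ge> 0) \<Longrightarrow> (\<And>n. b $$ n \<ge> 0) \<Longrightarrow> (a * b :: real fps) $$ n \<ge> 0"
  by (auto simp: fps_mult_nth intro!: sum_nonneg)

lemma fps_power_nonneg: "(\<And>n. a $$ n \<ge> 0) \<Longrightarrow> (a ^ k :: real fps) $$ n \<ge> 0"
  by (induction k arbitrary: n) (auto simp: fps_one_nth intro!: fps_mult_nonneg)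

section \<open>Discretisation of the multi-term fractional derivative\<close>

locale multi_term =
  fixes m :: nat and \<alpha> q :: "nat \<Rightarrow> real"
  assumes m: "m \<ge> 1"
    and \<alpha>: "\<And>j. j \<in> {1..m} \<Longrightarrow> 0 < \<alpha> j \<and> \<alpha> j < 1"
    and \<alpha>_dec: "\<And>i j. 1 \<le> i \<Longrightarrow> i < j \<Longrightarrow> j \<le> m \<Longrightarrow> \<alpha> j < \<alpha> i"
    and q: "\<And>j. j \<in> {1..m} \<Longrightarrow> 0 < q j"
    and q1: "q 1 = 1"
begin

abbreviation \<beta> :: "nat \<Rightarrow> real" where "\<beta> j \<equiv> if j = 1 then \<alpha> 1 else \<alpha> 1 - \<alpha> j"
abbreviation z :: "real \<Rightarrow> nat \<Rightarrow> real" where "z \<nu> j \<equiv> if j = 1 then - \<nu> else - q j"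

text \<open>The Gruenwald-Letnikov symbol, with step \<open>h\<close>, of the sum of the fractional
  time derivatives weighted by the \<open>q j\<close>: the factor
  \<open>neg_binomial (- \<alpha> j)\<close> is the power of 1 - X with exponent
  \<open>\<alpha> j\<close>.\<close>

definition G :: "real \<Rightarrow> real fps" where
  "G h = (\<Sum>j=1..m. fps_const (q j * h powr (- \<alpha> j)) * neg_binomial (- \<alpha> j))"

definition g0 :: "real \<Rightarrow> real" where "g0 h = (\<Sum>j=1..m. q j * h powr (- \<alpha> j))"

definition N :: "real \<Rightarrow> real fps" where "N h = fps_const (g0 h) - G h"

lemma \<beta>_bounds: "j \<in> {1..m} \<Longrightarrow> 0 < \<beta> j \<and> \<beta> j \<le> 1"
  using \<alpha>[of j] \<alpha>[of 1] m \<alpha>_dec[of 1 j] by auto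

lemma g0_pos: "h > 0 \<Longrightarrow> g0 h > 0"
  unfolding g0_def using m q by (intro sum_pos) auto

lemma N_nth_0: "N h $$ 0 = 0"
  by (simp add: N_def G_def g0_def fps_sum_nth)

lemma N_nonneg: "N h $$ n \<ge> 0"
proof (cases "n = 0")
  case False
  have "G h $$ n \<le> 0"
    unfolding G_def fps_sum_nth fps_mult_left_const_nth
    using False \<alpha> q by (intro sum_nonpos mult_nonneg_nonpos neg_binomial_neg_nonpos mult_nonneg_nonneg)
      (auto simp: less_imp_le)
  then show ?thesis using False by (simp add: N_def)
qed (simp add: N_nth_0)

text \<open>Dividing out the factor \<open>h\<^sup>\<alpha>\<^sup>1 (1 - X)\<^sup>-\<^sup>\<alpha>\<^sup>1\<close> leaves a resolvent at \<open>g0 h + \<nu> > 0\<close> perturbed by the series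
  \<open>N h\<close>, whose coefficients are non-negative because the orders \<open>\<alpha> j\<close> lie in \<open>(0, 1)\<close>.\<close>

lemma one_minus_ML_symbol:
  assumes "h > 0"
  shows "1 - mittag_leffler_symbol m \<beta> (z \<nu>) h = fps_const (h powr \<alpha> 1) * neg_binomial (\<alpha> 1) * (fps_const (g0 h + \<nu>) - N h)"
proof -
  have split: "{1..m} = insert 1 {2..m}" using m by auto
  have G: "fps_const (h powr \<alpha> 1) * neg_binomial (\<alpha> 1) * G h =
      1 + (\<Sum>j=2..m. fps_const (q j * h powr (\<alpha> 1 - \<alpha> j)) * neg_binomial (\<alpha> 1 - \<alpha> j))"
  proof -
    have e: "fps_const (h powr \<alpha> 1) * neg_binomial (\<alpha> 1) * (fps_const (q j * h powr (- \<alpha> j)) * neg_binomial (- \<alpha> j))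
       = fps_const (q j * h powr (\<alpha> 1 - \<alpha> j)) * neg_binomial (\<alpha> 1 - \<alpha> j)" for j
    proof -
      have "fps_const (h powr \<alpha> 1) * neg_binomial (\<alpha> 1) * (fps_const (q j * h powr (- \<alpha> j)) * neg_binomial (- \<alpha> j))
        = (fps_const (h powr \<alpha> 1) * fps_const (q j * h powr (- \<alpha> j))) * (neg_binomial (\<alpha> 1) * neg_binomial (- \<alpha> j))"
        by (simp only: mult_ac)
      also have "\<dots> = fps_const (q j * h powr (\<alpha> 1 - \<alpha> j)) * neg_binomial (\<alpha> 1 - \<alpha> j)"
        using assms by (simp add: neg_binomial_mult powr_diff powr_minus field_simps)
      finally show ?thesis .
    qed
    show ?thesis unfolding G_def sum_distrib_left e split using q1 assms by simp
  qed
  have neg: "fps_const (- x) * B = - (fps_const x * B)" for x :: real and B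
    by (simp only: fps_const_neg[symmetric] mult_minus_left)
  have S: "mittag_leffler_symbol m \<beta> (z \<nu>) h = - (fps_const (\<nu> * h powr \<alpha> 1) * neg_binomial (\<alpha> 1)) -
      (\<Sum>j=2..m. fps_const (q j * h powr (\<alpha> 1 - \<alpha> j)) * neg_binomial (\<alpha> 1 - \<alpha> j))"
  proof -
    have "(\<Sum>j=2..m. fps_const (z \<nu> j * h powr \<beta> j) * neg_binomial (\<beta> j)) =
       (\<Sum>j=2..m. - (fps_const (q j * h powr (\<alpha> 1 - \<alpha> j)) * neg_binomial (\<alpha> 1 - \<alpha> j)))"
      by (intro sum.cong refl) (simp only: neg[symmetric], simp)
    then show ?thesis unfolding mittag_leffler_symbol_def split sum_negf by (simp add: neg)
  qed
  have "fps_const (g0 h + \<nu>) - N h = fps_const \<nu> + G h"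
    by (simp add: N_def algebra_simps flip: fps_const_add)
  then have "fps_const (h powr \<alpha> 1) * neg_binomial (\<alpha> 1) * (fps_const (g0 h + \<nu>) - N h) =
     fps_const (\<nu> * h powr \<alpha> 1) * neg_binomial (\<alpha> 1) + fps_const (h powr \<alpha> 1) * neg_binomial (\<alpha> 1) * G h"
    by (simp only: distrib_left fps_const_mult[symmetric] mult_ac)
  also have "\<dots> = 1 - mittag_leffler_symbol m \<beta> (z \<nu>) h" unfolding G S by simp
  finally show ?thesis ..
qed

lemma mode_ML_limit:
  assumes t: "t > 0" and b: "b \<ge> 0" and \<nu>: "\<nu> \<ge> 0"
  shows "(\<lambda>n. (t / real n) powr (b - 1) *
      (neg_binomial b * inverse (fps_const (g0 (t / real n) + \<nu>) - N (t / real n))) $$ n)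
     \<longlonglongrightarrow> t powr (\<alpha> 1 + b - 1) * mode_ML m \<alpha> q \<nu> (\<alpha> 1 + b) t"
proof -
  have a1: "0 < \<alpha> 1" using \<alpha>[of 1] m by auto
  have "(\<lambda>n. (t / real n) powr (\<alpha> 1 + b - 1) *
       (neg_binomial (\<alpha> 1 + b) * inverse (1 - mittag_leffler_symbol m \<beta> (z \<nu>) (t / real n))) $$ n)
     \<longlonglongrightarrow> t powr (\<alpha> 1 + b - 1) * multinomial_ML m \<beta> (\<alpha> 1 + b) (\<lambda>j. z \<nu> j * t powr \<beta> j)"
    using \<beta>_bounds q \<nu> b a1 by (intro mittag_leffler_limit[OF t]) (auto simp: less_imp_le)
  moreover have "(\<lambda>j. z \<nu> j * t powr \<beta> j) = (\<lambda>j. if j = 1 then - \<nu> * t powr \<alpha> 1 else - q j * t powr (\<alpha> 1 - \<alpha> j))"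
    by auto
  moreover have "eventually (\<lambda>n. (t / real n) powr (\<alpha> 1 + b - 1) *
       (neg_binomial (\<alpha> 1 + b) * inverse (1 - mittag_leffler_symbol m \<beta> (z \<nu>) (t / real n))) $$ n =
     (t / real n) powr (b - 1) *
      (neg_binomial b * inverse (fps_const (g0 (t / real n) + \<nu>) - N (t / real n))) $$ n) sequentially"
    using eventually_gt_at_top[of 0]
  proof eventually_elim
    case (elim n)
    define h where "h = t / real n"
    have h: "h > 0" using elim t by (simp add: h_def)
    define R where "R = fps_const (g0 h + \<nu>) - N h"
    have nb: "neg_binomial (\<alpha> 1) * inverse (neg_binomial (\<alpha> 1)) = 1"
      by (rule inverse_mult_eq_1') simp
    have "neg_binomial (\<alpha> 1 + b) * inverse (1 - mittag_leffler_symbol m \<beta> (z \<nu>) h) =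
      neg_binomial b * neg_binomial (\<alpha> 1) * (fps_const (1 / h powr \<alpha> 1) * inverse (neg_binomial (\<alpha> 1)) * inverse R)"
      unfolding one_minus_ML_symbol[OF h] R_def[symmetric] neg_binomial_mult
      using h by (simp add: fps_inverse_mult fps_const_inverse inverse_eq_divide add.commute)
    also have "\<dots> = fps_const (1 / h powr \<alpha> 1) * (neg_binomial b * inverse R * (neg_binomial (\<alpha> 1) * inverse (neg_binomial (\<alpha> 1))))"
      by (simp only: mult_ac)
    finally have "neg_binomial (\<alpha> 1 + b) * inverse (1 - mittag_leffler_symbol m \<beta> (z \<nu>) h) = fps_const (1 / h powr \<alpha> 1) * (neg_binomial b * inverse R)"
      by (simp only: nb mult_1_right)
    then have e: "(neg_binomial (\<alpha> 1 + b) * inverse (1 - mittag_leffler_symbol m \<beta> (z \<nu>) h)) $$ n = 1 / h powr \<alpha> 1 * (neg_binomial b * inverse R) $$ n"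
      by simp
    have "h powr (\<alpha> 1 + b - 1) * (1 / h powr \<alpha> 1) = h powr (b - 1)"
      using h by (simp add: powr_add powr_diff)
    then show ?case unfolding h_def[symmetric] R_def[symmetric] e by (simp only: mult.assoc[symmetric])
  qed
  ultimately show ?thesis unfolding mode_ML_def by (simp add: tendsto_cong)
qed

lemma resolvent_sum_limitI:
  assumes t: "t > 0" and K: "\<And>h n. h > 0 \<Longrightarrow> K h $$ n \<ge> 0"
    and lim: "\<And>\<nu>. \<nu> \<ge> 0 \<Longrightarrow> (\<lambda>n. (K (t / real n) * inverse (fps_const (g0 (t / real n) + \<nu>) - N (t / real n))) $$ n) \<longlonglongrightarrow> \<rho> \<nu>"
  shows "resolvent_sum_limit \<rho>"
  unfolding resolvent_sum_limit_def
proof (intro exI conjI allI impI)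
  \<comment> \<open>At n = 0 the step size t / 0 is 0, where \<open>g0\<close> vanishes and the sign
    of \<open>K\<close> is unknown; the dummy values 1 and 0 keep the sign conditions for every
    \<open>n\<close>.\<close>
  let ?p = "\<lambda>n. if n = 0 then 1 else g0 (t / real n)"
  let ?c = "\<lambda>n l. if n = 0 then 0 else (K (t / real n) * N (t / real n) ^ l) $$ n"
  show "?p n > 0" for n using g0_pos t by simp
  show "?c n l \<ge> 0" for n l
    using t K N_nonneg by (auto intro!: fps_mult_nonneg fps_power_nonneg)
  fix \<nu> :: real assume \<nu>: "\<nu> \<ge> 0"
  have "eventually (\<lambda>n. (K (t / real n) * inverse (fps_const (g0 (t / real n) + \<nu>) - N (t / real n))) $$ n =
     (\<Sum>l\<le>n. ?c n l / (?p n + \<nu>) ^ (l + 1))) sequentially"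
    using eventually_gt_at_top[of 0]
  proof eventually_elim
    case (elim n)
    then have "g0 (t / real n) + \<nu> > 0" using g0_pos[of "t / real n"] t \<nu> by simp
    then show ?case using elim by (simp add: geometric_fps_nth[OF N_nth_0])
  qed
  then show "(\<lambda>n. \<Sum>l\<le>n. ?c n l / (?p n + \<nu>) ^ (l + 1)) \<longlonglongrightarrow> \<rho> \<nu>"
    using lim[OF \<nu>] by (rule Lim_transform_eventually[rotated])
qed

lemma resolvent_sum_limit_source:
  assumes t: "t > 0"
  shows "resolvent_sum_limit (\<lambda>\<nu>. t powr (\<alpha> 1 - 1) * mode_ML m \<alpha> q \<nu> (\<alpha> 1) t)"
proof (rule resolvent_sum_limitI[OF t])
  show "fps_const (h powr (- 1)) $$ n \<ge> 0" for h :: real and n by simp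
  show "(\<lambda>n. (fps_const ((t / real n) powr (- 1)) * inverse (fps_const (g0 (t / real n) + \<nu>) - N (t / real n))) $$ n)
     \<longlonglongrightarrow> t powr (\<alpha> 1 - 1) * mode_ML m \<alpha> q \<nu> (\<alpha> 1) t" if "\<nu> \<ge> 0" for \<nu>
    using mode_ML_limit[OF t order.refl that] by simp
qed

lemma resolvent_sum_limit_integrated:
  assumes t: "t > 0"
  shows "resolvent_sum_limit (\<lambda>\<nu>. t powr \<alpha> 1 * mode_ML m \<alpha> q \<nu> (1 + \<alpha> 1) t)"
proof (rule resolvent_sum_limitI[OF t, where K = "\<lambda>_. neg_binomial 1"])
  have nz: "eventually (\<lambda>n. t / real n \<noteq> 0) sequentially"
    using eventually_gt_at_top[of 0] by eventually_elim (use t in auto)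
  show "(\<lambda>n. (neg_binomial 1 * inverse (fps_const (g0 (t / real n) + \<nu>) - N (t / real n))) $$ n)
     \<longlonglongrightarrow> t powr \<alpha> 1 * mode_ML m \<alpha> q \<nu> (1 + \<alpha> 1) t" if "\<nu> \<ge> 0" for \<nu>
  proof (rule Lim_transform_eventually)
    show "(\<lambda>n. (t / real n) powr (1 - 1) *
      (neg_binomial 1 * inverse (fps_const (g0 (t / real n) + \<nu>) - N (t / real n))) $$ n)
     \<longlonglongrightarrow> t powr \<alpha> 1 * mode_ML m \<alpha> q \<nu> (1 + \<alpha> 1) t"
      using mode_ML_limit[OF t zero_le_one that] by (simp add: add.commute)
  qed (use nz in eventually_elim, auto)
qed (simp add: neg_binomial_nonneg)

text \<open>All coefficients of (1 - X)^(-1) are 1. With R = \<nu> + G, subtracting \<nu> times the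
  n-th coefficient of (1 - X)^(-1) R^(-1) from 1 therefore gives the n-th coefficient of (1 -
  X)^(-1) G R^(-1). Its numerator combines the series \<open>neg_binomial (1 - \<alpha> j)\<close>,
  whose coefficients are non-negative as the orders are below 1.\<close>

lemma resolvent_sum_limit_initial:
  assumes t: "t > 0"
  shows "resolvent_sum_limit (\<lambda>\<nu>. 1 - \<nu> * t powr \<alpha> 1 * mode_ML m \<alpha> q \<nu> (1 + \<alpha> 1) t)"
proof (rule resolvent_sum_limitI[OF t, where K = "\<lambda>h. neg_binomial 1 * G h"])
  fix h :: real and n assume h: "h > 0"
  have "neg_binomial 1 * G h = (\<Sum>j=1..m. fps_const (q j * h powr (- \<alpha> j)) * neg_binomial (1 - \<alpha> j))"
    unfolding G_def sum_distrib_left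
    by (intro sum.cong refl) (use neg_binomial_mult[of 1 "- \<alpha> _"] in \<open>simp add: mult.left_commute\<close>)
  then show "(neg_binomial 1 * G h) $$ n \<ge> 0"
    using \<alpha> q h by (auto simp: fps_sum_nth less_imp_le intro!: sum_nonneg mult_nonneg_nonneg neg_binomial_nonneg)
next
  fix \<nu> :: real assume \<nu>: "\<nu> \<ge> 0"
  have "(\<lambda>n. 1 - \<nu> * ((t / real n) powr (1 - 1) *
      (neg_binomial 1 * inverse (fps_const (g0 (t / real n) + \<nu>) - N (t / real n))) $$ n))
     \<longlonglongrightarrow> 1 - \<nu> * (t powr \<alpha> 1 * mode_ML m \<alpha> q \<nu> (1 + \<alpha> 1) t)"
    using tendsto_diff[OF tendsto_const tendsto_mult[OF tendsto_const mode_ML_limit[OF t zero_le_one \<nu>]], of 1 \<nu>]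
    by (simp only: add_diff_cancel_right' add_diff_cancel_left' add.commute[of "\<alpha> 1"])
  moreover have "eventually (\<lambda>n. 1 - \<nu> * ((t / real n) powr (1 - 1) *
      (neg_binomial 1 * inverse (fps_const (g0 (t / real n) + \<nu>) - N (t / real n))) $$ n) =
     (neg_binomial 1 * G (t / real n) * inverse (fps_const (g0 (t / real n) + \<nu>) - N (t / real n))) $$ n) sequentially"
    using eventually_gt_at_top[of 0]
  proof eventually_elim
    case (elim n)
    define h where "h = t / real n"
    have h: "h > 0" using elim t by (simp add: h_def)
    define R where "R = fps_const (g0 h + \<nu>) - N h"
    have "R $$ 0 \<noteq> 0" using g0_pos[OF h] \<nu> by (simp add: R_def N_nth_0)
    then have R: "R * inverse R = 1" by (rule inverse_mult_eq_1')
    have GR: "G h = R - fps_const \<nu>" by (simp add: R_def N_def flip: fps_const_add)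
    have "neg_binomial 1 * G h * inverse R = neg_binomial 1 * (R * inverse R) - fps_const \<nu> * (neg_binomial 1 * inverse R)"
      unfolding GR by (simp only: left_diff_distrib right_diff_distrib mult_ac)
    then have "(neg_binomial 1 * G h * inverse R) $$ n = 1 - \<nu> * (neg_binomial 1 * inverse R) $$ n"
      unfolding R by (simp add: neg_binomial_1_nth)
    then show ?case using h unfolding h_def[symmetric] R_def[symmetric] by simp
  qed
  ultimately show "(\<lambda>n. (neg_binomial 1 * G (t / real n) * inverse (fps_const (g0 (t / real n) + \<nu>) - N (t / real n))) $$ n)
     \<longlonglongrightarrow> 1 - \<nu> * t powr \<alpha> 1 * mode_ML m \<alpha> q \<nu> (1 + \<alpha> 1) t"
    by (simp add: tendsto_cong mult.assoc)
qed

text \<open>By log-convexity a zero at \<nu> would be inherited by \<nu>/2, \<nu>/4 and so on. Close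
  to 0 this is impossible: the multiplier is 1 - \<nu> J(\<nu>), where J is bounded by J(0).\<close>

lemma initial_multiplier_pos:
  assumes t: "t > 0" and \<nu>: "\<nu> \<ge> 0"
  shows "1 - \<nu> * t powr \<alpha> 1 * mode_ML m \<alpha> q \<nu> (1 + \<alpha> 1) t > 0"
proof -
  define e where "e = (\<lambda>\<nu>. 1 - \<nu> * t powr \<alpha> 1 * mode_ML m \<alpha> q \<nu> (1 + \<alpha> 1) t)"
  define J where "J = (\<lambda>\<nu>. t powr \<alpha> 1 * mode_ML m \<alpha> q \<nu> (1 + \<alpha> 1) t)"
  have e: "resolvent_sum_limit e" unfolding e_def by (rule resolvent_sum_limit_initial[OF t])
  have J: "resolvent_sum_limit J" unfolding J_def by (rule resolvent_sum_limit_integrated[OF t])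
  have e0: "e 0 = 1" by (simp add: e_def)
  have zero: "e (\<nu> / 2 ^ k) = 0" if "e \<nu> = 0" for k
  proof (induction k)
    case (Suc k)
    have "(e (\<nu> / 2 ^ k / 2))\<^sup>2 \<le> e 0 * e (\<nu> / 2 ^ k)"
      using \<nu> by (intro resolvent_sum_limit_log_convex[OF e]) auto
    then show ?case using Suc by (simp add: mult.commute)
  qed (use that in auto)
  have "e \<nu> \<noteq> 0"
  proof
    assume "e \<nu> = 0"
    have "1 \<le> \<nu> / 2 ^ k * J 0" for k
    proof -
      have "\<nu> / 2 ^ k * J (\<nu> / 2 ^ k) = 1" using zero[OF \<open>e \<nu> = 0\<close>, of k] by (simp add: e_def J_def mult.assoc)
      moreover have "\<nu> / 2 ^ k * J (\<nu> / 2 ^ k) \<le> \<nu> / 2 ^ k * J 0"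
        using \<nu> resolvent_sum_limit_antimono[OF J, of "\<nu> / 2 ^ k"] by (intro mult_left_mono) auto
      ultimately show ?thesis by simp
    qed
    moreover have "(\<lambda>k. \<nu> * J 0 * (1 / 2) ^ k) \<longlonglongrightarrow> 0"
      by (intro tendsto_mult_right_zero LIMSEQ_realpow_zero) auto
    ultimately have "1 \<le> (0::real)"
      by (intro LIMSEQ_le_const[of _ 0 1]) (auto simp: power_one_over)
    then show False by simp
  qed
  moreover have "e \<nu> \<ge> 0" using e \<nu> by (rule resolvent_sum_limit_nonneg)
  ultimately show ?thesis by (simp add: e_def)
qed

end

section \<open>Square integrable functions\<close>


lemma L2_measurable: "f \<in> L2 \<Omega> \<Longrightarrow> f \<in> borel_measurable (lebesgue_on \<Omega>)"
  and L2_square_integrable: "f \<in> L2 \<Omega> \<Longrightarrow> integrable (lebesgue_on \<Omega>) (\<lambda>x. (f x)\<^sup>2)"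
  by (auto simp: L2_def)

lemma L2_mult_integrable:
  assumes "f \<in> L2 \<Omega>" "g \<in> L2 \<Omega>"
  shows "integrable (lebesgue_on \<Omega>) (\<lambda>x. f x * g x)"
proof (rule Bochner_Integration.integrable_bound)
  show "integrable (lebesgue_on \<Omega>) (\<lambda>x. (f x)\<^sup>2 + (g x)\<^sup>2)"
    using assms by (auto simp: L2_def)
  show "(\<lambda>x. f x * g x) \<in> borel_measurable (lebesgue_on \<Omega>)"
    using assms by (auto simp: L2_def)
  have "\<bar>a * b\<bar> \<le> a\<^sup>2 + b\<^sup>2" for a b :: real
  proof -
    have "2 * \<bar>a * b\<bar> \<le> a\<^sup>2 + b\<^sup>2"
      using sum_squares_bound[of "\<bar>a\<bar>" "\<bar>b\<bar>"] by (simp add: abs_mult)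
    then show ?thesis using abs_ge_zero[of "a * b"] by linarith
  qed
  then show "AE x in lebesgue_on \<Omega>. norm (f x * g x) \<le> norm ((f x)\<^sup>2 + (g x)\<^sup>2)"
    by (auto simp: abs_mult)
qed

lemma L2_add: assumes "f \<in> L2 \<Omega>" "g \<in> L2 \<Omega>" shows "(\<lambda>x. f x + g x) \<in> L2 \<Omega>"
proof -
  have "integrable (lebesgue_on \<Omega>) (\<lambda>x. (f x)\<^sup>2 + (g x)\<^sup>2 + 2 * (f x * g x))"
    using assms L2_mult_integrable[OF assms] by (auto simp: L2_def)
  then show ?thesis using assms by (auto simp: L2_def power2_sum mult.assoc)
qed

lemma L2_bounded_mult:
  assumes "f \<in> L2 \<Omega>" "k \<in> borel_measurable (lebesgue_on \<Omega>)" "\<And>x. x \<in> \<Omega> \<Longrightarrow> \<bar>k x\<bar> \<le> C"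
    "\<Omega> \<in> sets lebesgue"
  shows "(\<lambda>x. k x * f x) \<in> L2 \<Omega>"
proof -
  have "integrable (lebesgue_on \<Omega>) (\<lambda>x. (k x * f x)\<^sup>2)"
  proof (rule Bochner_Integration.integrable_bound)
    show "integrable (lebesgue_on \<Omega>) (\<lambda>x. C\<^sup>2 * (f x)\<^sup>2)" using assms by (auto simp: L2_def)
    show "(\<lambda>x. (k x * f x)\<^sup>2) \<in> borel_measurable (lebesgue_on \<Omega>)" using assms by (auto simp: L2_def)
    have "norm ((k x * f x)\<^sup>2) \<le> norm (C\<^sup>2 * (f x)\<^sup>2)" if "x \<in> \<Omega>" for x
    proof -
      have "(k x)\<^sup>2 \<le> C\<^sup>2" using assms(3)[OF that] by (meson abs_le_square_iff abs_ge_self order_trans)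
      then show ?thesis by (simp add: power_mult_distrib mult_right_mono)
    qed
    then show "AE x in lebesgue_on \<Omega>. norm ((k x * f x)\<^sup>2) \<le> norm (C\<^sup>2 * (f x)\<^sup>2)"
      using assms(4) by (intro AE_I2) (auto simp: space_restrict_space)
  qed
  then show ?thesis using assms by (auto simp: L2_def)
qed

lemma L2_dominated:
  assumes "f \<in> L2 \<Omega>" "g \<in> borel_measurable (lebesgue_on \<Omega>)" "\<And>x. \<bar>g x\<bar> \<le> \<bar>f x\<bar>"
  shows "g \<in> L2 \<Omega>"
proof -
  have "integrable (lebesgue_on \<Omega>) (\<lambda>x. (g x)\<^sup>2)"
    by (rule Bochner_Integration.integrable_bound[OF L2_square_integrable[OF assms(1)]])
       (use assms in \<open>auto simp: abs_le_square_iff[symmetric]\<close>)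
  then show ?thesis using assms by (simp add: L2_def)
qed

lemma L2_scale: "f \<in> L2 \<Omega> \<Longrightarrow> (\<lambda>x. k * f x) \<in> L2 \<Omega>"
  by (auto simp: L2_def power_mult_distrib)

lemma L2_diff: assumes "f \<in> L2 \<Omega>" "g \<in> L2 \<Omega>" shows "(\<lambda>x. f x - g x) \<in> L2 \<Omega>"
  using L2_add[OF assms(1) L2_scale[OF assms(2), of "-1"]] by simp

lemma L2_zero: "(\<lambda>x. 0) \<in> L2 \<Omega>"
  by (auto simp: L2_def)

lemma L2_sum: "(\<And>i. i \<in> I \<Longrightarrow> f i \<in> L2 \<Omega>) \<Longrightarrow> (\<lambda>x. \<Sum>i\<in>I. f i x) \<in> L2 \<Omega>"
  by (induction I rule: infinite_finite_induct) (auto simp: L2_zero L2_add)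

lemma L2_inner_commute: "L2_inner \<Omega> f g = L2_inner \<Omega> g f"
  by (simp add: L2_inner_def mult.commute)

lemma L2_inner_add_left:
  "f \<in> L2 \<Omega> \<Longrightarrow> g \<in> L2 \<Omega> \<Longrightarrow> h \<in> L2 \<Omega> \<Longrightarrow>
    L2_inner \<Omega> (\<lambda>x. f x + g x) h = L2_inner \<Omega> f h + L2_inner \<Omega> g h"
  by (simp add: L2_inner_def distrib_right L2_mult_integrable)

lemma L2_inner_diff_left:
  "f \<in> L2 \<Omega> \<Longrightarrow> g \<in> L2 \<Omega> \<Longrightarrow> h \<in> L2 \<Omega> \<Longrightarrow>
    L2_inner \<Omega> (\<lambda>x. f x - g x) h = L2_inner \<Omega> f h - L2_inner \<Omega> g h"
  by (simp add: L2_inner_def left_diff_distrib L2_mult_integrable)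

lemma L2_inner_scale_left: "L2_inner \<Omega> (\<lambda>x. k * f x) h = k * L2_inner \<Omega> f h"
  by (simp add: L2_inner_def mult.assoc)

lemma L2_inner_sum_left:
  "(\<And>i. i \<in> I \<Longrightarrow> f i \<in> L2 \<Omega>) \<Longrightarrow> h \<in> L2 \<Omega> \<Longrightarrow>
    L2_inner \<Omega> (\<lambda>x. \<Sum>i\<in>I. f i x) h = (\<Sum>i\<in>I. L2_inner \<Omega> (f i) h)"
proof (induction I rule: infinite_finite_induct)
  case (insert i I)
  then show ?case by (simp add: L2_inner_add_left L2_sum)
qed (auto simp: L2_inner_def)

lemma L2_inner_add_right:
  "f \<in> L2 \<Omega> \<Longrightarrow> g \<in> L2 \<Omega> \<Longrightarrow> h \<in> L2 \<Omega> \<Longrightarrow>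
    L2_inner \<Omega> h (\<lambda>x. f x + g x) = L2_inner \<Omega> h f + L2_inner \<Omega> h g"
  by (simp add: L2_inner_def distrib_left L2_mult_integrable)

lemma L2_inner_diff_right:
  "f \<in> L2 \<Omega> \<Longrightarrow> g \<in> L2 \<Omega> \<Longrightarrow> h \<in> L2 \<Omega> \<Longrightarrow>
    L2_inner \<Omega> h (\<lambda>x. f x - g x) = L2_inner \<Omega> h f - L2_inner \<Omega> h g"
  by (simp add: L2_inner_def right_diff_distrib L2_mult_integrable)

lemma L2_inner_self_nonneg: "L2_inner \<Omega> f f \<ge> 0"
  by (simp add: L2_inner_def integral_nonneg)

lemma L2_norm_nonneg: "L2_norm \<Omega> f \<ge> 0"
  by (simp add: L2_norm_def L2_inner_self_nonneg)

lemma L2_norm_power2: "(L2_norm \<Omega> f)\<^sup>2 = L2_inner \<Omega> f f"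
  by (simp add: L2_norm_def L2_inner_self_nonneg)

lemma L2_Cauchy_Schwarz:
  assumes "f \<in> L2 \<Omega>" "g \<in> L2 \<Omega>"
  shows "\<bar>L2_inner \<Omega> f g\<bar> \<le> L2_norm \<Omega> f * L2_norm \<Omega> g"
proof -
  define a b c where "a = L2_inner \<Omega> f f" and "b = L2_inner \<Omega> f g" and "c = L2_inner \<Omega> g g"
  have pos: "0 \<le> a + 2 * s * b + s\<^sup>2 * c" for s
  proof -
    have i: "integrable (lebesgue_on \<Omega>) (\<lambda>x. f x * f x)" "integrable (lebesgue_on \<Omega>) (\<lambda>x. f x * g x)"
       "integrable (lebesgue_on \<Omega>) (\<lambda>x. g x * g x)"
      using assms by (auto intro!: L2_mult_integrable)
    have "L2_inner \<Omega> (\<lambda>x. f x + s * g x) (\<lambda>x. f x + s * g x) =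
       (LINT x|lebesgue_on \<Omega>. f x * f x + 2 * s * (f x * g x) + s\<^sup>2 * (g x * g x))"
      unfolding L2_inner_def by (intro Bochner_Integration.integral_cong refl) (simp add: algebra_simps power2_eq_square)
    also have "\<dots> = a + 2 * s * b + s\<^sup>2 * c"
      using i by (simp add: a_def b_def c_def L2_inner_def)
    finally show ?thesis using L2_inner_self_nonneg[of \<Omega> "\<lambda>x. f x + s * g x"] by simp
  qed
  have "b\<^sup>2 \<le> a * c"
  proof (cases "c = 0")
    case True
    have "b = 0"
    proof (rule ccontr)
      assume "b \<noteq> 0"
      \<comment> \<open>This value of \<open>s\<close> makes a + 2 s b equal to -1.\<close>
      then show False using pos[of "- (a + 1) / (2 * b)"] True by (simp add: field_simps)
    qed
    then show ?thesis by (simp add: True)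
  next
    case False
    then have "c > 0" using L2_inner_self_nonneg[of \<Omega> g] by (simp add: c_def)
    then show ?thesis using pos[of "- b / c"] by (simp add: field_simps power2_eq_square)
  qed
  then have "\<bar>b\<bar> \<le> sqrt (a * c)" by (simp add: real_le_rsqrt)
  then show ?thesis by (simp add: L2_norm_def a_def b_def c_def real_sqrt_mult)
qed

lemma L2_norm_triangle:
  assumes "f \<in> L2 \<Omega>" "g \<in> L2 \<Omega>"
  shows "L2_norm \<Omega> (\<lambda>x. f x + g x) \<le> L2_norm \<Omega> f + L2_norm \<Omega> g"
proof (rule power2_le_imp_le)
  have "(L2_norm \<Omega> (\<lambda>x. f x + g x))\<^sup>2 = L2_inner \<Omega> f f + L2_inner \<Omega> g g + 2 * L2_inner \<Omega> f g"
    unfolding L2_norm_power2 using assms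
    by (simp add: L2_inner_add_left L2_add L2_inner_add_right L2_inner_commute[of \<Omega> g f])
  also have "\<dots> \<le> L2_inner \<Omega> f f + L2_inner \<Omega> g g + 2 * (L2_norm \<Omega> f * L2_norm \<Omega> g)"
    using L2_Cauchy_Schwarz[OF assms] by simp
  also have "\<dots> = (L2_norm \<Omega> f + L2_norm \<Omega> g)\<^sup>2"
    by (simp add: power2_sum L2_norm_power2)
  finally show "(L2_norm \<Omega> (\<lambda>x. f x + g x))\<^sup>2 \<le> (L2_norm \<Omega> f + L2_norm \<Omega> g)\<^sup>2" .
qed (simp add: L2_norm_nonneg add_nonneg_nonneg)

lemma L2_norm_scale: "L2_norm \<Omega> (\<lambda>x. k * f x) = \<bar>k\<bar> * L2_norm \<Omega> f"
  by (simp add: L2_norm_def L2_inner_scale_left L2_inner_commute[of \<Omega> f "\<lambda>x. k * f x"]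
      L2_inner_scale_left real_sqrt_mult mult.assoc[symmetric] abs_mult_self_eq)

lemma L2_norm_minus_commute: "L2_norm \<Omega> (\<lambda>x. f x - g x) = L2_norm \<Omega> (\<lambda>x. g x - f x)"
  using L2_norm_scale[of \<Omega> "-1" "\<lambda>x. g x - f x"] by simp

lemma L2_norm_mono:
  assumes "f \<in> L2 \<Omega>" "g \<in> L2 \<Omega>" "\<And>x. x \<in> \<Omega> \<Longrightarrow> \<bar>f x\<bar> \<le> \<bar>g x\<bar>"
  shows "L2_norm \<Omega> f \<le> L2_norm \<Omega> g"
  unfolding L2_norm_def L2_inner_def
proof (intro real_sqrt_le_mono integral_mono L2_mult_integrable assms)
  fix x assume "x \<in> space (lebesgue_on \<Omega>)"
  then have "\<bar>f x\<bar> * \<bar>f x\<bar> \<le> \<bar>g x\<bar> * \<bar>g x\<bar>" using assms by (intro mult_mono) (auto simp: space_restrict_space)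
  then show "f x * f x \<le> g x * g x" by (simp flip: abs_mult)
qed

section \<open>Convergence in the L2 norm\<close>

lemma L2_tendsto_inner:
  assumes "L2_tendsto \<Omega> f f'" "L2_tendsto \<Omega> g g'"
  shows "(\<lambda>k. L2_inner \<Omega> (f k) (g k)) \<longlonglongrightarrow> L2_inner \<Omega> f' g'"
proof -
  have f: "\<And>k. f k \<in> L2 \<Omega>" "f' \<in> L2 \<Omega>" "(\<lambda>k. L2_norm \<Omega> (\<lambda>x. f k x - f' x)) \<longlonglongrightarrow> 0"
   and g: "\<And>k. g k \<in> L2 \<Omega>" "g' \<in> L2 \<Omega>" "(\<lambda>k. L2_norm \<Omega> (\<lambda>x. g k x - g' x)) \<longlonglongrightarrow> 0"
    using assms by (auto simp: L2_tendsto_def)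
  let ?u = "\<lambda>k. L2_norm \<Omega> (\<lambda>x. f k x - f' x)" and ?v = "\<lambda>k. L2_norm \<Omega> (\<lambda>x. g k x - g' x)"
  have "(\<lambda>k. ?u k * (?v k + L2_norm \<Omega> g') + L2_norm \<Omega> f' * ?v k) \<longlonglongrightarrow> 0 * (0 + L2_norm \<Omega> g') + L2_norm \<Omega> f' * 0"
    by (intro tendsto_intros f g)
  then have lim: "(\<lambda>k. ?u k * (?v k + L2_norm \<Omega> g') + L2_norm \<Omega> f' * ?v k) \<longlonglongrightarrow> 0" by simp
  have "norm (L2_inner \<Omega> (f k) (g k) - L2_inner \<Omega> f' g') \<le> ?u k * (?v k + L2_norm \<Omega> g') + L2_norm \<Omega> f' * ?v k" for k
  proof -
    have "L2_inner \<Omega> (f k) (g k) - L2_inner \<Omega> f' g' =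
       L2_inner \<Omega> (\<lambda>x. f k x - f' x) (g k) + L2_inner \<Omega> f' (\<lambda>x. g k x - g' x)"
      using f g by (simp add: L2_inner_diff_left L2_inner_diff_right)
    also have "\<bar>\<dots>\<bar> \<le> ?u k * L2_norm \<Omega> (g k) + L2_norm \<Omega> f' * ?v k"
      using f g by (intro order_trans[OF abs_triangle_ineq] add_mono L2_Cauchy_Schwarz L2_diff)
    also have "\<dots> \<le> ?u k * (?v k + L2_norm \<Omega> g') + L2_norm \<Omega> f' * ?v k"
      using L2_norm_triangle[OF L2_diff[OF g(1)[of k] g(2)] g(2)] 
      by (intro add_right_mono mult_left_mono L2_norm_nonneg) simp
    finally show ?thesis by simp
  qed
  then have "(\<lambda>k. L2_inner \<Omega> (f k) (g k) - L2_inner \<Omega> f' g') \<longlonglongrightarrow> 0"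
    by (intro Lim_null_comparison[OF _ lim]) auto
  then show ?thesis by (simp add: LIM_zero_iff)
qed

lemma L2_tendsto_const: "f \<in> L2 \<Omega> \<Longrightarrow> L2_tendsto \<Omega> (\<lambda>_. f) f"
  by (auto simp: L2_tendsto_def L2_norm_def L2_inner_def)

lemma L2_tendsto_add:
  assumes "L2_tendsto \<Omega> f f'" "L2_tendsto \<Omega> g g'"
  shows "L2_tendsto \<Omega> (\<lambda>k x. f k x + g k x) (\<lambda>x. f' x + g' x)"
  unfolding L2_tendsto_def
proof (intro conjI allI)
  have f: "\<And>k. f k \<in> L2 \<Omega>" "f' \<in> L2 \<Omega>" "(\<lambda>k. L2_norm \<Omega> (\<lambda>x. f k x - f' x)) \<longlonglongrightarrow> 0"
   and g: "\<And>k. g k \<in> L2 \<Omega>" "g' \<in> L2 \<Omega>" "(\<lambda>k. L2_norm \<Omega> (\<lambda>x. g k x - g' x)) \<longlonglongrightarrow> 0"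
    using assms by (auto simp: L2_tendsto_def)
  show "(\<lambda>x. f k x + g k x) \<in> L2 \<Omega>" for k using f g by (intro L2_add)
  show "(\<lambda>x. f' x + g' x) \<in> L2 \<Omega>" using f g by (intro L2_add)
  have "L2_norm \<Omega> (\<lambda>x. f k x + g k x - (f' x + g' x)) \<le>
      L2_norm \<Omega> (\<lambda>x. f k x - f' x) + L2_norm \<Omega> (\<lambda>x. g k x - g' x)" for k
    using L2_norm_triangle[OF L2_diff[OF f(1)[of k] f(2)] L2_diff[OF g(1)[of k] g(2)]]
    by (simp add: algebra_simps)
  then show "(\<lambda>k. L2_norm \<Omega> (\<lambda>x. f k x + g k x - (f' x + g' x))) \<longlonglongrightarrow> 0"
    by (intro tendsto_sandwich[OF _ _ tendsto_const tendsto_add_zero[OF f(3) g(3)]])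
       (auto simp: L2_norm_nonneg)
qed

lemma L2_tendsto_scale:
  assumes "L2_tendsto \<Omega> f f'" shows "L2_tendsto \<Omega> (\<lambda>k x. c * f k x) (\<lambda>x. c * f' x)"
proof -
  have "(\<lambda>k. \<bar>c\<bar> * L2_norm \<Omega> (\<lambda>x. f k x - f' x)) \<longlonglongrightarrow> 0"
    using assms by (intro tendsto_mult_right_zero) (auto simp: L2_tendsto_def)
  then show ?thesis using assms
    by (auto simp: L2_tendsto_def L2_scale right_diff_distrib[symmetric] L2_norm_scale)
qed

lemma L2_tendsto_sum:
  "(\<And>i. i \<in> I \<Longrightarrow> L2_tendsto \<Omega> (f i) (g i)) \<Longrightarrow>
     L2_tendsto \<Omega> (\<lambda>k x. \<Sum>i\<in>I. f i k x) (\<lambda>x. \<Sum>i\<in>I. g i x)"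
  by (induction I rule: infinite_finite_induct) (auto simp: L2_tendsto_add L2_tendsto_const L2_zero)

text \<open>Meant for maps that are Lipschitz pointwise: multiplication by a bounded coefficient,
  and truncation by \<open>smooth_pos\<close>.\<close>

lemma L2_tendsto_dominated:
  assumes "L2_tendsto \<Omega> f f'" "\<And>k. g k \<in> L2 \<Omega>" "g' \<in> L2 \<Omega>"
    "\<And>k x. x \<in> \<Omega> \<Longrightarrow> \<bar>g k x - g' x\<bar> \<le> C * \<bar>f k x - f' x\<bar>"
  shows "L2_tendsto \<Omega> g g'"
  unfolding L2_tendsto_def
proof (intro conjI allI)
  have f: "\<And>k. f k \<in> L2 \<Omega>" "f' \<in> L2 \<Omega>" "(\<lambda>k. L2_norm \<Omega> (\<lambda>x. f k x - f' x)) \<longlonglongrightarrow> 0"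
    using assms by (auto simp: L2_tendsto_def)
  have "L2_norm \<Omega> (\<lambda>x. g k x - g' x) \<le> L2_norm \<Omega> (\<lambda>x. C * (f k x - f' x))" for k
    using f assms(2,3)
  proof (intro L2_norm_mono L2_scale L2_diff)
    fix x assume "x \<in> \<Omega>"
    then have "\<bar>g k x - g' x\<bar> \<le> C * \<bar>f k x - f' x\<bar>" by (rule assms(4))
    also have "\<dots> \<le> \<bar>C * (f k x - f' x)\<bar>" by (simp add: abs_mult mult_right_mono)
    finally show "\<bar>g k x - g' x\<bar> \<le> \<bar>C * (f k x - f' x)\<bar>" .
  qed auto
  then have le: "L2_norm \<Omega> (\<lambda>x. g k x - g' x) \<le> \<bar>C\<bar> * L2_norm \<Omega> (\<lambda>x. f k x - f' x)" for k
    by (simp add: L2_norm_scale)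
  show "(\<lambda>k. L2_norm \<Omega> (\<lambda>x. g k x - g' x)) \<longlonglongrightarrow> 0"
    using le by (intro tendsto_sandwich[OF _ _ tendsto_const tendsto_mult_right_zero[OF f(3), where c = "\<bar>C\<bar>"]])
       (auto simp: L2_norm_nonneg)
qed (use assms in auto)

lemma L2_norm_zero_AE:
  assumes "f \<in> L2 \<Omega>" "L2_inner \<Omega> f f = 0" shows "AE x in lebesgue_on \<Omega>. f x = 0"
proof -
  have "AE x in lebesgue_on \<Omega>. f x * f x = 0"
    using assms L2_mult_integrable[OF assms(1) assms(1)]
    by (subst (asm) L2_inner_def) (simp add: integral_nonneg_eq_0_iff_AE)
  then show ?thesis by simp
qed

lemma L2_inner_nonneg_AE:
  assumes "AE x in lebesgue_on \<Omega>. f x \<ge> 0" "AE x in lebesgue_on \<Omega>. g x \<ge> 0"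
  shows "L2_inner \<Omega> f g \<ge> 0"
  unfolding L2_inner_def by (rule integral_nonneg_AE) (use assms in eventually_elim, auto)

lemma L2_bounded:
  assumes "k \<in> borel_measurable (lebesgue_on \<Omega>)" "\<And>x. x \<in> \<Omega> \<Longrightarrow> \<bar>k x\<bar> \<le> C" "\<Omega> \<in> lmeasurable"
  shows "k \<in> L2 \<Omega>"
proof -
  have "(\<lambda>x. 1) \<in> L2 \<Omega>"
    using finite_measure.integrable_const[OF finite_measure_lebesgue_on[OF assms(3)]] by (auto simp: L2_def)
  from L2_bounded_mult[OF this assms(1,2)] assms(3) show ?thesis by (auto simp: fmeasurable_def)
qed

text \<open>The negative part of \<open>f\<close> is itself an admissible \<psi>, and the inner
  product of \<open>f\<close> with it is minus its squared norm.\<close>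

lemma nonneg_AE_of_inner_nonneg:
  assumes f: "f \<in> L2 \<Omega>" and \<Omega>: "\<Omega> \<in> lmeasurable"
    and "\<And>\<psi>. \<psi> \<in> L2 \<Omega> \<Longrightarrow> (\<And>x. \<psi> x \<ge> 0) \<Longrightarrow> L2_inner \<Omega> f \<psi> \<ge> 0"
  shows "AE x in lebesgue_on \<Omega>. f x \<ge> 0"
proof -
  define g where "g = (\<lambda>x. max 0 (- f x))"
  have fm: "f \<in> borel_measurable (lebesgue_on \<Omega>)" using f by (rule L2_measurable)
  have gm: "g \<in> borel_measurable (lebesgue_on \<Omega>)" unfolding g_def using fm by measurable
  have g: "g \<in> L2 \<Omega>" by (rule L2_dominated[OF f gm]) (auto simp: g_def max_def)
  have "0 \<le> L2_inner \<Omega> f g" using g by (intro assms(3)) (auto simp: g_def)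
  also have "L2_inner \<Omega> f g = - L2_inner \<Omega> g g"
    unfolding L2_inner_def Bochner_Integration.integral_minus[symmetric] by (intro Bochner_Integration.integral_cong refl) (auto simp: g_def max_def)
  finally have "L2_inner \<Omega> g g = 0" using L2_inner_self_nonneg[of \<Omega> g] by simp
  from L2_norm_zero_AE[OF g this] show ?thesis by eventually_elim (auto simp: g_def max_def split: if_splits)
qed

section \<open>Smooth functions\<close>


lemma pd_eq: "(f has_derivative f') (at x) \<Longrightarrow> pd j f x = f' (axis j 1)"
  unfolding pd_def using frechet_derivative_at by metis

lemma has_derivative_pd:
  fixes f :: "real^'n::finite \<Rightarrow> real"
  assumes "f differentiable (at x)"
  shows "(f has_derivative (\<lambda>h. \<Sum>j\<in>UNIV. pd j f x * h $ j)) (at x)"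
proof -
  define f' where "f' = frechet_derivative f (at x)"
  have f': "(f has_derivative f') (at x)" using assms unfolding f'_def by (simp add: frechet_derivative_works)
  interpret f': bounded_linear f' using f' by (rule has_derivative_bounded_linear)
  have "f' h = (\<Sum>j\<in>UNIV. pd j f x * h $ j)" for h
  proof -
    have "f' h = f' (\<Sum>j\<in>UNIV. h $ j *\<^sub>R axis j 1)" by (simp add: basis_expansion flip: scalar_mult_eq_scaleR)
    also have "\<dots> = (\<Sum>j\<in>UNIV. h $ j * f' (axis j 1))" by (simp add: f'.sum f'.scale)
    finally show ?thesis by (simp add: pd_def f'_def mult.commute)
  qed
  then have "f' = (\<lambda>h. \<Sum>j\<in>UNIV. pd j f x * h $ j)" by (rule ext)
  with f' show ?thesis by simp
qed

text \<open>This holds at points without a derivative too: \<open>frechet_derivative\<close> is a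
  choice from a predicate that \<open>f\<close> and \<open>g\<close> share.\<close>

lemma pd_cong_open:
  assumes "open U" "x \<in> U" "\<And>y. y \<in> U \<Longrightarrow> f y = g y" shows "pd j f x = pd j g x"
proof -
  have "(f has_derivative D) (at x) \<longleftrightarrow> (g has_derivative D) (at x)" for D
    using assms by (auto intro: has_derivative_transform_within_open[of _ _ _ _ U])
  then show ?thesis by (simp add: pd_def frechet_derivative_def)
qed

text \<open>A coinductive rule: it suffices to exhibit a family that contains all iterated
  derivatives. The families used below are generated algebras and images under
  mollification.\<close>

lemma smooth_onI_invariant:
  assumes "f \<in> S" "\<And>g x. g \<in> S \<Longrightarrow> g differentiable (at x)" "\<And>g j. g \<in> S \<Longrightarrow> pd j g \<in> S"
  shows "smooth_on UNIV f"
proof -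
  have "iter_pd js f \<in> S" for js by (induction js) (auto simp: assms)
  then show ?thesis by (auto simp: smooth_on_def assms(2))
qed

lemma iter_pd_append: "iter_pd (is @ js) f = iter_pd is (iter_pd js f)"
  by (induction "is") auto

lemma smooth_on_pd: "smooth_on UNIV f \<Longrightarrow> smooth_on UNIV (pd j f)"
  using iter_pd_append[of _ "[j]" f] by (simp add: smooth_on_def) metis

lemma smooth_on_differentiable: "smooth_on UNIV f \<Longrightarrow> f differentiable (at x)"
  unfolding smooth_on_def by (drule spec[of _ "[]"]) simp

lemma smooth_on_continuous: "smooth_on UNIV f \<Longrightarrow> continuous_on S f"
  by (meson continuous_at_imp_continuous_on differentiable_imp_continuous_within smooth_on_differentiable)

text \<open>Serves as invariant in \<open>smooth_onI_invariant\<close>: derivatives of sums and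
  products are polynomials in the generators as soon as the derivatives of the generators
  are.\<close>

inductive_set generated_algebra :: "('a \<Rightarrow> real) set \<Rightarrow> ('a \<Rightarrow> real) set" for B where
  base: "f \<in> B \<Longrightarrow> f \<in> generated_algebra B"
| const: "(\<lambda>_. c) \<in> generated_algebra B"
| add: "f \<in> generated_algebra B \<Longrightarrow> g \<in> generated_algebra B \<Longrightarrow> (\<lambda>x. f x + g x) \<in> generated_algebra B"
| mult: "f \<in> generated_algebra B \<Longrightarrow> g \<in> generated_algebra B \<Longrightarrow> (\<lambda>x. f x * g x) \<in> generated_algebra B"

lemma pd_const: "pd j (\<lambda>_. c) = (\<lambda>_. 0)"
  by (rule ext, subst pd_eq[where f' = "\<lambda>_. 0"]) auto

lemma pd_add:
  assumes "f differentiable (at x)" "g differentiable (at x)"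
  shows "pd j (\<lambda>x. f x + g x) x = pd j f x + pd j g x"
  by (subst pd_eq[OF has_derivative_add[OF has_derivative_pd has_derivative_pd]])
     (auto simp: assms axis_def if_distrib cong: if_cong)

lemma pd_mult:
  assumes "f differentiable (at x)" "g differentiable (at x)"
  shows "pd j (\<lambda>x. f x * g x) x = f x * pd j g x + pd j f x * g x"
  by (subst pd_eq[OF has_derivative_mult[OF has_derivative_pd has_derivative_pd]])
     (auto simp: assms axis_def if_distrib cong: if_cong)

lemma pd_compose:
  fixes f :: "real^'n::finite \<Rightarrow> real"
  assumes "f differentiable (at x)" "(h has_real_derivative h') (at (f x))"
  shows "pd j (\<lambda>x. h (f x)) x = h' * pd j f x"
proof -
  have "((\<lambda>x. h (f x)) has_derivative (\<lambda>y. h' * (\<Sum>j\<in>UNIV. pd j f x * y $ j))) (at x)"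
    using has_derivative_compose[OF has_derivative_pd[OF assms(1)] assms(2)[unfolded has_field_derivative_def]] .
  from pd_eq[OF this] show ?thesis by (simp add: axis_def if_distrib cong: if_cong)
qed

lemma generated_algebra_differentiable:
  assumes "\<And>g x. g \<in> B \<Longrightarrow> g differentiable (at x)" "f \<in> generated_algebra B"
  shows "f differentiable (at x)"
  using assms(2) by induction (auto simp: assms(1))

lemma smooth_on_generated_algebra:
  assumes "\<And>g x. g \<in> B \<Longrightarrow> g differentiable (at x)" "\<And>g j. g \<in> B \<Longrightarrow> pd j g \<in> generated_algebra B"
    "f \<in> generated_algebra B"
  shows "smooth_on UNIV f"
proof (rule smooth_onI_invariant[OF assms(3)])
  have diff: "g differentiable (at x)" if "g \<in> generated_algebra B" for g x
    using generated_algebra_differentiable assms(1) that by blast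
  show "g differentiable (at x)" if "g \<in> generated_algebra B" for g x using diff that .
  show "pd j g \<in> generated_algebra B" if "g \<in> generated_algebra B" for g j
    using that
  proof induction
    case (add f g)
    have "pd j (\<lambda>x. f x + g x) = (\<lambda>x. pd j f x + pd j g x)"
      using add diff by (intro ext pd_add) auto
    then show ?case using add by (auto intro: generated_algebra.add)
  next
    case (mult f g)
    have "pd j (\<lambda>x. f x * g x) = (\<lambda>x. f x * pd j g x + pd j f x * g x)"
      using mult diff by (intro ext pd_mult) auto
    then show ?case using mult by (auto intro: generated_algebra.add generated_algebra.mult)
  qed (auto simp: assms(2) pd_const intro: generated_algebra.const)
qed

lemma smooth_on_algebra:
  "f \<in> generated_algebra {f. smooth_on UNIV f} \<Longrightarrow> smooth_on UNIV f"
  by (rule smooth_on_generated_algebra[where B = "{f. smooth_on UNIV f}"])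
     (auto intro: smooth_on_differentiable smooth_on_pd generated_algebra.base)

lemma smooth_on_const: "smooth_on UNIV (\<lambda>_. c)"
  by (auto intro: smooth_on_algebra generated_algebra.intros)

lemma smooth_on_add: "smooth_on UNIV f \<Longrightarrow> smooth_on UNIV g \<Longrightarrow> smooth_on UNIV (\<lambda>x. f x + g x)"
  by (auto intro: smooth_on_algebra generated_algebra.intros)

lemma smooth_on_mult: "smooth_on UNIV f \<Longrightarrow> smooth_on UNIV g \<Longrightarrow> smooth_on UNIV (\<lambda>x. f x * g x)"
  by (auto intro: smooth_on_algebra generated_algebra.intros)

lemma smooth_on_sum: "(\<And>i. i \<in> I \<Longrightarrow> smooth_on UNIV (f i)) \<Longrightarrow> smooth_on UNIV (\<lambda>x. \<Sum>i\<in>I. f i x)"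
  by (induction I rule: infinite_finite_induct) (auto simp: smooth_on_const smooth_on_add)

lemma smooth_on_coordinate: "smooth_on UNIV (\<lambda>x::real^'n::finite. x $ i)"
proof (rule smooth_on_generated_algebra[where B = "{\<lambda>x::real^'n. x $ i}"])
  have D: "((\<lambda>x::real^'n. x $ i) has_derivative (\<lambda>h. h $ i)) (at x)" for x
    by (rule bounded_linear_imp_has_derivative[OF bounded_linear_vec_nth])
  then have "pd j (\<lambda>x::real^'n. x $ i) = (\<lambda>_. axis j 1 $ i)" for j
    by (auto simp: pd_eq[OF D])
  then show "pd j g \<in> generated_algebra {\<lambda>x::real^'n. x $ i}" if "g \<in> {\<lambda>x::real^'n. x $ i}" for g j
    using that by (auto intro: generated_algebra.const)
  show "g differentiable (at x)" if "g \<in> {\<lambda>x::real^'n. x $ i}" for g x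
    using that D by (auto simp: differentiable_def)
qed (auto intro: generated_algebra.base)

section \<open>The functions exp(-1/s)/s^k and the smooth truncation\<close>

definition flat :: "nat \<Rightarrow> real \<Rightarrow> real" where
  "flat k s = (if s > 0 then exp (- 1 / s) / s ^ k else 0)"

lemma flat_tendsto_0: "(flat k \<longlongrightarrow> 0) (at 0)"
proof -
  have "((\<lambda>s. inverse s ^ k / exp (inverse s)) \<longlongrightarrow> 0) (at_right (0::real))"
    by (rule filterlim_compose[OF tendsto_power_div_exp_0 filterlim_inverse_at_top_right])
  moreover have "eventually (\<lambda>s. inverse s ^ k / exp (inverse s) = flat k s) (at_right (0::real))"
    using eventually_at_right_less[of 0]
    by eventually_elim (simp add: flat_def exp_minus field_simps power_inverse)
  ultimately have R: "(flat k \<longlongrightarrow> 0) (at_right 0)" by (rule Lim_transform_eventually)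
  have "(flat k \<longlongrightarrow> 0) (at_left 0)"
    by (rule tendsto_eventually) (auto simp: eventually_at_filter flat_def)
  with R show ?thesis by (simp add: filterlim_split_at)
qed

text \<open>Differentiation stays in the linear span of the family, which is why the negative powers
  of \<open>s\<close> are carried along.\<close>

lemma flat_DERIV: "(flat k has_real_derivative (flat (k + 2) s - real k * flat (k + 1) s)) (at s)"
proof -
  consider "s > 0" | "s < 0" | "s = 0" by linarith
  then show ?thesis
  proof cases
    case 1
    have "((\<lambda>s. exp (- 1 / s) / s ^ k) has_real_derivative (flat (k + 2) s - real k * flat (k + 1) s)) (at s)"
      using 1 by (auto intro!: derivative_eq_intros simp: flat_def field_simps power2_eq_square)
        (cases k, auto simp: field_simps)
    then show ?thesis
      by (rule has_field_derivative_transform_within_open[where S = "{0<..}"]) (use 1 in \<open>auto simp: flat_def\<close>)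
  next
    case 2
    have "((\<lambda>s. 0) has_real_derivative 0) (at s)" by simp
    then show ?thesis using 2
      by (auto simp: flat_def intro: has_field_derivative_transform_within_open[where S = "{..<0}" and f = "\<lambda>s. 0"])
  next
    case 3
    \<comment> \<open>At 0 the difference quotient of \<open>flat k\<close> is
      \<open>flat (k + 1)\<close> itself.\<close>
    have "(\<lambda>h. (flat k (0 + h) - flat k 0) / h) = flat (k + 1)"
      by (auto simp: flat_def fun_eq_iff field_simps)
    then show ?thesis using flat_tendsto_0[of "k + 1"] 3
      by (simp add: DERIV_def flat_def)
  qed
qed

text \<open>The generators are the smooth functions together with all \<open>flat k\<close> composed
  with \<open>p\<close>; the chain rule keeps their derivatives in the algebra.\<close>

lemma smooth_on_flat:
  assumes "smooth_on UNIV p" shows "smooth_on UNIV (\<lambda>x. flat k (p x))"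
proof -
  define B where "B = {f. smooth_on UNIV f} \<union> {f. \<exists>k. f = (\<lambda>x. flat k (p x))}"
  have B1: "pd j p \<in> generated_algebra B" for j
    using assms by (auto simp: B_def intro: generated_algebra.base smooth_on_pd)
  have B2: "(\<lambda>x. flat k (p x)) \<in> generated_algebra B" for k
    by (auto simp: B_def intro: generated_algebra.base)
  show ?thesis
  proof (rule smooth_on_generated_algebra[OF _ _ B2])
    show "g differentiable (at x)" if "g \<in> B" for g x
    proof -
      have "(\<lambda>x. flat k (p x)) differentiable (at x)" for k
        using has_derivative_compose[OF has_derivative_pd[OF smooth_on_differentiable[OF assms]]
           flat_DERIV[unfolded has_field_derivative_def]] unfolding differentiable_def by blast
      then show ?thesis using that by (auto simp: B_def smooth_on_differentiable)
    qed
    show "pd j g \<in> generated_algebra B" if "g \<in> B" for g j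
    proof -
      have "pd j (\<lambda>x. flat k (p x)) = (\<lambda>x. (flat (k + 2) (p x) + (- real k) * flat (k + 1) (p x)) * pd j p x)" for k
        using pd_compose[OF smooth_on_differentiable[OF assms] flat_DERIV] by auto
      then have "pd j (\<lambda>x. flat k (p x)) \<in> generated_algebra B" for k
        by (simp only:) (intro generated_algebra.intros B1 B2)
      then show ?thesis using that by (auto simp: B_def intro: generated_algebra.base smooth_on_pd)
    qed
  qed
qed

lemma flat_0_bounds: "0 \<le> flat 0 s" "flat 0 s \<le> 1"
  by (auto simp: flat_def)

text \<open>A smooth nondecreasing substitute for the positive part, used to truncate test functions.\<close>

definition smooth_pos :: "real \<Rightarrow> real" where "smooth_pos s = s * flat 0 s"

definition smooth_pos_deriv :: "real \<Rightarrow> real" where "smooth_pos_deriv s = flat 0 s + flat 1 s"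

lemma smooth_pos_DERIV: "(smooth_pos has_real_derivative smooth_pos_deriv s) (at s)"
proof -
  have "s * flat 2 s = flat 1 s" by (simp add: flat_def power2_eq_square)
  then show ?thesis
    unfolding smooth_pos_def[abs_def] smooth_pos_deriv_def
    using DERIV_mult[OF DERIV_ident flat_DERIV[of 0 s]] by (simp add: numeral_2_eq_2 mult.commute)
qed

lemma smooth_pos_deriv_bounds: "0 \<le> smooth_pos_deriv s" "smooth_pos_deriv s \<le> 2"
proof -
  \<comment> \<open>Gives (1/s) exp(-1/s) \<le> 1; together with \<open>flat_0_bounds\<close> this
    is the Lipschitz constant 2 of the truncation.\<close>
  have "1 / s \<le> exp (1 / s)" using exp_ge_add_one_self[of "1 / s"] by linarith
  then have "exp (- (1 / s)) * (1 / s) \<le> exp (- (1 / s)) * exp (1 / s)" by (intro mult_left_mono) auto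
  then have "exp (- (1 / s)) * (1 / s) \<le> 1" by (simp add: exp_minus)
  then have "flat 1 s \<le> 1" by (simp add: flat_def)
  then show "smooth_pos_deriv s \<le> 2" using flat_0_bounds[of s] by (simp add: smooth_pos_deriv_def)
  show "0 \<le> smooth_pos_deriv s" by (auto simp: smooth_pos_deriv_def flat_def)
qed

lemma smooth_pos_nonneg: "smooth_pos s \<ge> 0"
  and smooth_pos_eq_0: "s \<le> 0 \<Longrightarrow> smooth_pos s = 0"
  and smooth_pos_le: "smooth_pos s \<le> \<bar>s\<bar>"
  by (auto simp: smooth_pos_def flat_def)

lemma smooth_pos_lipschitz: "\<bar>smooth_pos s - smooth_pos t\<bar> \<le> 2 * \<bar>s - t\<bar>"
proof -
  have "norm (smooth_pos s - smooth_pos t) \<le> 2 * norm (s - t)"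
    by (rule field_differentiable_bound[where S = UNIV and f' = "smooth_pos_deriv"])
       (use smooth_pos_deriv_bounds smooth_pos_DERIV in auto)
  then show ?thesis by simp
qed

lemma continuous_on_smooth_pos: "continuous_on S smooth_pos"
  by (rule DERIV_continuous_on[where D = "smooth_pos_deriv"])
     (auto intro: smooth_pos_DERIV has_field_derivative_at_within)

lemma smooth_on_smooth_pos: "smooth_on UNIV p \<Longrightarrow> smooth_on UNIV (\<lambda>x. smooth_pos (p x))"
  unfolding smooth_pos_def by (intro smooth_on_mult smooth_on_flat)

section \<open>Mollification\<close>


lemma pd_zero_outside_closed:
  assumes "closed K" "\<And>x. x \<notin> K \<Longrightarrow> F x = 0" "x \<notin> K" shows "pd j F x = 0"
proof -
  have "pd j F x = pd j (\<lambda>_. 0) x"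
    using assms by (intro pd_cong_open[of "- K"]) auto
  then show ?thesis by (simp add: pd_const)
qed

lemma
  fixes F :: "real^'n::finite \<Rightarrow> real"
  assumes "continuous_on UNIV F" "\<And>x. x \<notin> cbox a b \<Longrightarrow> F x = 0"
  shows integrable_compact_support: "integrable lborel F"
    and integral_compact_support: "integral\<^sup>L lborel F = integral (cbox a b) F"
proof -
  have "integrable lborel (\<lambda>x. indicator (cbox a b) x *\<^sub>R F x)"
    using assms by (intro borel_integrable_compact) (auto intro: continuous_on_subset)
  also have "(\<lambda>x. indicator (cbox a b) x *\<^sub>R F x) = F"
    using assms by (auto simp: fun_eq_iff indicator_def)
  finally show i: "integrable lborel F" .
  have "integral (cbox a b) F = integral UNIV (\<lambda>x. if x \<in> cbox a b then F x else 0)"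
    by (simp add: integral_restrict_UNIV)
  also have "(\<lambda>x. if x \<in> cbox a b then F x else 0) = F" using assms by auto
  finally show "integral\<^sup>L lborel F = integral (cbox a b) F" using integral_lborel[OF i] by simp
qed

lemma lborel_integral_translate:
  fixes F :: "'a::euclidean_space \<Rightarrow> real"
  assumes "F \<in> borel_measurable borel"
  shows "(LINT y|lborel. F (c + y)) = integral\<^sup>L lborel F"
proof -
  have "integral\<^sup>L lborel F = integral\<^sup>L (distr lborel borel ((+) c)) F" by (simp add: lborel_distr_plus)
  also have "\<dots> = (LINT y|lborel. F (c + y))" using assms by (intro integral_distr) auto
  finally show ?thesis ..
qed

text \<open>By translation invariance the integral of F(s e + y) over y does not depend on s, while
  its derivative at s = 0 is the integral of the partial derivative.\<close>

lemma integral_pd_eq_0: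
  fixes F :: "real^'n::finite \<Rightarrow> real"
  assumes diff: "\<And>x. F differentiable (at x)" and cont: "continuous_on UNIV (pd j F)"
    and supp: "\<And>x. x \<notin> cbox a b \<Longrightarrow> F x = 0"
  shows "integral\<^sup>L lborel (pd j F) = 0"
proof -
  define e :: "real^'n" where "e = axis j 1"
  \<comment> \<open>The box is widened by 1 in every coordinate, so that it contains the support of
    each translate with s between -1 and 1.\<close>
  define a' b' where "a' = a - (\<Sum>i\<in>Basis. i)" and "b' = b + (\<Sum>i\<in>Basis. i)"
  have contF: "continuous_on UNIV F"
    using diff by (meson continuous_at_imp_continuous_on differentiable_imp_continuous_within)
  have out: "s *\<^sub>R e + y \<notin> cbox a b" if "y \<notin> cbox a' b'" "s \<in> {-1..1}" for s y
  proof
    assume *: "s *\<^sub>R e + y \<in> cbox a b"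
    have "a' \<bullet> i \<le> y \<bullet> i \<and> y \<bullet> i \<le> b' \<bullet> i" if i: "i \<in> Basis" for i
    proof -
      have "\<bar>s * (e \<bullet> i)\<bar> \<le> 1 * 1"
        using \<open>s \<in> {-1..1}\<close> i unfolding abs_mult e_def
        by (intro mult_mono) (auto simp: axis_eq_axis inner_axis_axis Basis_vec_def)
      moreover have "a \<bullet> i \<le> s * (e \<bullet> i) + y \<bullet> i" "s * (e \<bullet> i) + y \<bullet> i \<le> b \<bullet> i"
        using * i by (auto simp: mem_box inner_add_left)
      ultimately show ?thesis using i
        by (auto simp: a'_def b'_def inner_diff_left inner_add_left inner_sum_left_Basis abs_le_iff)
    qed
    then show False using that(1) by (simp add: mem_box)
  qed
  define \<phi> where "\<phi> = (\<lambda>s. integral (cbox a' b') (\<lambda>y. F (s *\<^sub>R e + y)))"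
  have \<phi>: "\<phi> s = integral\<^sup>L lborel F" if "s \<in> {-1..1}" for s
  proof -
    have "\<phi> s = (LINT y|lborel. F (s *\<^sub>R e + y))"
      unfolding \<phi>_def using out supp that
      by (intro integral_compact_support[symmetric] continuous_on_compose2[OF contF] continuous_intros) auto
    also have "\<dots> = integral\<^sup>L lborel F"
      by (rule lborel_integral_translate) (use contF in \<open>rule borel_measurable_continuous_onI\<close>)
    finally show ?thesis .
  qed
  have "(\<phi> has_field_derivative integral (cbox a' b') (\<lambda>y. pd j F (0 *\<^sub>R e + y))) (at 0 within {-1..1})"
    unfolding \<phi>_def
  proof (rule leibniz_rule_field_derivative)
    fix s :: real and y
    have "((\<lambda>s. F (s *\<^sub>R e + y)) has_derivative (\<lambda>h. \<Sum>i\<in>UNIV. pd i F (s *\<^sub>R e + y) * (h *\<^sub>R e) $ i)) (at s within {-1..1})"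
      by (rule has_derivative_compose[OF _ has_derivative_pd[OF diff]]) (auto intro!: derivative_eq_intros)
    moreover have "(\<lambda>h. \<Sum>i\<in>UNIV. pd i F (s *\<^sub>R e + y) * (h *\<^sub>R e) $ i) = (*) (pd j F (s *\<^sub>R e + y))"
      by (auto simp: e_def axis_def if_distrib fun_eq_iff cong: if_cong)
    ultimately show "((\<lambda>s. F (s *\<^sub>R e + y)) has_field_derivative pd j F (s *\<^sub>R e + y)) (at s within {-1..1})"
      by (simp add: has_field_derivative_def)
    show "(\<lambda>y. F (s *\<^sub>R e + y)) integrable_on cbox a' b'"
      by (intro integrable_continuous continuous_on_compose2[OF contF] continuous_intros) auto
    show "continuous_on ({-1..1} \<times> cbox a' b') (\<lambda>(s, y). pd j F (s *\<^sub>R e + y))"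
      unfolding case_prod_unfold
      by (intro continuous_on_compose2[OF cont] continuous_intros) auto
  qed auto
  moreover have "(\<phi> has_field_derivative 0) (at 0 within {-1..1})"
    by (rule has_field_derivative_transform_within[of "\<lambda>_. integral\<^sup>L lborel F" _ _ _ 1]) (auto simp: \<phi>)
  moreover have "at (0::real) within {-1..1} = at 0"
    by (rule at_within_interior) auto
  ultimately have "integral (cbox a' b') (pd j F) = 0"
    by (simp add: DERIV_unique)
  moreover have "integral\<^sup>L lborel (pd j F) = integral (cbox a' b') (pd j F)"
  proof (rule integral_compact_support[OF cont])
    fix x assume "x \<notin> cbox a' b'"
    then have "0 *\<^sub>R e + x \<notin> cbox a b" by (rule out) auto
    then show "pd j F x = 0" by (intro pd_zero_outside_closed[OF closed_cbox supp]) auto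
  qed
  ultimately show ?thesis by simp
qed

definition mollify :: "(real^'n::finite \<Rightarrow> real) \<Rightarrow> (real^'n \<Rightarrow> real) \<Rightarrow> real^'n \<Rightarrow> real" where
  "mollify f g x = (LINT y|lborel. g (x - y) * f y)"

text \<open>Differentiation under the integral sign, the derivative falling on the smooth factor
  \<open>g\<close>, while \<open>f\<close> is merely continuous.\<close>

lemma
  fixes f g :: "real^'n::finite \<Rightarrow> real"
  assumes f: "continuous_on UNIV f" "\<And>x. x \<notin> cbox a b \<Longrightarrow> f x = 0"
    and g: "smooth_on UNIV g"
  shows mollify_differentiable: "mollify f g differentiable (at x)"
    and pd_mollify: "pd j (mollify f g) x = mollify f (pd j g) x"
proof -
  have m: "mollify f g x = integral (cbox a b) (\<lambda>y. g (x - y) * f y)" if "smooth_on UNIV g" for g x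
    unfolding mollify_def using f
    by (intro integral_compact_support continuous_intros continuous_on_compose2[OF smooth_on_continuous[OF that, of UNIV]]) auto
  \<comment> \<open>The derivative of the integrand as a bounded linear functional, the form in
    which \<open>leibniz_rule\<close> takes it.\<close>
  define fx where "fx = (\<lambda>x y. blinfun_inner_right (\<Sum>j\<in>UNIV. (pd j g (x - y) * f y) *\<^sub>R (axis j 1 :: real^'n)))"
  have cont: "continuous_on S (\<lambda>p. pd j g (fst p - snd p) * f (snd p))" for S j
    by (intro continuous_intros continuous_on_compose2[OF smooth_on_continuous[OF smooth_on_pd[OF g], of UNIV]]
       continuous_on_compose2[OF f(1)]) auto
  have cont2: "continuous_on S (\<lambda>y. pd j g (x - y) * f y)" for S j x
    by (intro continuous_intros continuous_on_compose2[OF smooth_on_continuous[OF smooth_on_pd[OF g], of UNIV]]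
       continuous_on_compose2[OF f(1)]) auto
  have fxapp: "blinfun_apply (fx x y) (axis j 1) = pd j g (x - y) * f y" for x y j
  proof -
    have "(\<Sum>i\<in>UNIV. (pd i g (x - y) * f y) *\<^sub>R (axis i 1 :: real^'n)) \<bullet> axis j 1 =
       (\<Sum>i\<in>UNIV. if i = j then pd i g (x - y) * f y else 0)"
      unfolding inner_sum_left by (intro sum.cong refl) (auto simp: inner_axis_axis)
    then show ?thesis by (simp add: fx_def)
  qed
  have D: "((\<lambda>x. integral (cbox a b) (\<lambda>y. g (x - y) * f y)) has_derivative integral (cbox a b) (fx x)) (at x within UNIV)"
  proof (rule leibniz_rule)
    fix x y
    have "((\<lambda>x. g (x - y) * f y) has_derivative (\<lambda>h. (\<Sum>j\<in>UNIV. pd j g (x - y) * h $ j) * f y)) (at x)"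
      by (intro has_derivative_mult_left has_derivative_compose[OF _ has_derivative_pd[OF smooth_on_differentiable[OF g]]])
         (auto intro!: derivative_eq_intros)
    moreover have "(\<lambda>h. (\<Sum>j\<in>UNIV. pd j g (x - y) * h $ j) * f y) = blinfun_apply (fx x y)"
      by (auto simp: fx_def fun_eq_iff inner_sum_left sum_distrib_right inner_axis' intro!: sum.cong)
    ultimately show "((\<lambda>x. g (x - y) * f y) has_derivative blinfun_apply (fx x y)) (at x within UNIV)" by simp
    show "(\<lambda>y. g (x - y) * f y) integrable_on cbox a b"
      by (intro integrable_continuous continuous_intros continuous_on_compose2[OF f(1)]
         continuous_on_compose2[OF smooth_on_continuous[OF g, of UNIV]]) auto
    show "continuous_on (UNIV \<times> cbox a b) (\<lambda>(x, y). fx x y)"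
      unfolding fx_def case_prod_unfold
      by (intro bounded_linear.continuous_on[OF bounded_linear_blinfun_inner_right] continuous_intros cont)
  qed auto
  have eq: "mollify f g = (\<lambda>x. integral (cbox a b) (\<lambda>y. g (x - y) * f y))" using m[OF g] by auto
  show "mollify f g differentiable (at x)" using D unfolding eq differentiable_def by auto
  have "pd j (mollify f g) x = blinfun_apply (integral (cbox a b) (fx x)) (axis j 1)"
    using D unfolding eq by (simp add: pd_eq)
  also have "\<dots> = integral (cbox a b) (\<lambda>y. blinfun_apply (fx x y) (axis j 1))"
    unfolding fx_def
    by (intro blinfun_apply_integral integrable_continuous bounded_linear.continuous_on[OF bounded_linear_blinfun_inner_right] continuous_intros cont2)
  also have "\<dots> = mollify f (pd j g) x" by (simp add: fxapp m[OF smooth_on_pd[OF g]])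
  finally show "pd j (mollify f g) x = mollify f (pd j g) x" .
qed

lemma smooth_on_mollify:
  fixes f g :: "real^'n::finite \<Rightarrow> real"
  assumes f: "continuous_on UNIV f" "\<And>x. x \<notin> cbox a b \<Longrightarrow> f x = 0" and g: "smooth_on UNIV g"
  shows "smooth_on UNIV (mollify f g)"
proof (rule smooth_onI_invariant[where S = "mollify f ` {g. smooth_on UNIV g}"])
  have "pd j (mollify f g) = mollify f (pd j g)" if "smooth_on UNIV g" for j g
    using pd_mollify[OF f that] by auto
  then show "pd j g \<in> mollify f ` {g. smooth_on UNIV g}" if "g \<in> mollify f ` {g. smooth_on UNIV g}" for g j
    using that by (auto intro: smooth_on_pd)
qed (use g mollify_differentiable[OF f] in auto)

text \<open>Integration by parts: the j-th partial derivative of y -> g(x - y) f(y) has integral 0,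
  and the inner minus sign in x - y accounts for the sign.\<close>

lemma mollify_pd_commute:
  fixes f g :: "real^'n::finite \<Rightarrow> real"
  assumes f: "\<And>x. f differentiable (at x)" "continuous_on UNIV (pd j f)" "\<And>x. x \<notin> cbox a b \<Longrightarrow> f x = 0"
    and g: "smooth_on UNIV g"
  shows "mollify f (pd j g) x = mollify (pd j f) g x"
proof -
  define F where "F = (\<lambda>y. g (x - y) * f y)"
  have cf: "continuous_on UNIV f"
    using f(1) by (meson continuous_at_imp_continuous_on differentiable_imp_continuous_within)
  have dg: "((\<lambda>y. g (x - y)) has_derivative (\<lambda>h. \<Sum>i\<in>UNIV. pd i g (x - y) * (- h) $ i)) (at y)" for y
    by (rule has_derivative_compose[OF _ has_derivative_pd[OF smooth_on_differentiable[OF g]]])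
       (auto intro!: derivative_eq_intros)
  have "pd j (\<lambda>y. g (x - y)) y = - pd j g (x - y)" for y
    by (subst pd_eq[OF dg]) (simp add: axis_def if_distrib cong: if_cong)
  moreover have gd: "(\<lambda>y. g (x - y)) differentiable (at y)" for y using dg unfolding differentiable_def by blast
  ultimately have pF: "pd j F = (\<lambda>y. g (x - y) * pd j f y - pd j g (x - y) * f y)"
    unfolding F_def by (auto simp: pd_mult f)
  have c1: "continuous_on UNIV (\<lambda>y. g (x - y) * pd j f y)" and c2: "continuous_on UNIV (\<lambda>y. pd j g (x - y) * f y)"
    by (intro continuous_intros continuous_on_compose2[OF smooth_on_continuous[OF smooth_on_pd[OF g], of UNIV]]
      continuous_on_compose2[OF smooth_on_continuous[OF g, of UNIV]] cf f(2); simp)+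
  have "integral\<^sup>L lborel (pd j F) = 0"
  proof (rule integral_pd_eq_0)
    show "F differentiable (at y)" for y unfolding F_def using gd f(1) by simp
    show "continuous_on UNIV (pd j F)" unfolding pF by (rule continuous_on_diff[OF c1 c2])
    show "F x = 0" if "x \<notin> cbox a b" for x using f(3)[OF that] by (simp add: F_def)
  qed
  moreover have "integral\<^sup>L lborel (pd j F) = mollify (pd j f) g x - mollify f (pd j g) x"
    unfolding pF mollify_def
    by (intro Bochner_Integration.integral_diff integrable_compact_support[OF c1, of a b] integrable_compact_support[OF c2, of a b])
       (auto simp: f(3) pd_zero_outside_closed[OF closed_cbox f(3)])
  ultimately show ?thesis by simp
qed


section \<open>Bump kernels and uniform approximation\<close>

definition bump :: "real \<Rightarrow> real^'n::finite \<Rightarrow> real" where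
  "bump d x = flat 0 (d\<^sup>2 - x \<bullet> x)"

lemma smooth_on_bump: "smooth_on UNIV (bump d :: real^'n::finite \<Rightarrow> real)"
proof -
  have "smooth_on UNIV (\<lambda>x::real^'n. d\<^sup>2 + (\<Sum>i\<in>UNIV. (-1) * (x $ i * x $ i)))"
    by (intro smooth_on_add smooth_on_const smooth_on_sum smooth_on_mult smooth_on_coordinate)
  moreover have "(\<lambda>x::real^'n. d\<^sup>2 + (\<Sum>i\<in>UNIV. (-1) * (x $ i * x $ i))) = (\<lambda>x. d\<^sup>2 - x \<bullet> x)"
    by (simp add: inner_vec_def sum_negf)
  ultimately show ?thesis unfolding bump_def[abs_def] using smooth_on_flat by metis
qed

lemma bump_nonneg: "bump d x \<ge> 0"
  by (simp add: bump_def flat_0_bounds)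

lemma bump_eq_0_iff: "d > 0 \<Longrightarrow> bump d x = 0 \<longleftrightarrow> norm x \<ge> d"
proof -
  assume "d > 0"
  then have "d \<le> norm x \<longleftrightarrow> d\<^sup>2 \<le> (norm x)\<^sup>2" by (intro power_mono_iff[symmetric]) auto
  then show ?thesis by (auto simp: bump_def flat_def dot_square_norm not_less)
qed

lemma bump_support_box:
  fixes x :: "real^'n::finite"
  assumes "d > 0" "x \<notin> cbox (- (\<Sum>i\<in>Basis. d *\<^sub>R i)) (\<Sum>i\<in>Basis. d *\<^sub>R i)"
  shows "bump d x = 0"
proof -
  have "d \<le> norm x"
  proof (rule ccontr)
    assume "\<not> d \<le> norm x"
    then have "\<bar>x \<bullet> i\<bar> \<le> d" if "i \<in> Basis" for i using Basis_le_norm[OF that, of x] by linarith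
    then have "x \<in> cbox (- (\<Sum>i\<in>Basis. d *\<^sub>R i)) (\<Sum>i\<in>Basis. d *\<^sub>R i)"
      by (auto simp: mem_box inner_sum_left_Basis abs_le_iff) (smt (verit, best))
    with assms show False by simp
  qed
  then show ?thesis using assms by (simp add: bump_eq_0_iff)
qed

lemma integrable_bump: "d > 0 \<Longrightarrow> integrable lborel (bump d :: real^'n::finite \<Rightarrow> real)"
  by (rule integrable_compact_support[OF smooth_on_continuous[OF smooth_on_bump] bump_support_box])

lemma integral_bump_pos:
  assumes "d > 0" shows "integral\<^sup>L lborel (bump d :: real^'n::finite \<Rightarrow> real) > 0"
proof -
  have "integral\<^sup>L lborel (bump d :: real^'n \<Rightarrow> real) \<noteq> 0"
  proof
    assume "integral\<^sup>L lborel (bump d :: real^'n \<Rightarrow> real) = 0"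
    then have "AE x in lborel. bump d (x :: real^'n) = 0"
      using integrable_bump[OF assms] by (subst (asm) integral_nonneg_eq_0_iff_AE) (auto simp: bump_nonneg)
    then have "AE x in lborel. x \<notin> ball (0 :: real^'n) d"
      by eventually_elim (use assms in \<open>auto simp: bump_eq_0_iff\<close>)
    then have "ball (0 :: real^'n) d \<in> null_sets lborel" by (subst AE_iff_null_sets) auto
    then have "emeasure lborel (ball (0 :: real^'n) d) = 0" by auto
    then have "negligible (ball (0 :: real^'n) d)"
      by (simp add: negligible_iff_emeasure0)
    then show False using assms by (simp add: negligible_iff_measure)
  qed
  moreover have "integral\<^sup>L lborel (bump d :: real^'n \<Rightarrow> real) \<ge> 0"
    by (rule Bochner_Integration.integral_nonneg) (rule bump_nonneg)
  ultimately show ?thesis by simp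
qed

definition bump_kernel :: "real \<Rightarrow> real^'n::finite \<Rightarrow> real" where
  "bump_kernel d x = bump d x * (1 / integral\<^sup>L lborel (bump d :: real^'n \<Rightarrow> real))"

lemma smooth_on_bump_kernel: "smooth_on UNIV (bump_kernel d)"
  unfolding bump_kernel_def[abs_def] by (intro smooth_on_mult smooth_on_bump smooth_on_const)

lemma bump_kernel_nonneg: "d > 0 \<Longrightarrow> bump_kernel d x \<ge> 0"
  by (simp add: bump_kernel_def bump_nonneg integral_bump_pos less_imp_le)

lemma bump_kernel_eq_0: "d > 0 \<Longrightarrow> norm x \<ge> d \<Longrightarrow> bump_kernel d x = 0"
  by (simp add: bump_kernel_def bump_eq_0_iff)

lemma
  fixes x :: "real^'n::finite"
  assumes "d > 0"
  shows integrable_bump_kernel: "integrable lborel (\<lambda>y. bump_kernel d (x - y))"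
    and integral_bump_kernel: "(LINT y|lborel. bump_kernel d (x - y)) = 1"
proof -
  \<comment> \<open>The reflection symmetry of the bump replaces y -> x - y by a translation, under
    which the measure is invariant.\<close>
  have even: "bump_kernel d (x - y) = bump_kernel d (- x + y)" for y
    by (simp add: bump_kernel_def bump_def inner_commute algebra_simps)
  have meas: "bump_kernel d \<in> borel_measurable (borel :: (real^'n) measure)"
    by (intro borel_measurable_continuous_onI smooth_on_continuous smooth_on_bump_kernel)
  have I: "integrable lborel (bump_kernel d :: real^'n \<Rightarrow> real)"
    unfolding bump_kernel_def[abs_def] by (intro integrable_mult_left integrable_bump assms)
  have "integrable (distr lborel borel ((+) (- x))) (bump_kernel d)"
    using I by (simp add: lborel_distr_plus)
  then show "integrable lborel (\<lambda>y. bump_kernel d (x - y))"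
    unfolding even using meas by (subst (asm) integrable_distr_eq) auto
  show "(LINT y|lborel. bump_kernel d (x - y)) = 1"
    unfolding even lborel_integral_translate[OF meas]
    using integral_bump_pos[OF assms, where 'n='n] by (simp add: bump_kernel_def[abs_def])
qed

text \<open>The kernel is non-negative with mass 1, so the difference is a weighted average of f(y)
  - f(x) over the ball of radius \<open>d\<close> around \<open>x\<close>.\<close>

lemma mollify_bump_close:
  fixes f :: "real^'n::finite \<Rightarrow> real"
  assumes d: "d > 0" and f: "continuous_on UNIV f" "\<And>x. x \<notin> cbox a b \<Longrightarrow> f x = 0"
    and close: "\<And>y. norm (x - y) < d \<Longrightarrow> \<bar>f y - f x\<bar> \<le> e"
  shows "\<bar>mollify f (bump_kernel d) x - f x\<bar> \<le> e"
proof -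
  note ib = integrable_bump_kernel[OF d, of x]
  have i1: "integrable lborel (\<lambda>y. bump_kernel d (x - y) * f y)"
    by (rule integrable_compact_support[of _ a b])
       (auto simp: f(2) intro!: continuous_intros f(1) continuous_on_compose2[OF smooth_on_continuous[OF smooth_on_bump_kernel, of UNIV]])
  have "mollify f (bump_kernel d) x - f x = (LINT y|lborel. bump_kernel d (x - y) * f y) - (LINT y|lborel. bump_kernel d (x - y) * f x)"
    using ib by (simp add: mollify_def integral_bump_kernel[OF d])
  also have "\<dots> = (LINT y|lborel. bump_kernel d (x - y) * f y - bump_kernel d (x - y) * f x)"
    using i1 ib by (intro Bochner_Integration.integral_diff[symmetric]) auto
  also have "\<bar>\<dots>\<bar> \<le> (LINT y|lborel. \<bar>bump_kernel d (x - y) * f y - bump_kernel d (x - y) * f x\<bar>)"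
    by (rule integral_abs_bound)
  also have "\<dots> \<le> (LINT y|lborel. bump_kernel d (x - y) * e)"
  proof (rule integral_mono)
    show "integrable lborel (\<lambda>y. \<bar>bump_kernel d (x - y) * f y - bump_kernel d (x - y) * f x\<bar>)"
      using i1 ib by (intro integrable_abs Bochner_Integration.integrable_diff) auto
    show "integrable lborel (\<lambda>y. bump_kernel d (x - y) * e)" using ib by simp
    fix y
    show "\<bar>bump_kernel d (x - y) * f y - bump_kernel d (x - y) * f x\<bar> \<le> bump_kernel d (x - y) * e"
    proof (cases "norm (x - y) < d")
      case True
      have "\<bar>bump_kernel d (x - y) * f y - bump_kernel d (x - y) * f x\<bar> = bump_kernel d (x - y) * \<bar>f y - f x\<bar>"
        using bump_kernel_nonneg[OF d, of "x - y"] by (simp add: abs_mult flip: right_diff_distrib)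
      then show ?thesis using close[OF True] bump_kernel_nonneg[OF d, of "x - y"] by (simp add: mult_left_mono)
    qed (simp add: bump_kernel_eq_0[OF d])
  qed
  also have "\<dots> = e" using ib by (simp add: integral_bump_kernel[OF d])
  finally show ?thesis .
qed

lemma mollify_bump_support:
  assumes "d > 0" "\<And>y. norm (x - y) < d \<Longrightarrow> f y = 0"
  shows "mollify f (bump_kernel d) x = 0"
proof -
  have "bump_kernel d (x - y) * f y = 0" for y
    using assms bump_kernel_eq_0[OF assms(1), of "x - y"] by (cases "norm (x - y) < d") auto
  then have "(\<lambda>y. bump_kernel d (x - y) * f y) = (\<lambda>_. 0)" by auto
  then show ?thesis by (simp add: mollify_def)
qed

lemma uniform_modulus_compact_support:
  fixes f :: "'a::euclidean_space \<Rightarrow> real"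
  assumes "continuous_on UNIV f" "compact K" "\<And>x. x \<notin> K \<Longrightarrow> f x = 0" "e > 0"
  obtains d where "d > 0" "\<And>x y. norm (x - y) < d \<Longrightarrow> \<bar>f y - f x\<bar> < e"
proof -
  \<comment> \<open>The closed unit neighbourhood of \<open>K\<close>: if \<open>x\<close> and
    \<open>y\<close> are within distance 1, either both lie in it or \<open>f\<close> vanishes at
    both.\<close>
  define K1 where "K1 = {x + y |x y. x \<in> K \<and> y \<in> cball 0 1}"
  have K1: "compact K1" unfolding K1_def using assms(2) by (intro compact_sums) auto
  have in1: "y \<in> K1" if "x \<in> K" "norm (x - y) \<le> 1" for x y
    unfolding K1_def using that
    by (intro CollectI exI[of _ x] exI[of _ "y - x"]) (auto simp: norm_minus_commute)
  have "uniformly_continuous_on K1 f"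
    using K1 assms(1) by (intro compact_uniformly_continuous) (auto intro: continuous_on_subset)
  then obtain d where d: "d > 0" "\<And>x y. x \<in> K1 \<Longrightarrow> y \<in> K1 \<Longrightarrow> dist y x < d \<Longrightarrow> dist (f y) (f x) < e"
    unfolding uniformly_continuous_on_def using assms(4) by metis
  show ?thesis
  proof (rule that[of "min d 1"])
    fix x y :: 'a assume xy: "norm (x - y) < min d 1"
    then have dd: "dist y x < d" by (simp add: dist_norm norm_minus_commute)
    show "\<bar>f y - f x\<bar> < e"
    proof (cases "x \<in> K \<or> y \<in> K")
      case True
      then have "x \<in> K1 \<and> y \<in> K1"
        using xy in1[of x y] in1[of x x] in1[of y x] in1[of y y] by (auto simp: norm_minus_commute)
      then show ?thesis using d(2)[OF _ _ dd] by (auto simp: dist_real_def)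
    qed (use assms in auto)
  qed (use d in auto)
qed

text \<open>\<open>C\<^sup>1\<close> functions with compact support can replace smooth ones in the definition of a weak
  derivative: they are limits of test functions with supports in a fixed compact set.\<close>

lemma test_fun_approx_C1:
  fixes f :: "real^'n::finite \<Rightarrow> real"
  assumes f: "\<And>x. f differentiable (at x)" "continuous_on UNIV (pd j f)"
    and K: "compact K" "K \<subseteq> \<Omega>" "open \<Omega>" "\<And>x. x \<notin> K \<Longrightarrow> f x = 0"
  obtains K' where "compact K'" "K' \<subseteq> \<Omega>" "K \<subseteq> K'"
    "\<And>e. e > 0 \<Longrightarrow> \<exists>\<psi>\<in>test_fun \<Omega>. (\<forall>x. x \<notin> K' \<longrightarrow> \<psi> x = 0) \<and>
       (\<forall>x. \<bar>\<psi> x - f x\<bar> \<le> e) \<and> (\<forall>x. \<bar>pd j \<psi> x - pd j f x\<bar> \<le> e)"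
proof -
  obtain r where r: "r > 0" "(\<Union>x\<in>K. cball x r) \<subseteq> \<Omega>"
    using compact_subset_open_imp_cball_epsilon_subset[OF K(1,3,2)] by metis
  \<comment> \<open>A compact neighbourhood of \<open>K\<close> inside \<Omega>, fixed before
    \<open>e\<close> is given: it holds the support of every mollification of radius at most
    \<open>r\<close>.\<close>
  define K' where "K' = {x + y |x y. x \<in> K \<and> y \<in> cball 0 r}"
  have K'c: "compact K'" unfolding K'_def using K by (intro compact_sums) auto
  have inK': "y \<in> K'" if "x \<in> K" "norm (x - y) \<le> r" for x y
    unfolding K'_def using that
    by (intro CollectI exI[of _ x] exI[of _ "y - x"]) (auto simp: norm_minus_commute)
  have K'\<Omega>: "K' \<subseteq> \<Omega>"
  proof
    fix z assume "z \<in> K'"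
    then obtain x y where "z = x + y" "x \<in> K" "norm y \<le> r" by (auto simp: K'_def)
    then have "z \<in> cball x r" by (simp add: dist_norm)
    then show "z \<in> \<Omega>" by (intro subsetD[OF r(2)] UN_I[OF \<open>x \<in> K\<close>])
  qed
  obtain a b where ab: "K \<subseteq> cbox a b"
    using compact_imp_bounded[OF K(1)] bounded_subset_cbox_symmetric by metis
  have out: "f x = 0" "pd j f x = 0" if "x \<notin> K" for x
    using K(4)[OF that] pd_zero_outside_closed[OF compact_imp_closed[OF K(1)] K(4) that] by auto
  have outb: "f x = 0" "pd j f x = 0" if "x \<notin> cbox a b" for x using out[of x] that ab by auto
  have cf: "continuous_on UNIV f"
    using f(1) by (meson continuous_at_imp_continuous_on differentiable_imp_continuous_within)
  show ?thesis
  proof (rule that[OF K'c K'\<Omega>])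
    show "K \<subseteq> K'" using inK'[of x x for x] r by auto
    fix e :: real assume e: "e > 0"
    obtain d1 where d1: "d1 > 0" "\<And>x y. norm (x - y) < d1 \<Longrightarrow> \<bar>f y - f x\<bar> < e"
      using uniform_modulus_compact_support[OF cf K(1) out(1) e] by metis
    obtain d2 where d2: "d2 > 0" "\<And>x y. norm (x - y) < d2 \<Longrightarrow> \<bar>pd j f y - pd j f x\<bar> < e"
      using uniform_modulus_compact_support[OF f(2) K(1) out(2) e] by metis
    define d where "d = min (min d1 d2) r"
    have d: "d > 0" "d \<le> d1" "d \<le> d2" "d \<le> r" using d1 d2 r by (auto simp: d_def)
    define \<psi> where "\<psi> = mollify f (bump_kernel d)"
    have sm: "smooth_on UNIV \<psi>" unfolding \<psi>_def by (rule smooth_on_mollify[OF cf outb(1) smooth_on_bump_kernel])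
    have supp: "\<psi> x = 0" if "x \<notin> K'" for x
      unfolding \<psi>_def
    proof (rule mollify_bump_support[OF d(1)])
      fix y assume "norm (x - y) < d"
      then have "y \<notin> K" using inK'[of y x] that d by (auto simp: norm_minus_commute)
      then show "f y = 0" by (rule out)
    qed
    have "closure {x. \<psi> x \<noteq> 0} \<subseteq> K'"
      using supp by (intro closure_minimal compact_imp_closed[OF K'c]) auto
    moreover have "compact (closure {x. \<psi> x \<noteq> 0})"
      using supp by (simp add: compact_closure, intro bounded_subset[OF compact_imp_bounded[OF K'c]]) auto
    ultimately have "\<psi> \<in> test_fun \<Omega>"
      using sm K'\<Omega> unfolding test_fun_def by auto
    moreover have "\<bar>\<psi> x - f x\<bar> \<le> e" for x
      unfolding \<psi>_def by (rule mollify_bump_close[OF d(1) cf outb(1)]) (use d1 d in \<open>auto intro: less_imp_le\<close>)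
    moreover have "\<bar>pd j \<psi> x - pd j f x\<bar> \<le> e" for x
    proof -
      \<comment> \<open>The derivative is moved from the kernel onto \<open>f\<close>, so that the
        uniform modulus of \<open>pd j f\<close> applies.\<close>
      have "pd j \<psi> x = mollify f (pd j (bump_kernel d)) x"
        unfolding \<psi>_def by (rule pd_mollify[OF cf outb(1) smooth_on_bump_kernel])
      also have "\<dots> = mollify (pd j f) (bump_kernel d) x"
        by (rule mollify_pd_commute[OF f outb(1) smooth_on_bump_kernel])
      finally show ?thesis
        using mollify_bump_close[OF d(1) f(2) outb(2), where x = x and e = e] d2 d by (simp add: less_imp_le)
    qed
    ultimately show "\<exists>\<psi>\<in>test_fun \<Omega>. (\<forall>x. x \<notin> K' \<longrightarrow> \<psi> x = 0) \<and>
       (\<forall>x. \<bar>\<psi> x - f x\<bar> \<le> e) \<and> (\<forall>x. \<bar>pd j \<psi> x - pd j f x\<bar> \<le> e)" using supp by blast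
  qed
qed

section \<open>Weak derivatives and multiplication by functions of class \<open>C\<^sup>1\<close>\<close>


lemma test_fun_smooth: "\<psi> \<in> test_fun \<Omega> \<Longrightarrow> smooth_on UNIV \<psi>"
  by (simp add: test_fun_def)

lemma test_funI:
  assumes "smooth_on UNIV \<psi>" "compact K" "K \<subseteq> \<Omega>" "\<And>x. x \<notin> K \<Longrightarrow> \<psi> x = 0"
  shows "\<psi> \<in> test_fun \<Omega>"
proof -
  have "closure {x. \<psi> x \<noteq> 0} \<subseteq> K"
    using assms by (intro closure_minimal compact_imp_closed) auto
  moreover have "compact (closure {x. \<psi> x \<noteq> 0})"
    using assms by (simp add: compact_closure, intro bounded_subset[OF compact_imp_bounded[OF assms(2)]]) auto
  ultimately show ?thesis using assms by (auto simp: test_fun_def)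
qed

lemma test_funE:
  assumes "\<psi> \<in> test_fun \<Omega>"
  obtains K where "compact K" "K \<subseteq> \<Omega>" "\<And>x. x \<notin> K \<Longrightarrow> \<psi> x = 0"
  using assms that[of "closure {x. \<psi> x \<noteq> 0}"] closure_subset[of "{x. \<psi> x \<noteq> 0}"]
  unfolding test_fun_def by blast

lemma test_fun_pd: "\<psi> \<in> test_fun \<Omega> \<Longrightarrow> pd j \<psi> \<in> test_fun \<Omega>"
proof -
  assume \<psi>: "\<psi> \<in> test_fun \<Omega>"
  obtain K where K: "compact K" "K \<subseteq> \<Omega>" "\<And>x. x \<notin> K \<Longrightarrow> \<psi> x = 0" using test_funE[OF \<psi>] by metis
  show ?thesis
    by (rule test_funI[OF smooth_on_pd[OF test_fun_smooth[OF \<psi>]] K(1,2)])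
       (rule pd_zero_outside_closed[OF compact_imp_closed[OF K(1)] K(3)])
qed

lemma test_fun_smooth_pos: "\<psi> \<in> test_fun \<Omega> \<Longrightarrow> (\<lambda>x. smooth_pos (- \<psi> x)) \<in> test_fun \<Omega>"
proof -
  assume \<psi>: "\<psi> \<in> test_fun \<Omega>"
  have "smooth_on UNIV (\<lambda>x. (-1) * \<psi> x)"
    by (intro smooth_on_mult smooth_on_const test_fun_smooth[OF \<psi>])
  then have "smooth_on UNIV (\<lambda>x. - \<psi> x)" by simp
  then have sm: "smooth_on UNIV (\<lambda>x. smooth_pos (- \<psi> x))" by (rule smooth_on_smooth_pos)
  obtain K where K: "compact K" "K \<subseteq> \<Omega>" "\<And>x. x \<notin> K \<Longrightarrow> \<psi> x = 0" using test_funE[OF \<psi>] by metis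
  show ?thesis by (rule test_funI[OF sm K(1,2)]) (simp add: K(3) smooth_pos_def)
qed

lemma test_fun_scale: "\<psi> \<in> test_fun \<Omega> \<Longrightarrow> (\<lambda>x. c * \<psi> x) \<in> test_fun \<Omega>"
proof -
  assume \<psi>: "\<psi> \<in> test_fun \<Omega>"
  obtain K where K: "compact K" "K \<subseteq> \<Omega>" "\<And>x. x \<notin> K \<Longrightarrow> \<psi> x = 0" using test_funE[OF \<psi>] by metis
  show ?thesis
    by (rule test_funI[OF smooth_on_mult[OF smooth_on_const test_fun_smooth[OF \<psi>]] K(1,2)]) (simp add: K(3))
qed

lemma test_fun_add:
  assumes "f \<in> test_fun \<Omega>" "g \<in> test_fun \<Omega>" shows "(\<lambda>x. f x + g x) \<in> test_fun \<Omega>"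
proof -
  obtain K where K: "compact K" "K \<subseteq> \<Omega>" "\<And>x. x \<notin> K \<Longrightarrow> f x = 0" using test_funE[OF assms(1)] by metis
  obtain L where L: "compact L" "L \<subseteq> \<Omega>" "\<And>x. x \<notin> L \<Longrightarrow> g x = 0" using test_funE[OF assms(2)] by metis
  show ?thesis
    by (rule test_funI[OF smooth_on_add compact_Un[OF K(1) L(1)]])
       (use assms K L in \<open>auto simp: test_fun_smooth\<close>)
qed

lemma test_fun_zero: "(\<lambda>_. 0) \<in> test_fun \<Omega>"
  by (rule test_funI[OF smooth_on_const compact_empty]) auto

lemma test_fun_sum: "(\<And>i. i \<in> I \<Longrightarrow> f i \<in> test_fun \<Omega>) \<Longrightarrow> (\<lambda>x. \<Sum>i\<in>I. f i x) \<in> test_fun \<Omega>"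
  by (induction I rule: infinite_finite_induct) (auto simp: test_fun_zero test_fun_add)

lemma pd_scale: "f differentiable (at x) \<Longrightarrow> pd j (\<lambda>x. c * f x) x = c * pd j f x"
  using pd_mult[of "\<lambda>_. c" x f j] by (simp add: pd_const)

lemma pd_sum:
  "(\<And>i. i \<in> I \<Longrightarrow> f i differentiable (at x)) \<Longrightarrow> pd j (\<lambda>x. \<Sum>i\<in>I. f i x) x = (\<Sum>i\<in>I. pd j (f i) x)"
  by (induction I rule: infinite_finite_induct) (auto simp: pd_const pd_add)

lemma test_fun_bounded:
  assumes "\<psi> \<in> test_fun \<Omega>" obtains C where "\<And>x. \<bar>\<psi> x\<bar> \<le> C"
proof -
  obtain K where K: "compact K" "K \<subseteq> \<Omega>" "\<And>x. x \<notin> K \<Longrightarrow> \<psi> x = 0" using test_funE[OF assms] by metis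
  have "bounded (\<psi> ` K)"
    using smooth_on_continuous[OF test_fun_smooth[OF assms]] K by (intro compact_imp_bounded compact_continuous_image)
  then obtain C where C: "\<And>x. x \<in> K \<Longrightarrow> \<bar>\<psi> x\<bar> \<le> C" by (auto simp: bounded_iff)
  have "\<bar>\<psi> x\<bar> \<le> max C 0" for x using C[of x] K(3)[of x] by (cases "x \<in> K") auto
  then show ?thesis by (rule that)
qed

lemma test_fun_measurable:
  "\<psi> \<in> test_fun \<Omega> \<Longrightarrow> S \<in> sets lebesgue \<Longrightarrow> \<psi> \<in> borel_measurable (lebesgue_on S)"
  by (intro continuous_imp_measurable_on_sets_lebesgue smooth_on_continuous test_fun_smooth)

lemma test_fun_L2:
  assumes "\<psi> \<in> test_fun \<Omega>" "\<Omega> \<in> lmeasurable" shows "\<psi> \<in> L2 \<Omega>"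
proof -
  obtain C where "\<And>x. \<bar>\<psi> x\<bar> \<le> C" using test_fun_bounded[OF assms(1)] by metis
  then show ?thesis using assms by (intro L2_bounded[of _ _ C] test_fun_measurable) auto
qed

text \<open>The bound sees \<open>h\<close> only through its supremum \<open>C\<close>. So, with
  supports in one compact \<open>K\<close>, uniform convergence of test functions is enough to pass
  to the limit.\<close>

lemma
  assumes f: "loc_integrable \<Omega> f" and \<Omega>: "\<Omega> \<in> sets lebesgue" and K: "compact K" "K \<subseteq> \<Omega>"
    and h: "h \<in> borel_measurable (lebesgue_on \<Omega>)" "\<And>x. x \<in> \<Omega> \<Longrightarrow> \<bar>h x\<bar> \<le> C" "\<And>x. x \<notin> K \<Longrightarrow> h x = 0"
  shows loc_integrable_mult: "integrable (lebesgue_on \<Omega>) (\<lambda>x. f x * h x)"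
    and loc_integrable_mult_bound:
      "\<bar>LINT x|lebesgue_on \<Omega>. f x * h x\<bar> \<le> C * (LINT x|lebesgue_on \<Omega>. \<bar>indicator K x * f x\<bar>)"
proof -
  have "integrable lebesgue (\<lambda>x. indicator K x *\<^sub>R f x)"
    using f K by (auto simp: loc_integrable_def set_integrable_def)
  moreover have "(\<lambda>x. indicator K x *\<^sub>R f x) = (\<lambda>x. indicator \<Omega> x *\<^sub>R (indicator K x * f x))"
    using K by (auto simp: indicator_def fun_eq_iff)
  ultimately have "integrable lebesgue (\<lambda>x. indicator \<Omega> x *\<^sub>R (indicator K x * f x))" by (simp only:)
  then have i: "integrable (lebesgue_on \<Omega>) (\<lambda>x. indicator K x * f x)"
    using \<Omega> by (subst integrable_restrict_space) auto
  have eq: "f x * h x = (indicator K x * f x) * h x" for x using h(3)[of x] by (cases "x \<in> K") auto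
  have le: "\<bar>(indicator K x * f x) * h x\<bar> \<le> C * \<bar>indicator K x * f x\<bar>" if "x \<in> \<Omega>" for x
    using h(2)[OF that] by (simp add: abs_mult mult.commute[of _ "\<bar>h x\<bar>"] mult_right_mono)
  have i2: "integrable (lebesgue_on \<Omega>) (\<lambda>x. C * \<bar>indicator K x * f x\<bar>)" using i by simp
  show i3: "integrable (lebesgue_on \<Omega>) (\<lambda>x. f x * h x)"
    unfolding eq
  proof (rule Bochner_Integration.integrable_bound[OF i2])
    show "(\<lambda>x. indicator K x * f x * h x) \<in> borel_measurable (lebesgue_on \<Omega>)"
      using borel_measurable_times[OF borel_measurable_integrable[OF i] h(1)] .
    show "AE x in lebesgue_on \<Omega>. norm (indicator K x * f x * h x) \<le> norm (C * \<bar>indicator K x * f x\<bar>)"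
      using order_trans[OF le abs_ge_self] by (intro AE_I2) (auto simp: space_restrict_space)
  qed
  have "\<bar>LINT x|lebesgue_on \<Omega>. f x * h x\<bar> \<le> (LINT x|lebesgue_on \<Omega>. \<bar>f x * h x\<bar>)"
    by (rule integral_abs_bound)
  also have "\<dots> \<le> (LINT x|lebesgue_on \<Omega>. C * \<bar>indicator K x * f x\<bar>)"
    using i2 i3 le by (intro integral_mono) (auto simp: space_restrict_space eq[symmetric])
  also have "\<dots> = C * (LINT x|lebesgue_on \<Omega>. \<bar>indicator K x * f x\<bar>)" by simp
  finally show "\<bar>LINT x|lebesgue_on \<Omega>. f x * h x\<bar> \<le> C * (LINT x|lebesgue_on \<Omega>. \<bar>indicator K x * f x\<bar>)" .
qed

text \<open>The defect \<open>X\<close> of the identity is at most \<open>e * (I f + I g)\<close>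
  for each \<open>e > 0\<close>, where \<open>I\<close> integrates over one compact set that holds
  all approximating supports.\<close>

lemma weak_pd_test_C1:
  fixes h :: "real^'n::finite \<Rightarrow> real"
  assumes w: "has_weak_pd \<Omega> j f g" and \<Omega>: "open \<Omega>"
    and h: "\<And>x. h differentiable (at x)" "continuous_on UNIV (pd j h)"
    and K: "compact K" "K \<subseteq> \<Omega>" "\<And>x. x \<notin> K \<Longrightarrow> h x = 0"
  shows "(LINT x|lebesgue_on \<Omega>. f x * pd j h x) = - (LINT x|lebesgue_on \<Omega>. g x * h x)"
proof -
  have \<Omega>s: "\<Omega> \<in> sets lebesgue" using \<Omega> by auto
  have f: "loc_integrable \<Omega> f" and g: "loc_integrable \<Omega> g" using w by (auto simp: has_weak_pd_def)
  have ch: "continuous_on UNIV h"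
    using h(1) by (meson continuous_at_imp_continuous_on differentiable_imp_continuous_within)
  obtain K' where K': "compact K'" "K' \<subseteq> \<Omega>" "K \<subseteq> K'"
    "\<And>e. e > 0 \<Longrightarrow> \<exists>\<psi>\<in>test_fun \<Omega>. (\<forall>x. x \<notin> K' \<longrightarrow> \<psi> x = 0) \<and>
       (\<forall>x. \<bar>\<psi> x - h x\<bar> \<le> e) \<and> (\<forall>x. \<bar>pd j \<psi> x - pd j h x\<bar> \<le> e)"
    using test_fun_approx_C1[OF h K(1,2) \<Omega> K(3)] by metis
  have pdh: "pd j h x = 0" if "x \<notin> K" for x
    by (rule pd_zero_outside_closed[OF compact_imp_closed[OF K(1)] K(3) that])
  define I where "I = (\<lambda>f :: real^'n \<Rightarrow> real. LINT x|lebesgue_on \<Omega>. \<bar>indicator K' x * f x\<bar>)"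
  define X where "X = (LINT x|lebesgue_on \<Omega>. f x * pd j h x) + (LINT x|lebesgue_on \<Omega>. g x * h x)"
  have bd: "\<exists>C. \<forall>x. \<bar>k x\<bar> \<le> C" if "continuous_on UNIV k" "\<And>x. x \<notin> K \<Longrightarrow> k x = 0" for k :: "real^'n \<Rightarrow> real"
  proof -
    have "bounded (k ` K)"
      using that K by (intro compact_imp_bounded compact_continuous_image) (auto intro: continuous_on_subset)
    then obtain C where C: "\<And>x. x \<in> K \<Longrightarrow> \<bar>k x\<bar> \<le> C" by (auto simp: bounded_iff)
    have "\<bar>k x\<bar> \<le> max C 0" for x using C[of x] that(2)[of x] by (cases "x \<in> K") auto
    then show ?thesis by blast
  qed
  obtain C1 C2 where C: "\<And>x. \<bar>h x\<bar> \<le> C1" "\<And>x. \<bar>pd j h x\<bar> \<le> C2"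
    using bd[OF ch K(3)] bd[OF h(2) pdh] by metis
  have meas: "k \<in> borel_measurable (lebesgue_on \<Omega>)" if "continuous_on UNIV k" for k :: "real^'n \<Rightarrow> real"
    using that \<Omega>s by (intro continuous_imp_measurable_on_sets_lebesgue) (auto intro: continuous_on_subset)
  have ih: "integrable (lebesgue_on \<Omega>) (\<lambda>x. f x * pd j h x)" "integrable (lebesgue_on \<Omega>) (\<lambda>x. g x * h x)"
    using K K' C ch h(2) pdh
    by (auto intro!: loc_integrable_mult[OF f \<Omega>s K(1,2)] loc_integrable_mult[OF g \<Omega>s K(1,2)] meas)
  have "\<bar>X\<bar> \<le> e * (I f + I g)" if e: "e > 0" for e
  proof -
    obtain \<psi> where \<psi>: "\<psi> \<in> test_fun \<Omega>" "\<And>x. x \<notin> K' \<Longrightarrow> \<psi> x = 0" "\<And>x. \<bar>\<psi> x - h x\<bar> \<le> e" "\<And>x. \<bar>pd j \<psi> x - pd j h x\<bar> \<le> e"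
      using K'(4)[OF e] by blast
    have pd\<psi>: "pd j \<psi> x = 0" if "x \<notin> K'" for x
      by (rule pd_zero_outside_closed[OF compact_imp_closed[OF K'(1)] \<psi>(2) that])
    have c\<psi>: "continuous_on UNIV \<psi>" "continuous_on UNIV (pd j \<psi>)"
      using \<psi>(1) by (auto intro!: smooth_on_continuous test_fun_smooth test_fun_pd)
    have out: "\<psi> x = 0" "h x = 0" "pd j \<psi> x = 0" "pd j h x = 0" if "x \<notin> K'" for x
      using that K'(3) K(3)[of x] pdh[of x] \<psi>(2)[of x] pd\<psi>[of x] by auto
    note L = \<Omega>s K'(1,2)
    have i1: "integrable (lebesgue_on \<Omega>) (\<lambda>x. f x * (pd j \<psi> x - pd j h x))"
      by (intro loc_integrable_mult[OF f L meas, of _ e] continuous_intros c\<psi> h(2)) (auto simp: \<psi> out)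
    have i2: "integrable (lebesgue_on \<Omega>) (\<lambda>x. g x * (\<psi> x - h x))"
      by (intro loc_integrable_mult[OF g L meas, of _ e] continuous_intros c\<psi> ch) (auto simp: \<psi> out)
    have "(LINT x|lebesgue_on \<Omega>. f x * pd j \<psi> x) = (LINT x|lebesgue_on \<Omega>. f x * (pd j \<psi> x - pd j h x) + f x * pd j h x)"
      by (simp add: algebra_simps)
    also have "\<dots> = (LINT x|lebesgue_on \<Omega>. f x * (pd j \<psi> x - pd j h x)) + (LINT x|lebesgue_on \<Omega>. f x * pd j h x)"
      by (rule Bochner_Integration.integral_add[OF i1 ih(1)])
    finally have e1: "(LINT x|lebesgue_on \<Omega>. f x * pd j \<psi> x) = \<dots>" .
    have "(LINT x|lebesgue_on \<Omega>. g x * \<psi> x) = (LINT x|lebesgue_on \<Omega>. g x * (\<psi> x - h x) + g x * h x)"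
      by (simp add: algebra_simps)
    also have "\<dots> = (LINT x|lebesgue_on \<Omega>. g x * (\<psi> x - h x)) + (LINT x|lebesgue_on \<Omega>. g x * h x)"
      by (rule Bochner_Integration.integral_add[OF i2 ih(2)])
    finally have e2: "(LINT x|lebesgue_on \<Omega>. g x * \<psi> x) = \<dots>" .
    have "(LINT x|lebesgue_on \<Omega>. f x * pd j \<psi> x) = - (LINT x|lebesgue_on \<Omega>. g x * \<psi> x)"
      using w \<psi>(1) by (auto simp: has_weak_pd_def)
    then have "X = - (LINT x|lebesgue_on \<Omega>. f x * (pd j \<psi> x - pd j h x)) - (LINT x|lebesgue_on \<Omega>. g x * (\<psi> x - h x))"
      unfolding X_def e1 e2 by simp
    moreover have "\<bar>LINT x|lebesgue_on \<Omega>. f x * (pd j \<psi> x - pd j h x)\<bar> \<le> e * I f"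
      unfolding I_def
      by (intro loc_integrable_mult_bound[OF f L meas] continuous_intros c\<psi> h(2)) (auto simp: \<psi> out)
    moreover have "\<bar>LINT x|lebesgue_on \<Omega>. g x * (\<psi> x - h x)\<bar> \<le> e * I g"
      unfolding I_def
      by (intro loc_integrable_mult_bound[OF g L meas] continuous_intros c\<psi> ch) (auto simp: \<psi> out)
    ultimately show ?thesis by (simp add: distrib_left)
  qed
  note bound = this
  have "X = 0"
  proof (rule ccontr)
    assume X: "X \<noteq> 0"
    have "I f + I g \<ge> 0" unfolding I_def by (intro add_nonneg_nonneg Bochner_Integration.integral_nonneg) auto
    \<comment> \<open>With e = \<bar>X\<bar> / (2 (I f + I g + 1)) the bound is a proper fraction of
      \<bar>X\<bar>; the summand 1 avoids a division by zero.\<close>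
    then have "(I f + I g) / (2 * (I f + I g + 1)) < 1" by (simp add: divide_simps)
    then have "\<bar>X\<bar> * ((I f + I g) / (2 * (I f + I g + 1))) < \<bar>X\<bar> * 1"
      using X by (intro mult_strict_left_mono) auto
    then have "\<bar>X\<bar> / (2 * (I f + I g + 1)) * (I f + I g) < \<bar>X\<bar>" by simp
    moreover have "\<bar>X\<bar> \<le> \<bar>X\<bar> / (2 * (I f + I g + 1)) * (I f + I g)"
      using X \<open>I f + I g \<ge> 0\<close> by (intro bound) simp
    ultimately show False by simp
  qed
  then show ?thesis by (simp add: X_def)
qed

lemma continuous_on_closure_measurable_bounded:
  assumes "continuous_on (closure \<Omega>) f" "bounded \<Omega>" "open \<Omega>"
  shows "f \<in> borel_measurable (lebesgue_on \<Omega>)" "\<exists>C. \<forall>x\<in>\<Omega>. \<bar>f x\<bar> \<le> (C::real)"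
proof -
  have "continuous_on \<Omega> f" using assms(1) closure_subset by (rule continuous_on_subset)
  then show "f \<in> borel_measurable (lebesgue_on \<Omega>)"
    using assms(3) by (intro continuous_imp_measurable_on_sets_lebesgue) auto
  have "bounded (f ` closure \<Omega>)"
    using assms by (intro compact_imp_bounded compact_continuous_image) (auto simp: compact_closure)
  then show "\<exists>C. \<forall>x\<in>\<Omega>. \<bar>f x\<bar> \<le> C" using closure_subset[of \<Omega>] by (auto simp: bounded_iff)
qed

lemma loc_integrable_continuous_mult:
  fixes k :: "real^'n::finite \<Rightarrow> real"
  assumes "continuous_on \<Omega> k" "loc_integrable \<Omega> f" shows "loc_integrable \<Omega> (\<lambda>x. k x * f x)"
  unfolding loc_integrable_def
proof (intro allI impI, elim conjE)
  fix K assume K: "compact K" "K \<subseteq> \<Omega>"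
  have c: "continuous_on K k" using assms(1) K(2) by (rule continuous_on_subset)
  have Ks: "K \<in> sets lebesgue" using K(1) by (simp add: compact_imp_closed borel_closed)
  show "(\<lambda>x. k x * f x) absolutely_integrable_on K"
  proof (rule absolutely_integrable_bounded_measurable_product[OF bilinear_times _ Ks])
    show "k \<in> borel_measurable (lebesgue_on K)"
      using c Ks by (rule continuous_imp_measurable_on_sets_lebesgue)
    show "bounded (k ` K)" using c K(1) by (intro compact_imp_bounded compact_continuous_image)
    show "f absolutely_integrable_on K" using assms(2) K by (auto simp: loc_integrable_def)
  qed
qed

text \<open>The product rule. Moving \<open>B\<close> onto a test function gives a factor that is
  only C^1, so \<open>weak_pd_test_C1\<close> takes the place of the definition. Existence suffices,
  because \<open>weak_pd\<close> is a choice.\<close>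

lemma has_weak_pd_C1_mult:
  fixes w :: "real^'n::finite \<Rightarrow> real"
  assumes B: "C1_closure \<Omega> B" and \<Omega>: "open \<Omega>" and w: "has_weak_pd \<Omega> j w w'"
  shows "\<exists>g. has_weak_pd \<Omega> j (\<lambda>x. B x * w x) g"
proof -
  obtain D where D: "continuous_on (closure \<Omega>) D" "\<And>x. x \<in> \<Omega> \<Longrightarrow> (B has_derivative (\<lambda>h. D x \<bullet> h)) (at x)"
    and Bc: "continuous_on (closure \<Omega>) B"
    using B by (auto simp: C1_closure_def)
  have \<Omega>s: "\<Omega> \<in> sets lebesgue" using \<Omega> by auto
  define d where "d = (\<lambda>x. D x \<bullet> axis j 1)"
  have Bd: "B differentiable (at x)" "pd j B x = d x" if "x \<in> \<Omega>" for x
    using D(2)[OF that] pd_eq[OF D(2)[OF that]] by (auto simp: differentiable_def d_def)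
  have cB: "continuous_on \<Omega> B" and cd: "continuous_on \<Omega> d"
    using Bc D(1) closure_subset unfolding d_def
    by (auto intro!: continuous_intros intro: continuous_on_subset)
  have lw: "loc_integrable \<Omega> w" "loc_integrable \<Omega> w'" using w by (auto simp: has_weak_pd_def)
  have "has_weak_pd \<Omega> j (\<lambda>x. B x * w x) (\<lambda>x. B x * w' x + d x * w x)"
    unfolding has_weak_pd_def
  proof (intro conjI ballI)
    show "loc_integrable \<Omega> (\<lambda>x. B x * w x)" by (rule loc_integrable_continuous_mult[OF cB lw(1)])
    show "loc_integrable \<Omega> (\<lambda>x. B x * w' x + d x * w x)"
      using loc_integrable_continuous_mult[OF cB lw(2)] loc_integrable_continuous_mult[OF cd lw(1)]
      by (auto simp: loc_integrable_def intro!: set_integral_add)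
    fix \<psi> assume \<psi>: "\<psi> \<in> test_fun \<Omega>"
    obtain K where K: "compact K" "K \<subseteq> \<Omega>" "\<And>x. x \<notin> K \<Longrightarrow> \<psi> x = 0" using test_funE[OF \<psi>] by metis
    have clK: "closed K" using K(1) by (rule compact_imp_closed)
    have pd0: "pd j \<psi> x = 0" if "x \<notin> K" for x by (rule pd_zero_outside_closed[OF clK K(3) that])
    define h where "h = (\<lambda>x. B x * \<psi> x)"
    have h0: "h x = 0" if "x \<notin> K" for x using K(3)[OF that] by (simp add: h_def)
    have \<psi>d: "\<psi> differentiable (at x)" for x by (rule smooth_on_differentiable[OF test_fun_smooth[OF \<psi>]])
    have pdh: "pd j h x = B x * pd j \<psi> x + d x * \<psi> x" if "x \<in> \<Omega>" for x
      using Bd[OF that] \<psi>d by (simp add: h_def pd_mult)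
    have hd: "h differentiable (at x)" for x
    proof (cases "x \<in> \<Omega>")
      case True then show ?thesis unfolding h_def using Bd \<psi>d by simp
    next
      case False
      \<comment> \<open>Differentiability of \<open>B\<close> is known only in \<Omega>, but
        \<open>h\<close> vanishes on the open set \<open>- K\<close>.\<close>
      then have "x \<in> - K" using K by auto
      have "(h has_derivative (\<lambda>_. 0)) (at x)"
        by (rule has_derivative_transform_within_open[of "\<lambda>_. 0" _ _ _ "- K"]) (use clK \<open>x \<in> - K\<close> h0 in auto)
      then show ?thesis by (auto simp: differentiable_def)
    qed
    have cps: "continuous_on S \<psi>" "continuous_on S (pd j \<psi>)" for S
      using \<psi> by (auto intro!: smooth_on_continuous test_fun_smooth test_fun_pd)
    \<comment> \<open>Continuity is glued from the open sets \<Omega> and \<open>- K\<close>, which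
      cover the space.\<close>
    have "continuous_on \<Omega> (pd j h)"
      by (subst continuous_on_cong[OF refl pdh]) (auto intro!: continuous_intros cB cd cps)
    moreover have "continuous_on (- K) (pd j h)"
      by (subst continuous_on_cong[OF refl pd_zero_outside_closed[OF clK h0]]) auto
    ultimately have "continuous_on (\<Omega> \<union> - K) (pd j h)" using \<Omega> clK by (intro continuous_on_open_Un) auto
    then have cph: "continuous_on UNIV (pd j h)" 
  proof -
      have "\<Omega> \<union> - K = UNIV" using K(2) by auto
      with \<open>continuous_on (\<Omega> \<union> - K) (pd j h)\<close> show ?thesis by simp
    qed
    have e: "(LINT x|lebesgue_on \<Omega>. w x * pd j h x) = - (LINT x|lebesgue_on \<Omega>. w' x * h x)"
      by (rule weak_pd_test_C1[OF w \<Omega> hd cph K(1,2) h0])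
    have int: "integrable (lebesgue_on \<Omega>) (\<lambda>x. f x * (k x * p x))"
      if asm: "loc_integrable \<Omega> f" "continuous_on \<Omega> k" "p \<in> test_fun \<Omega>" "\<And>x. x \<notin> K \<Longrightarrow> p x = 0" for f k p
    proof -
      obtain C where C: "\<And>x. \<bar>p x\<bar> \<le> C" using test_fun_bounded[OF asm(3)] by metis
      have "bounded (k ` K)"
        using asm(2) K by (intro compact_imp_bounded compact_continuous_image) (auto intro: continuous_on_subset)
      then obtain C' where C': "\<And>x. x \<in> K \<Longrightarrow> \<bar>k x\<bar> \<le> C'" by (auto simp: bounded_iff)
      show ?thesis
      proof (rule loc_integrable_mult[OF asm(1) \<Omega>s K(1,2)])
        show "(\<lambda>x. k x * p x) \<in> borel_measurable (lebesgue_on \<Omega>)"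
          using asm(2,3) \<Omega>s by (intro borel_measurable_times continuous_imp_measurable_on_sets_lebesgue test_fun_measurable)
        show "\<bar>k x * p x\<bar> \<le> \<bar>C'\<bar> * \<bar>C\<bar>" for x
        proof (cases "x \<in> K")
          case True
          then show ?thesis unfolding abs_mult using C[of x] C'[of x] by (intro mult_mono) auto
        qed (simp add: asm(4))
        show "k x * p x = 0" if "x \<notin> K" for x using asm(4)[OF that] by simp
      qed
    qed
    have i1: "integrable (lebesgue_on \<Omega>) (\<lambda>x. w x * (B x * pd j \<psi> x))" by (rule int[OF lw(1) cB test_fun_pd[OF \<psi>] pd0])
    have i2: "integrable (lebesgue_on \<Omega>) (\<lambda>x. w x * (d x * \<psi> x))" by (rule int[OF lw(1) cd \<psi> K(3)])
    have i3: "integrable (lebesgue_on \<Omega>) (\<lambda>x. w' x * (B x * \<psi> x))" by (rule int[OF lw(2) cB \<psi> K(3)])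
    have "(LINT x|lebesgue_on \<Omega>. w x * pd j h x) = (LINT x|lebesgue_on \<Omega>. w x * (B x * pd j \<psi> x) + w x * (d x * \<psi> x))"
      by (intro Bochner_Integration.integral_cong refl) (simp add: space_restrict_space pdh distrib_left)
    also have "\<dots> = (LINT x|lebesgue_on \<Omega>. w x * (B x * pd j \<psi> x)) + (LINT x|lebesgue_on \<Omega>. w x * (d x * \<psi> x))"
      by (rule Bochner_Integration.integral_add[OF i1 i2])
    finally have "(LINT x|lebesgue_on \<Omega>. w x * (B x * pd j \<psi> x)) =
       - ((LINT x|lebesgue_on \<Omega>. w' x * (B x * \<psi> x)) + (LINT x|lebesgue_on \<Omega>. w x * (d x * \<psi> x)))"
      using e by (simp add: h_def)
    also have "\<dots> = - (LINT x|lebesgue_on \<Omega>. w' x * (B x * \<psi> x) + w x * (d x * \<psi> x))"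
      by (subst Bochner_Integration.integral_add[OF i3 i2]) simp
    finally show "(LINT x|lebesgue_on \<Omega>. B x * w x * pd j \<psi> x) = - (LINT x|lebesgue_on \<Omega>. (B x * w' x + d x * w x) * \<psi> x)"
      by (simp add: algebra_simps)
  qed
  then show ?thesis by blast
qed

section \<open>The weak form of the eigenvalue equation\<close>


lemma L2_tendsto_norm:
  assumes "L2_tendsto \<Omega> f g" shows "(\<lambda>k. L2_norm \<Omega> (f k)) \<longlonglongrightarrow> L2_norm \<Omega> g"
  unfolding L2_norm_def by (intro tendsto_real_sqrt L2_tendsto_inner assms)

text \<open>The second arguments \<open>g k\<close> are bounded but may fail to converge: they will
  be gradients of truncations.\<close>

lemma L2_inner_difference_tendsto_0:
  assumes f: "L2_tendsto \<Omega> f f'" and g: "\<And>k. g k \<in> L2 \<Omega>" "\<And>k. L2_norm \<Omega> (g k) \<le> B k" "B \<longlonglongrightarrow> b"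
  shows "(\<lambda>k. L2_inner \<Omega> f' (g k) - L2_inner \<Omega> (f k) (g k)) \<longlonglongrightarrow> 0"
proof -
  have f': "\<And>k. f k \<in> L2 \<Omega>" "f' \<in> L2 \<Omega>" "(\<lambda>k. L2_norm \<Omega> (\<lambda>x. f k x - f' x)) \<longlonglongrightarrow> 0"
    using f by (auto simp: L2_tendsto_def)
  have lim: "(\<lambda>k. L2_norm \<Omega> (\<lambda>x. f k x - f' x) * B k) \<longlonglongrightarrow> 0"
    using tendsto_mult[OF f'(3) g(3)] by simp
  have "norm (L2_inner \<Omega> f' (g k) - L2_inner \<Omega> (f k) (g k)) \<le> L2_norm \<Omega> (\<lambda>x. f k x - f' x) * B k" for k
  proof -
    have "L2_inner \<Omega> f' (g k) - L2_inner \<Omega> (f k) (g k) = L2_inner \<Omega> (\<lambda>x. f' x - f k x) (g k)"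
      using f' g by (simp add: L2_inner_diff_left)
    also have "\<bar>\<dots>\<bar> \<le> L2_norm \<Omega> (\<lambda>x. f' x - f k x) * L2_norm \<Omega> (g k)"
      using f' g by (intro L2_Cauchy_Schwarz L2_diff) auto
    also have "\<dots> \<le> L2_norm \<Omega> (\<lambda>x. f' x - f k x) * B k"
      using g(2) by (intro mult_left_mono L2_norm_nonneg) auto
    finally show ?thesis by (simp add: L2_norm_minus_commute[of \<Omega> f'])
  qed
  then show ?thesis by (intro Lim_null_comparison[OF _ lim]) auto
qed

locale elliptic_problem =
  fixes \<Omega> :: "(real^'n::finite) set" and A c \<mu> \<phi>
  assumes dom: "smooth_bounded_domain \<Omega>" and ell: "elliptic_coeffs \<Omega> A c"
    and eig: "eigensystem \<Omega> A c \<mu> \<phi>"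
begin

lemma \<Omega>_open: "open \<Omega>" and \<Omega>_bounded: "bounded \<Omega>"
  using dom by (auto simp: smooth_bounded_domain_def)

lemma \<Omega>_lmeasurable: "\<Omega> \<in> lmeasurable"
  using \<Omega>_open \<Omega>_bounded by (intro bounded_set_imp_lmeasurable) auto

lemma \<Omega>_sets: "\<Omega> \<in> sets lebesgue" using \<Omega>_lmeasurable by auto

lemma A_cont: "continuous_on (closure \<Omega>) (A i j)" and A_C1: "C1_closure \<Omega> (A i j)"
  using ell by (auto simp: elliptic_coeffs_def C1_closure_def)

lemma c_cont: "continuous_on (closure \<Omega>) c" and c_nonneg: "x \<in> \<Omega> \<Longrightarrow> c x \<ge> 0"
  using ell closure_subset[of \<Omega>] by (auto simp: elliptic_coeffs_def)

lemma A_nonneg: "x \<in> \<Omega> \<Longrightarrow> (\<Sum>i\<in>UNIV. \<Sum>j\<in>UNIV. A i j x * \<xi> i * \<xi> j) \<ge> 0"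
proof -
  assume "x \<in> \<Omega>"
  then have x: "x \<in> closure \<Omega>" using closure_subset by auto
  obtain \<delta> where \<delta>: "\<delta> > 0" "\<And>\<zeta>::real^'n. (\<Sum>i\<in>UNIV. \<Sum>j\<in>UNIV. A i j x * \<zeta> $ i * \<zeta> $ j) \<ge> \<delta> * (\<Sum>i\<in>UNIV. (\<zeta> $ i)\<^sup>2)"
    using ell x unfolding elliptic_coeffs_def by blast
  have "0 \<le> \<delta> * (\<Sum>i\<in>UNIV. ((\<chi> i. \<xi> i) $ i)\<^sup>2)" using \<delta>(1) by (intro mult_nonneg_nonneg sum_nonneg) auto
  also have "\<dots> \<le> (\<Sum>i\<in>UNIV. \<Sum>j\<in>UNIV. A i j x * \<xi> i * \<xi> j)" using \<delta>(2)[of "\<chi> i. \<xi> i"] by simp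
  finally show ?thesis .
qed

lemma \<phi>_op_domain: "\<phi> n \<in> op_domain \<Omega>"
  and \<phi>_eigen: "AE x in lebesgue_on \<Omega>. elliptic_op \<Omega> A c (\<phi> n) x = \<mu> n * \<phi> n x"
  and \<phi>_orthonormal: "L2_inner \<Omega> (\<phi> n) (\<phi> k) = (if n = k then 1 else 0)"
  and \<phi>_complete: "f \<in> L2 \<Omega> \<Longrightarrow> L2_sums \<Omega> (\<lambda>n x. L2_inner \<Omega> f (\<phi> n) * \<phi> n x) f"
  using eig by (auto simp: eigensystem_def)

lemma \<mu>_pos: "\<mu> n > 0"
proof -
  have "\<mu> 0 \<le> \<mu> n" using eig by (auto simp: eigensystem_def incseq_def)
  then show ?thesis using eig by (auto simp: eigensystem_def)
qed

lemma \<phi>_L2: "\<phi> n \<in> L2 \<Omega>"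
  using \<phi>_op_domain[of n] by (auto simp: op_domain_def H10_def H1_def)

lemma grad_L2: "weak_pd \<Omega> j (\<phi> n) \<in> L2 \<Omega>"
  using \<phi>_op_domain[of n] by (auto simp: op_domain_def H10_def H1_def)

lemma cont_mult_L2:
  assumes "continuous_on (closure \<Omega>) k" "f \<in> L2 \<Omega>" shows "(\<lambda>x. k x * f x) \<in> L2 \<Omega>"
proof -
  note continuous_on_closure_measurable_bounded[OF assms(1) \<Omega>_bounded \<Omega>_open]
  then obtain C where "k \<in> borel_measurable (lebesgue_on \<Omega>)" "\<And>x. x \<in> \<Omega> \<Longrightarrow> \<bar>k x\<bar> \<le> C" by auto
  then show ?thesis using assms(2) \<Omega>_sets by (intro L2_bounded_mult) auto
qed

lemma cont_mult_tendsto: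
  assumes "continuous_on (closure \<Omega>) k" "L2_tendsto \<Omega> f f'"
  shows "L2_tendsto \<Omega> (\<lambda>n x. k x * f n x) (\<lambda>x. k x * f' x)"
proof -
  obtain C where C: "\<And>x. x \<in> \<Omega> \<Longrightarrow> \<bar>k x\<bar> \<le> C"
    using continuous_on_closure_measurable_bounded[OF assms(1) \<Omega>_bounded \<Omega>_open] by auto
  show ?thesis
  proof (rule L2_tendsto_dominated[OF assms(2)])
    show "(\<lambda>x. k x * f n x) \<in> L2 \<Omega>" "(\<lambda>x. k x * f' x) \<in> L2 \<Omega>" for n
      using assms by (auto intro!: cont_mult_L2 simp: L2_tendsto_def)
    show "\<bar>k x * f n x - k x * f' x\<bar> \<le> C * \<bar>f n x - f' x\<bar>" if "x \<in> \<Omega>" for n x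
      using C[OF that] by (simp add: abs_mult mult_right_mono flip: right_diff_distrib)
  qed
qed

text \<open>The eigenvalue equation is multiplied by \<psi> and one derivative is moved onto \<psi>.
  As \<open>\<phi> n\<close> lies in H^2, the products \<open>A i j\<close> times first derivatives
  have weak derivatives by \<open>has_weak_pd_C1_mult\<close>. These are locally integrable, so they
  can be paired with the compactly supported \<psi> one by one.\<close>

lemma weak_form_eigen:
  assumes \<psi>: "\<psi> \<in> test_fun \<Omega>"
  shows "\<mu> n * L2_inner \<Omega> (\<phi> n) \<psi> =
    (\<Sum>i\<in>UNIV. \<Sum>j\<in>UNIV. L2_inner \<Omega> (\<lambda>x. A i j x * weak_pd \<Omega> i (\<phi> n) x) (pd j \<psi>)) +
    L2_inner \<Omega> (\<lambda>x. c x * \<phi> n x) \<psi>"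
proof -
  define v where "v = (\<lambda>i j. weak_pd \<Omega> j (\<lambda>y. A i j y * weak_pd \<Omega> i (\<phi> n) y))"
  have w: "has_weak_pd \<Omega> j (\<lambda>y. A i j y * weak_pd \<Omega> i (\<phi> n) y) (v i j)" for i j
  proof -
    have "has_weak_pd \<Omega> j (weak_pd \<Omega> i (\<phi> n)) (weak_pd \<Omega> j (weak_pd \<Omega> i (\<phi> n)))"
      using \<phi>_op_domain[of n] by (auto simp: op_domain_def H2_def H1_def)
    \<comment> \<open>Existence turns the choice \<open>weak_pd\<close> inside
      \<open>elliptic_op\<close> into an actual weak derivative.\<close>
    from has_weak_pd_C1_mult[OF A_C1 \<Omega>_open this] show ?thesis
      unfolding v_def weak_pd_def[of \<Omega> j "\<lambda>y. A i j y * weak_pd \<Omega> i (\<phi> n) y"] by (rule someI_ex)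
  qed
  have \<psi>L2: "\<psi> \<in> L2 \<Omega>" using \<psi> \<Omega>_lmeasurable by (rule test_fun_L2)
  obtain K where K: "compact K" "K \<subseteq> \<Omega>" "\<And>x. x \<notin> K \<Longrightarrow> \<psi> x = 0" using test_funE[OF \<psi>] by metis
  obtain C where C: "\<And>x. \<bar>\<psi> x\<bar> \<le> C" using test_fun_bounded[OF \<psi>] by metis
  have iv: "integrable (lebesgue_on \<Omega>) (\<lambda>x. v i j x * \<psi> x)" for i j
    by (rule loc_integrable_mult[OF _ \<Omega>_sets K(1,2) test_fun_measurable[OF \<psi> \<Omega>_sets] C K(3)])
       (use w in \<open>auto simp: has_weak_pd_def\<close>)
  have ic: "integrable (lebesgue_on \<Omega>) (\<lambda>x. c x * \<phi> n x * \<psi> x)"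
    by (intro L2_mult_integrable cont_mult_L2 c_cont \<phi>_L2 \<psi>L2)
  have eq: "elliptic_op \<Omega> A c (\<phi> n) x * \<psi> x = - (\<Sum>i\<in>UNIV. \<Sum>j\<in>UNIV. v i j x * \<psi> x) + c x * \<phi> n x * \<psi> x" for x
    by (simp add: elliptic_op_def v_def left_diff_distrib sum_distrib_right)
  have isum: "integrable (lebesgue_on \<Omega>) (\<lambda>x. \<Sum>i\<in>UNIV. \<Sum>j\<in>UNIV. v i j x * \<psi> x)"
    by (intro Bochner_Integration.integrable_sum iv)
  have int: "integrable (lebesgue_on \<Omega>) (\<lambda>x. elliptic_op \<Omega> A c (\<phi> n) x * \<psi> x)"
    unfolding eq using isum ic by simp
  have vl: "(LINT x|lebesgue_on \<Omega>. v i j x * \<psi> x) = - L2_inner \<Omega> (\<lambda>x. A i j x * weak_pd \<Omega> i (\<phi> n) x) (pd j \<psi>)" for i j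
    using w[of j i] \<psi> by (auto simp: has_weak_pd_def L2_inner_def)
  have "\<mu> n * L2_inner \<Omega> (\<phi> n) \<psi> = (LINT x|lebesgue_on \<Omega>. \<mu> n * (\<phi> n x * \<psi> x))"
    by (simp add: L2_inner_def)
  also have "\<dots> = (LINT x|lebesgue_on \<Omega>. elliptic_op \<Omega> A c (\<phi> n) x * \<psi> x)"
  proof (rule integral_cong_AE)
    show "(\<lambda>x. \<mu> n * (\<phi> n x * \<psi> x)) \<in> borel_measurable (lebesgue_on \<Omega>)"
      using L2_measurable[OF \<phi>_L2] L2_measurable[OF \<psi>L2] by simp
    show "AE x in lebesgue_on \<Omega>. \<mu> n * (\<phi> n x * \<psi> x) = elliptic_op \<Omega> A c (\<phi> n) x * \<psi> x"
      using \<phi>_eigen[of n] by eventually_elim simp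
  qed (use int in auto)
  also have "\<dots> = - (\<Sum>i\<in>UNIV. \<Sum>j\<in>UNIV. LINT x|lebesgue_on \<Omega>. v i j x * \<psi> x) + L2_inner \<Omega> (\<lambda>x. c x * \<phi> n x) \<psi>"
    unfolding eq using isum ic iv by (simp add: Bochner_Integration.integral_sum L2_inner_def)
  finally show ?thesis by (simp add: vl sum_negf)
qed

text \<open>With T = \<open>smooth_pos\<close> and L the elliptic operator, (L u, T(-u)) is formally
  the integral of c u T(-u) minus T'(-u) times the quadratic form of A at the gradient of u, and
  neither term contributes positively. Instead of a chain rule in H^1_0, test functions close to u
  are truncated: the results are again test functions, so the classical chain rule and
  \<open>weak_form_eigen\<close> apply.\<close>

lemma truncation_inequality:
  "L2_inner \<Omega> (\<lambda>x. \<Sum>n<N. b n * \<mu> n * \<phi> n x) (\<lambda>x. smooth_pos (- (\<Sum>n<N. b n * \<phi> n x))) \<le> 0"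
proof -
  define u where "u = (\<lambda>x. \<Sum>n<N. b n * \<phi> n x)"
  define Lu where "Lu = (\<lambda>x. \<Sum>n<N. b n * \<mu> n * \<phi> n x)"
  define D where "D = (\<lambda>j x. \<Sum>n<N. b n * weak_pd \<Omega> j (\<phi> n) x)"
  have "\<forall>n. \<exists>\<psi>. (\<forall>k. \<psi> k \<in> test_fun \<Omega>) \<and> L2_tendsto \<Omega> \<psi> (\<phi> n) \<and>
                 (\<forall>j. L2_tendsto \<Omega> (\<lambda>k. pd j (\<psi> k)) (weak_pd \<Omega> j (\<phi> n)))"
    using \<phi>_op_domain by (auto simp: op_domain_def H10_def)
  then obtain \<psi> where \<psi>: "\<And>n k. \<psi> n k \<in> test_fun \<Omega>" "\<And>n. L2_tendsto \<Omega> (\<psi> n) (\<phi> n)"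
    "\<And>n j. L2_tendsto \<Omega> (\<lambda>k. pd j (\<psi> n k)) (weak_pd \<Omega> j (\<phi> n))" by metis
  define \<Psi> where "\<Psi> = (\<lambda>k x. \<Sum>n<N. b n * \<psi> n k x)"
  have \<Psi>t: "\<Psi> k \<in> test_fun \<Omega>" for k
    unfolding \<Psi>_def by (intro test_fun_sum test_fun_scale \<psi>)
  have \<Psi>u: "L2_tendsto \<Omega> \<Psi> u"
    unfolding \<Psi>_def u_def by (intro L2_tendsto_sum L2_tendsto_scale \<psi>)
  have diff: "f differentiable (at x)" if "f \<in> test_fun \<Omega>" for f x
    by (rule smooth_on_differentiable[OF test_fun_smooth[OF that]])
  have pd\<Psi>: "pd j (\<Psi> k) = (\<lambda>x. \<Sum>n<N. b n * pd j (\<psi> n k) x)" for j k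
    unfolding \<Psi>_def by (intro ext) (simp add: pd_sum pd_scale diff test_fun_scale \<psi>(1))
  have \<Psi>D: "L2_tendsto \<Omega> (\<lambda>k. pd j (\<Psi> k)) (D j)" for j
    unfolding pd\<Psi> D_def by (intro L2_tendsto_sum L2_tendsto_scale \<psi>)
  define \<tau> where "\<tau> = (\<lambda>k x. smooth_pos (- \<Psi> k x))"
  have \<tau>t: "\<tau> k \<in> test_fun \<Omega>" for k unfolding \<tau>_def by (rule test_fun_smooth_pos[OF \<Psi>t])
  have pd\<tau>: "pd j (\<tau> k) x = - smooth_pos_deriv (- \<Psi> k x) * pd j (\<Psi> k) x" for j k x
  proof -
    have "((\<lambda>s. smooth_pos (- s)) has_real_derivative - smooth_pos_deriv (- \<Psi> k x)) (at (\<Psi> k x))"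
      using DERIV_chain2[OF smooth_pos_DERIV DERIV_minus[OF DERIV_ident]] by simp
    from pd_compose[OF diff[OF \<Psi>t] this] show ?thesis by (simp add: \<tau>_def)
  qed
  have L2s: "\<Psi> k \<in> L2 \<Omega>" "\<tau> k \<in> L2 \<Omega>" "pd j (\<Psi> k) \<in> L2 \<Omega>" "pd j (\<tau> k) \<in> L2 \<Omega>" for j k
    by (auto intro!: test_fun_L2 \<Omega>_lmeasurable test_fun_pd \<Psi>t \<tau>t)
  have uL2: "u \<in> L2 \<Omega>"
    unfolding u_def by (intro L2_sum L2_scale \<phi>_L2)
  define Tu where "Tu = (\<lambda>x. smooth_pos (- u x))"
  have Tu: "Tu \<in> L2 \<Omega>"
  proof -
    have "(\<lambda>x. - u x) \<in> borel_measurable (lebesgue_on \<Omega>)" using L2_measurable[OF uL2] by simp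
    from borel_measurable_continuous_on[OF continuous_on_smooth_pos this]
    have m: "Tu \<in> borel_measurable (lebesgue_on \<Omega>)" by (simp add: Tu_def)
    have "\<bar>Tu x\<bar> \<le> \<bar>u x\<bar>" for x using smooth_pos_le[of "- u x"] smooth_pos_nonneg[of "- u x"] by (simp add: Tu_def)
    from L2_dominated[OF uL2 m this] show ?thesis .
  qed
  have \<tau>u: "L2_tendsto \<Omega> \<tau> Tu"
    by (rule L2_tendsto_dominated[OF \<Psi>u L2s(2) Tu, where C = 2]) (use smooth_pos_lipschitz[of "- _" "- _"] in \<open>auto simp: \<tau>_def Tu_def abs_minus_commute\<close>)
  have lhs: "(\<lambda>k. L2_inner \<Omega> Lu (\<tau> k)) \<longlonglongrightarrow> L2_inner \<Omega> Lu Tu"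
    by (intro L2_tendsto_inner \<tau>u L2_tendsto_const) (auto simp: Lu_def intro!: L2_sum L2_scale \<phi>_L2)
  have weak: "L2_inner \<Omega> Lu (\<tau> k) = (\<Sum>i\<in>UNIV. \<Sum>j\<in>UNIV. L2_inner \<Omega> (\<lambda>x. A i j x * D i x) (pd j (\<tau> k))) +
      L2_inner \<Omega> (\<lambda>x. c x * u x) (\<tau> k)" for k
  proof -
    have hA: "(\<Sum>n<N. b n * L2_inner \<Omega> (\<lambda>x. A i j x * weak_pd \<Omega> i (\<phi> n) x) (pd j (\<tau> k))) =
       L2_inner \<Omega> (\<lambda>x. A i j x * D i x) (pd j (\<tau> k))" for i j
    proof -
      have e: "(\<lambda>x. A i j x * D i x) = (\<lambda>x. \<Sum>n<N. b n * (A i j x * weak_pd \<Omega> i (\<phi> n) x))"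
        by (simp add: D_def sum_distrib_left mult_ac)
      show ?thesis unfolding e
        by (subst L2_inner_sum_left) (auto intro!: L2_scale cont_mult_L2 A_cont grad_L2 L2s simp: L2_inner_scale_left)
    qed
    have hc: "(\<Sum>n<N. b n * L2_inner \<Omega> (\<lambda>x. c x * \<phi> n x) (\<tau> k)) = L2_inner \<Omega> (\<lambda>x. c x * u x) (\<tau> k)"
    proof -
      have e: "(\<lambda>x. c x * u x) = (\<lambda>x. \<Sum>n<N. b n * (c x * \<phi> n x))"
        by (simp add: u_def sum_distrib_left mult_ac)
      show ?thesis unfolding e
        by (subst L2_inner_sum_left) (auto intro!: L2_scale cont_mult_L2 c_cont \<phi>_L2 L2s simp: L2_inner_scale_left)
    qed
    have "L2_inner \<Omega> Lu (\<tau> k) = (\<Sum>n<N. b n * (\<mu> n * L2_inner \<Omega> (\<phi> n) (\<tau> k)))"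
      unfolding Lu_def by (subst L2_inner_sum_left) (auto intro!: L2_scale \<phi>_L2 L2s simp: L2_inner_scale_left mult.assoc)
    also have "\<dots> = (\<Sum>n<N. \<Sum>i\<in>UNIV. \<Sum>j\<in>UNIV. b n * L2_inner \<Omega> (\<lambda>x. A i j x * weak_pd \<Omega> i (\<phi> n) x) (pd j (\<tau> k))) +
       (\<Sum>n<N. b n * L2_inner \<Omega> (\<lambda>x. c x * \<phi> n x) (\<tau> k))"
      unfolding weak_form_eigen[OF \<tau>t] by (simp add: distrib_left sum.distrib sum_distrib_left)
    also have "(\<Sum>n<N. \<Sum>i\<in>UNIV. \<Sum>j\<in>UNIV. b n * L2_inner \<Omega> (\<lambda>x. A i j x * weak_pd \<Omega> i (\<phi> n) x) (pd j (\<tau> k)))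
      = (\<Sum>i\<in>UNIV. \<Sum>j\<in>UNIV. \<Sum>n<N. b n * L2_inner \<Omega> (\<lambda>x. A i j x * weak_pd \<Omega> i (\<phi> n) x) (pd j (\<tau> k)))"
      by (subst sum.swap) (intro sum.cong refl sum.swap)
    finally show ?thesis by (simp only: hA hc)
  qed
  \<comment> \<open>The form in \<open>weak\<close> with \<open>u\<close> and \<open>D\<close>
    replaced by \<open>\<Psi> k\<close> and its gradient. Here the sign is visible, and
    \<open>E\<close> shows that the replacement costs nothing in the limit.\<close>
  define P where "P = (\<lambda>k. (\<Sum>i\<in>UNIV. \<Sum>j\<in>UNIV. L2_inner \<Omega> (\<lambda>x. A i j x * pd i (\<Psi> k) x) (pd j (\<tau> k))) +
      L2_inner \<Omega> (\<lambda>x. c x * \<Psi> k x) (\<tau> k))"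
  have P: "P k \<le> 0" for k
  proof -
    have i1: "integrable (lebesgue_on \<Omega>) (\<lambda>x. A i j x * pd i (\<Psi> k) x * pd j (\<tau> k) x)" for i j
      by (intro L2_mult_integrable cont_mult_L2 A_cont L2s)
    have i2: "integrable (lebesgue_on \<Omega>) (\<lambda>x. c x * \<Psi> k x * \<tau> k x)"
      by (intro L2_mult_integrable cont_mult_L2 c_cont L2s)
    have "P k = (LINT x|lebesgue_on \<Omega>. (\<Sum>i\<in>UNIV. \<Sum>j\<in>UNIV. A i j x * pd i (\<Psi> k) x * pd j (\<tau> k) x) + c x * \<Psi> k x * \<tau> k x)"
      using i1 i2 by (simp add: P_def L2_inner_def Bochner_Integration.integral_sum)
    also have "\<dots> \<le> 0"
    proof -
      have "(\<Sum>i\<in>UNIV. \<Sum>j\<in>UNIV. A i j x * pd i (\<Psi> k) x * pd j (\<tau> k) x) + c x * \<Psi> k x * \<tau> k x \<le> 0" if x: "x \<in> \<Omega>" for x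
      proof -
        have "(\<Sum>i\<in>UNIV. \<Sum>j\<in>UNIV. A i j x * pd i (\<Psi> k) x * pd j (\<tau> k) x) =
          - smooth_pos_deriv (- \<Psi> k x) * (\<Sum>i\<in>UNIV. \<Sum>j\<in>UNIV. A i j x * pd i (\<Psi> k) x * pd j (\<Psi> k) x)"
          by (simp add: pd\<tau> sum_distrib_left mult_ac)
        also have "\<dots> \<le> 0"
          using A_nonneg[OF x, of "\<lambda>i. pd i (\<Psi> k) x"] smooth_pos_deriv_bounds by (intro mult_nonpos_nonneg) auto
        finally have 1: "(\<Sum>i\<in>UNIV. \<Sum>j\<in>UNIV. A i j x * pd i (\<Psi> k) x * pd j (\<tau> k) x) \<le> 0" .
        have "\<Psi> k x * \<tau> k x \<le> 0"
          by (cases "\<Psi> k x \<ge> 0") (auto simp: \<tau>_def smooth_pos_eq_0 smooth_pos_nonneg mult_nonpos_nonneg)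
        then have "c x * \<Psi> k x * \<tau> k x \<le> 0" using c_nonneg[OF x] by (simp add: mult.assoc mult_nonneg_nonpos)
        with 1 show ?thesis by simp
      qed
      then have "0 \<le> (LINT x|lebesgue_on \<Omega>. - ((\<Sum>i\<in>UNIV. \<Sum>j\<in>UNIV. A i j x * pd i (\<Psi> k) x * pd j (\<tau> k) x) + c x * \<Psi> k x * \<tau> k x))"
        by (intro integral_nonneg_AE AE_I2) (simp only: space_restrict_space neg_0_le_iff_le, auto)
      then show ?thesis unfolding Bochner_Integration.integral_minus by linarith
    qed
    finally show ?thesis .
  qed
  have E: "(\<lambda>k. L2_inner \<Omega> Lu (\<tau> k) - P k) \<longlonglongrightarrow> 0"
  proof -
    \<comment> \<open>A bound on the gradients of the truncations is enough, since the other factor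
      of each inner product converges.\<close>
    have pdnorm: "L2_norm \<Omega> (pd j (\<tau> k)) \<le> 2 * L2_norm \<Omega> (pd j (\<Psi> k))" for j k
    proof -
      have "L2_norm \<Omega> (pd j (\<tau> k)) \<le> L2_norm \<Omega> (\<lambda>x. 2 * pd j (\<Psi> k) x)"
        using smooth_pos_deriv_bounds by (intro L2_norm_mono L2_scale L2s) (auto simp: pd\<tau> abs_mult mult_right_mono)
      then show ?thesis by (simp add: L2_norm_scale)
    qed
    have "(\<lambda>k. (\<Sum>i\<in>UNIV. \<Sum>j\<in>UNIV. L2_inner \<Omega> (\<lambda>x. A i j x * D i x) (pd j (\<tau> k)) -
          L2_inner \<Omega> (\<lambda>x. A i j x * pd i (\<Psi> k) x) (pd j (\<tau> k))) +
        (L2_inner \<Omega> (\<lambda>x. c x * u x) (\<tau> k) - L2_inner \<Omega> (\<lambda>x. c x * \<Psi> k x) (\<tau> k)))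
      \<longlonglongrightarrow> (\<Sum>i\<in>(UNIV :: 'n set). \<Sum>j\<in>(UNIV :: 'n set). 0) + 0"
      by (intro tendsto_add tendsto_sum L2_inner_difference_tendsto_0[OF cont_mult_tendsto[OF A_cont \<Psi>D] L2s(4) pdnorm tendsto_mult_left[OF L2_tendsto_norm[OF \<Psi>D]]]
          L2_inner_difference_tendsto_0[OF cont_mult_tendsto[OF c_cont \<Psi>u] L2s(2) order.refl L2_tendsto_norm[OF \<tau>u]])
    then show ?thesis unfolding weak P_def by (simp add: sum_subtractf algebra_simps)
  qed
  have "L2_inner \<Omega> Lu Tu - 0 \<le> 0"
    by (rule LIMSEQ_le_const2[OF tendsto_diff[OF lhs E]]) (use P in auto)
  then show ?thesis by (simp add: Lu_def Tu_def u_def)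
qed

end

section \<open>Positivity of multipliers\<close>


context elliptic_problem
begin

abbreviation coef :: "(real^'n \<Rightarrow> real) \<Rightarrow> nat \<Rightarrow> real" where "coef f n \<equiv> L2_inner \<Omega> f (\<phi> n)"

lemma Parseval:
  assumes "f \<in> L2 \<Omega>" "g \<in> L2 \<Omega>" shows "(\<lambda>n. coef f n * coef g n) sums L2_inner \<Omega> f g"
proof -
  have "(\<lambda>N. L2_inner \<Omega> (\<lambda>x. \<Sum>n<N. coef f n * \<phi> n x) g) \<longlonglongrightarrow> L2_inner \<Omega> f g"
    using \<phi>_complete[OF assms(1)] assms(2) unfolding L2_sums_def by (intro L2_tendsto_inner L2_tendsto_const)
  moreover have "L2_inner \<Omega> (\<lambda>x. \<Sum>n<N. coef f n * \<phi> n x) g = (\<Sum>n<N. coef f n * coef g n)" for N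
    using assms(2) by (simp add: L2_inner_sum_left L2_scale \<phi>_L2 L2_inner_scale_left L2_inner_commute[of \<Omega> g])
  ultimately show ?thesis by (simp add: sums_def)
qed

text \<open>Cauchy-Schwarz over the index together with Bessel's inequality. The absolute values
  inside the sum give absolute convergence for every bounded multiplier.\<close>

lemma coef_product_sum_le:
  assumes "f \<in> L2 \<Omega>" "g \<in> L2 \<Omega>"
  shows "(\<Sum>n<N. \<bar>coef f n * coef g n\<bar>) \<le> L2_norm \<Omega> f * L2_norm \<Omega> g"
proof (rule power2_le_imp_le)
  have bessel: "(\<Sum>n<N. \<bar>coef h n\<bar>\<^sup>2) \<le> (L2_norm \<Omega> h)\<^sup>2" if "h \<in> L2 \<Omega>" for h
    unfolding L2_norm_power2
    using Parseval[OF that that] sum_le_suminf[of "\<lambda>n. coef h n * coef h n" "{..<N}"]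
    by (auto simp: sums_iff power2_eq_square)
  have "(\<Sum>n<N. \<bar>coef f n * coef g n\<bar>)\<^sup>2 \<le> (\<Sum>n<N. \<bar>coef f n\<bar>\<^sup>2) * (\<Sum>n<N. \<bar>coef g n\<bar>\<^sup>2)"
    unfolding abs_mult by (rule Cauchy_Schwarz_ineq_sum)
  also have "\<dots> \<le> (L2_norm \<Omega> f)\<^sup>2 * (L2_norm \<Omega> g)\<^sup>2"
    using bessel assms by (intro mult_mono sum_nonneg) auto
  finally show "(\<Sum>n<N. \<bar>coef f n * coef g n\<bar>)\<^sup>2 \<le> (L2_norm \<Omega> f * L2_norm \<Omega> g)\<^sup>2"
    by (simp only: power_mult_distrib)
qed (simp add: L2_norm_nonneg)

lemma
  assumes "f \<in> L2 \<Omega>" "g \<in> L2 \<Omega>" "\<And>n. \<bar>\<rho> n\<bar> \<le> C"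
  shows summable_multiplier: "summable (\<lambda>n. \<bar>\<rho> n * (coef f n * coef g n)\<bar>)"
    and multiplier_bound: "\<bar>\<Sum>n. \<rho> n * (coef f n * coef g n)\<bar> \<le> C * (L2_norm \<Omega> f * L2_norm \<Omega> g)"
proof -
  have C: "C \<ge> 0" using assms(3)[of 0] by linarith
  have le: "(\<Sum>n<N. \<bar>\<rho> n * (coef f n * coef g n)\<bar>) \<le> C * (L2_norm \<Omega> f * L2_norm \<Omega> g)" for N
  proof -
    have "(\<Sum>n<N. \<bar>\<rho> n * (coef f n * coef g n)\<bar>) \<le> (\<Sum>n<N. C * \<bar>coef f n * coef g n\<bar>)"
      unfolding abs_mult[of "\<rho> _"] using assms(3) by (intro sum_mono mult_right_mono) auto
    also have "\<dots> \<le> C * (L2_norm \<Omega> f * L2_norm \<Omega> g)"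
      unfolding sum_distrib_left[symmetric] using C coef_product_sum_le[OF assms(1,2)] by (intro mult_left_mono)
    finally show ?thesis .
  qed
  show s: "summable (\<lambda>n. \<bar>\<rho> n * (coef f n * coef g n)\<bar>)"
    using le by (intro summableI_nonneg_bounded) auto
  have "\<bar>\<Sum>n. \<rho> n * (coef f n * coef g n)\<bar> \<le> (\<Sum>n. \<bar>\<rho> n * (coef f n * coef g n)\<bar>)"
    by (rule summable_rabs[OF s])
  also have "\<dots> \<le> C * (L2_norm \<Omega> f * L2_norm \<Omega> g)"
    using s le by (intro suminf_le_const) auto
  finally show "\<bar>\<Sum>n. \<rho> n * (coef f n * coef g n)\<bar> \<le> C * (L2_norm \<Omega> f * L2_norm \<Omega> g)" .
qed

lemma coef_finite_sum:
  "coef (\<lambda>x. \<Sum>k<N. b k * \<phi> k x) n = (if n < N then b n else 0)"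
  by (simp add: L2_inner_sum_left L2_scale \<phi>_L2 L2_inner_scale_left \<phi>_orthonormal if_distrib cong: if_cong)

lemma L2_norm_finite_sum: "(L2_norm \<Omega> (\<lambda>x. \<Sum>k<N. b k * \<phi> k x))\<^sup>2 = (\<Sum>k<N. (b k)\<^sup>2)"
proof -
  let ?u = "\<lambda>x. \<Sum>k<N. b k * \<phi> k x"
  have "L2_inner \<Omega> ?u ?u = (\<Sum>k<N. b k * L2_inner \<Omega> (\<phi> k) ?u)"
    by (subst L2_inner_sum_left) (auto intro!: L2_sum L2_scale \<phi>_L2 simp: L2_inner_scale_left)
  also have "\<dots> = (\<Sum>k<N. b k * b k)"
    by (intro sum.cong refl) (simp add: L2_inner_commute[of \<Omega> "\<phi> _"] coef_finite_sum)
  finally show ?thesis unfolding L2_norm_power2 by (simp add: power2_eq_square)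
qed

text \<open>The partial sums of the eigenfunction expansion of \<open>(A + p)\<^sup>-\<^sup>1 f\<close> need not be non-negative, but
  testing with their smoothed negative parts shows that their negative parts vanish in the limit.\<close>

lemma resolvent_negative_part:
  assumes f: "f \<in> L2 \<Omega>" "AE x in lebesgue_on \<Omega>. f x \<ge> 0" and p: "p > 0"
  defines "u \<equiv> \<lambda>N x. \<Sum>k<N. coef f k / (\<mu> k + p) * \<phi> k x"
  shows "(\<lambda>N. L2_norm \<Omega> (\<lambda>x. max 0 (- u N x))) \<longlonglongrightarrow> 0"
proof -
  define w where "w = (\<lambda>N x. max 0 (- u N x))"
  define S where "S = (\<lambda>N x. \<Sum>k<N. coef f k * \<phi> k x)"
  define Tu where "Tu = (\<lambda>N x. smooth_pos (- u N x))"
  have uL2: "u N \<in> L2 \<Omega>" and SL2: "S N \<in> L2 \<Omega>" for N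
    unfolding u_def S_def by (intro L2_sum L2_scale \<phi>_L2)+
  have um: "u N \<in> borel_measurable (lebesgue_on \<Omega>)" for N using uL2 by (rule L2_measurable)
  have TuL2: "Tu N \<in> L2 \<Omega>" for N
  proof (rule L2_dominated[OF uL2[of N]])
    have "(\<lambda>x. - u N x) \<in> borel_measurable (lebesgue_on \<Omega>)" using um by simp
    from borel_measurable_continuous_on[OF continuous_on_smooth_pos this]
    show "Tu N \<in> borel_measurable (lebesgue_on \<Omega>)" by (simp add: Tu_def)
    show "\<bar>Tu N x\<bar> \<le> \<bar>u N x\<bar>" for x using smooth_pos_le[of "- u N x"] smooth_pos_nonneg[of "- u N x"] by (simp add: Tu_def)
  qed
  have wL2: "w N \<in> L2 \<Omega>" for N
  proof (rule L2_dominated[OF uL2[of N]])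
    show "w N \<in> borel_measurable (lebesgue_on \<Omega>)" unfolding w_def using um by measurable
    show "\<bar>w N x\<bar> \<le> \<bar>u N x\<bar>" for x by (auto simp: w_def)
  qed
  have mp: "\<mu> k + p > 0" for k using \<mu>_pos[of k] p by simp
  have unorm: "L2_norm \<Omega> (u N) \<le> L2_norm \<Omega> f / p" for N
  proof (rule power2_le_imp_le)
    have "(L2_norm \<Omega> (u N))\<^sup>2 = (\<Sum>k<N. (coef f k / (\<mu> k + p))\<^sup>2)" unfolding u_def by (rule L2_norm_finite_sum)
    also have "\<dots> \<le> (\<Sum>k<N. \<bar>coef f k * coef f k\<bar> / p\<^sup>2)"
    proof (rule sum_mono)
      fix k
      have "p\<^sup>2 \<le> (\<mu> k + p)\<^sup>2" using p \<mu>_pos[of k] by (intro power_mono) auto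
      then show "(coef f k / (\<mu> k + p))\<^sup>2 \<le> \<bar>coef f k * coef f k\<bar> / p\<^sup>2"
        using p mp[of k] by (simp add: power_divide abs_mult power2_eq_square[of "coef f k"] frac_le)
    qed
    also have "\<dots> \<le> (L2_norm \<Omega> f * L2_norm \<Omega> f) / p\<^sup>2"
      unfolding sum_divide_distrib[symmetric] using coef_product_sum_le[OF f(1) f(1)] by (intro divide_right_mono) auto
    finally show "(L2_norm \<Omega> (u N))\<^sup>2 \<le> (L2_norm \<Omega> f / p)\<^sup>2" by (simp add: power_divide power2_eq_square)
  qed (use p in \<open>simp add: L2_norm_nonneg\<close>)
  have Slim: "(\<lambda>N. L2_norm \<Omega> (\<lambda>x. S N x - f x)) \<longlonglongrightarrow> 0"
    using \<phi>_complete[OF f(1)] unfolding L2_sums_def L2_tendsto_def S_def by simp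
  \<comment> \<open>By \<open>Ieq\<close> this is the integral of w^2 exp(-1/w) over the set where w
    > 0, a degenerate measure of the negative part.\<close>
  define I where "I = (\<lambda>N. - L2_inner \<Omega> (u N) (Tu N))"
  \<comment> \<open>With L the elliptic operator, (L + p) u = S is tested with the truncation: the
    elliptic part has a sign by \<open>truncation_inequality\<close>, \<open>f\<close> is
    non-negative, and only S - f is left, which tends to 0.\<close>
  have Ibound: "I N \<le> L2_norm \<Omega> (\<lambda>x. S N x - f x) * (L2_norm \<Omega> f / p) / p" for N
  proof -
    have "L2_inner \<Omega> (\<lambda>x. \<Sum>k<N. coef f k / (\<mu> k + p) * \<mu> k * \<phi> k x) (Tu N) \<le> 0"
      unfolding Tu_def u_def by (rule truncation_inequality)
    also have "(\<lambda>x. \<Sum>k<N. coef f k / (\<mu> k + p) * \<mu> k * \<phi> k x) = (\<lambda>x. S N x - p * u N x)"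
    proof -
      have "coef f k / (\<mu> k + p) * \<mu> k = coef f k - p * (coef f k / (\<mu> k + p))" for k
        using mp[of k] by (simp add: field_simps)
      then show ?thesis by (simp add: S_def u_def left_diff_distrib sum_subtractf sum_distrib_left mult.assoc)
    qed
    also have "L2_inner \<Omega> (\<lambda>x. S N x - p * u N x) (Tu N) = L2_inner \<Omega> (S N) (Tu N) + p * I N"
      using SL2 uL2 TuL2 by (simp add: L2_inner_diff_left L2_scale L2_inner_scale_left I_def)
    finally have "p * I N \<le> - L2_inner \<Omega> (S N) (Tu N)" by simp
    also have "\<dots> = - L2_inner \<Omega> f (Tu N) - L2_inner \<Omega> (\<lambda>x. S N x - f x) (Tu N)"
      using SL2 TuL2 f by (simp add: L2_inner_diff_left)
    also have "\<dots> \<le> - L2_inner \<Omega> (\<lambda>x. S N x - f x) (Tu N)"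
      using L2_inner_nonneg_AE[OF f(2), of "Tu N"] by (simp add: Tu_def smooth_pos_nonneg)
    also have "\<dots> \<le> L2_norm \<Omega> (\<lambda>x. S N x - f x) * L2_norm \<Omega> (Tu N)"
      using L2_Cauchy_Schwarz[OF L2_diff[OF SL2 f(1)] TuL2] by (simp add: abs_le_iff)
    also have "\<dots> \<le> L2_norm \<Omega> (\<lambda>x. S N x - f x) * (L2_norm \<Omega> f / p)"
    proof (intro mult_left_mono L2_norm_nonneg)
      have "L2_norm \<Omega> (Tu N) \<le> L2_norm \<Omega> (u N)"
        using smooth_pos_le[of "- u N _"] smooth_pos_nonneg by (intro L2_norm_mono TuL2 uL2) (auto simp: Tu_def)
      then show "L2_norm \<Omega> (Tu N) \<le> L2_norm \<Omega> f / p" using unorm[of N] by simp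
    qed
    finally show ?thesis using p by (simp add: field_simps)
  qed
  have Ieq: "- (u N x * Tu N x) = (w N x)\<^sup>2 * flat 0 (w N x)" for N x
    by (auto simp: Tu_def w_def smooth_pos_def max_def flat_def power2_eq_square)
  have Ipos: "I N \<ge> 0" for N
  proof -
    have "I N = (LINT x|lebesgue_on \<Omega>. (w N x)\<^sup>2 * flat 0 (w N x))"
      unfolding I_def L2_inner_def Bochner_Integration.integral_minus[symmetric] Ieq ..
    then show ?thesis by (simp add: flat_0_bounds Bochner_Integration.integral_nonneg)
  qed
  have Ilim: "I \<longlonglongrightarrow> 0"
  proof (rule tendsto_sandwich[OF _ _ tendsto_const])
    show "(\<lambda>N. L2_norm \<Omega> (\<lambda>x. S N x - f x) * (L2_norm \<Omega> f / p) / p) \<longlonglongrightarrow> 0"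
      using tendsto_mult_left_zero[OF Slim, of "L2_norm \<Omega> f / p / p"] by simp
  qed (use Ipos Ibound in auto)
  \<comment> \<open>The weight exp(-1/w) degenerates as w tends to 0, so \<open>I\<close> does not
    bound the norm directly. Up to the level \<open>e\<close> the bound w \<le> e serves; above it
    the weight is at least exp(-1/e).\<close>
  have est: "(L2_norm \<Omega> (w N))\<^sup>2 \<le> e\<^sup>2 * measure lebesgue \<Omega> + exp (1 / e) * I N" if e: "e > 0" for e N
  proof -
    have pt: "w N x * w N x \<le> e\<^sup>2 * 1 + exp (1 / e) * (- (u N x * Tu N x))" for x
    proof (cases "w N x \<le> e")
      case True
      then have "(w N x)\<^sup>2 \<le> e\<^sup>2" by (intro power_mono) (auto simp: w_def)
      moreover have "0 \<le> exp (1 / e) * (- (u N x * Tu N x))"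
        unfolding Ieq by (simp add: flat_0_bounds)
      ultimately show ?thesis by (simp add: power2_eq_square)
    next
      case False
      then have "exp (- 1 / e) \<le> flat 0 (w N x)" using e by (simp add: flat_def frac_le)
      then have "exp (1 / e) * exp (- 1 / e) \<le> exp (1 / e) * flat 0 (w N x)" by (intro mult_left_mono) auto
      then have "1 \<le> exp (1 / e) * flat 0 (w N x)" by (simp flip: exp_add)
      then have "(w N x)\<^sup>2 * 1 \<le> (w N x)\<^sup>2 * (exp (1 / e) * flat 0 (w N x))" by (intro mult_left_mono) auto
      then have "(w N x)\<^sup>2 \<le> exp (1 / e) * (- (u N x * Tu N x))" unfolding Ieq by (simp add: mult_ac)
      then show ?thesis using zero_le_power2[of e] unfolding power2_eq_square by linarith
    qed
    have fin: "integrable (lebesgue_on \<Omega>) (\<lambda>x. e\<^sup>2 * 1 :: real)"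
      by (rule finite_measure.integrable_const[OF finite_measure_lebesgue_on[OF \<Omega>_lmeasurable]])
    have iu: "integrable (lebesgue_on \<Omega>) (\<lambda>x. u N x * Tu N x)" by (intro L2_mult_integrable uL2 TuL2)
    have "(L2_norm \<Omega> (w N))\<^sup>2 = (LINT x|lebesgue_on \<Omega>. w N x * w N x)"
      by (simp add: L2_norm_power2 L2_inner_def)
    also have "\<dots> \<le> (LINT x|lebesgue_on \<Omega>. e\<^sup>2 * 1 + exp (1 / e) * (- (u N x * Tu N x)))"
      using fin iu pt by (intro integral_mono L2_mult_integrable[OF wL2 wL2] Bochner_Integration.integrable_add) auto
    also have "\<dots> = (LINT x|lebesgue_on \<Omega>. e\<^sup>2 * 1) + (LINT x|lebesgue_on \<Omega>. exp (1 / e) * (- (u N x * Tu N x)))"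
      using fin iu by (intro Bochner_Integration.integral_add) auto
    also have "\<dots> = e\<^sup>2 * measure lebesgue \<Omega> + exp (1 / e) * I N"
      using \<Omega>_sets by (simp add: I_def L2_inner_def measure_restrict_space space_restrict_space)
    finally show ?thesis .
  qed
  have "(\<lambda>N. (L2_norm \<Omega> (w N))\<^sup>2) \<longlonglongrightarrow> 0"
  proof (rule order_tendstoI)
    fix r :: real assume "r < 0"
    then show "eventually (\<lambda>N. r < (L2_norm \<Omega> (w N))\<^sup>2) sequentially" by (intro always_eventually) (auto intro: less_le_trans)
  next
    fix r :: real assume r: "0 < r"
    \<comment> \<open>Makes the first term of \<open>est\<close> at most r/2; the 1 added to the
      measure keeps the denominator positive.\<close>
    define e where "e = sqrt (r / (2 * (measure lebesgue \<Omega> + 1)))"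
    have m1: "measure lebesgue \<Omega> + 1 > 0" by (simp add: add_nonneg_pos)
    have e: "e > 0" "e\<^sup>2 = r / (2 * (measure lebesgue \<Omega> + 1))" using r m1 by (auto simp: e_def)
    have "e\<^sup>2 * measure lebesgue \<Omega> \<le> e\<^sup>2 * (measure lebesgue \<Omega> + 1)" by (intro mult_left_mono) auto
    also have "\<dots> = r / 2"
    proof -
      have "r / (2 * K) * K = r / 2" if "K > 0" for K :: real using that by simp
      from this[OF m1] show ?thesis unfolding e(2) .
    qed
    finally have e2: "e\<^sup>2 * measure lebesgue \<Omega> \<le> r / 2" .
    have "(\<lambda>N. exp (1 / e) * I N) \<longlonglongrightarrow> 0" by (intro tendsto_mult_right_zero Ilim)
    then have "eventually (\<lambda>N. exp (1 / e) * I N < r / 2) sequentially" by (rule order_tendstoD(2)) (use r in simp)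
    then show "eventually (\<lambda>N. (L2_norm \<Omega> (w N))\<^sup>2 < r) sequentially"
    proof eventually_elim
      case (elim N)
      then show ?case using est[OF e(1), of N] e2 by linarith
    qed
  qed
  then have "(\<lambda>N. sqrt ((L2_norm \<Omega> (w N))\<^sup>2)) \<longlonglongrightarrow> sqrt 0" by (rule tendsto_real_sqrt)
  then show ?thesis by (simp add: L2_norm_nonneg w_def)
qed

text \<open>Induction on \<open>l\<close> peels one resolvent off \<open>f\<close>. The partial sum
  \<open>u N\<close> of its expansion is split as \<open>v N - w N\<close>: the induction hypothesis
  applies to the non-negative \<open>v N\<close>, and \<open>w N\<close> tends to 0 by
  \<open>resolvent_negative_part\<close>.\<close>

lemma resolvent_power_nonneg:
  assumes "f \<in> L2 \<Omega>" "AE x in lebesgue_on \<Omega>. f x \<ge> 0" "g \<in> L2 \<Omega>" "AE x in lebesgue_on \<Omega>. g x \<ge> 0" "p > 0"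
  shows "(\<Sum>n. 1 / (p + \<mu> n) ^ l * (coef f n * coef g n)) \<ge> 0"
  using assms(1,2)
proof (induction l arbitrary: f)
  case 0
  then show ?case using Parseval[OF 0(1) assms(3)] L2_inner_nonneg_AE[OF 0(2) assms(4)] by (simp add: sums_iff)
next
  case (Suc l)
  define u where "u = (\<lambda>N x. \<Sum>k<N. coef f k / (\<mu> k + p) * \<phi> k x)"
  define w where "w = (\<lambda>N x. max 0 (- u N x))"
  define v where "v = (\<lambda>N x. max 0 (u N x))"
  have uL2: "u N \<in> L2 \<Omega>" for N unfolding u_def by (intro L2_sum L2_scale \<phi>_L2)
  have um: "u N \<in> borel_measurable (lebesgue_on \<Omega>)" for N using uL2 by (rule L2_measurable)
  have wL2: "w N \<in> L2 \<Omega>" and vL2: "v N \<in> L2 \<Omega>" for N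
    unfolding w_def v_def using um by (auto intro!: L2_dominated[OF uL2[of N]]) 
  have pm: "0 < p + \<mu> n" "p \<le> p + \<mu> n" for n using \<mu>_pos[of n] assms(5) by auto
  have bd: "\<bar>1 / (p + \<mu> n) ^ l\<bar> \<le> 1 / p ^ l" for l n
    using pm[of n] assms(5) by (simp add: frac_le power_mono)
  define \<rho> where "\<rho> = (\<lambda>n. 1 / (p + \<mu> n) ^ l)"
  have bd': "\<bar>\<rho> n\<bar> \<le> 1 / p ^ l" for n unfolding \<rho>_def by (rule bd)
  have cu: "coef (u N) n = coef (v N) n - coef (w N) n" for N n
  proof -
    have "u N = (\<lambda>x. v N x - w N x)" by (auto simp: v_def w_def max_def)
    then show ?thesis using L2_inner_diff_left[OF vL2 wL2 \<phi>_L2, of N N n] by simp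
  qed
  have cuf: "coef (u N) n = (if n < N then coef f n / (\<mu> n + p) else 0)" for N n
    unfolding u_def by (rule coef_finite_sum)
  \<comment> \<open>The coefficients of \<open>u N\<close> vanish from \<open>N\<close> on, so the
    N-th partial sum for the exponent \<open>Suc l\<close> at \<open>f\<close> is the full series
    for the exponent \<open>l\<close> at \<open>u N\<close>.\<close>
  have partial: "(\<Sum>n<N. 1 / (p + \<mu> n) ^ Suc l * (coef f n * coef g n)) \<ge> - (1 / p ^ l * (L2_norm \<Omega> (w N) * L2_norm \<Omega> g))" for N
  proof -
    have "(\<Sum>n<N. 1 / (p + \<mu> n) ^ Suc l * (coef f n * coef g n)) = (\<Sum>n<N. \<rho> n * (coef (u N) n * coef g n))"
      unfolding cuf \<rho>_def by (intro sum.cong refl) (simp add: add.commute)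
    also have "\<dots> = (\<Sum>n. \<rho> n * (coef (u N) n * coef g n))"
      by (rule suminf_finite[symmetric]) (auto simp: cuf)
    also have "\<dots> = (\<Sum>n. \<rho> n * (coef (v N) n * coef g n) - \<rho> n * (coef (w N) n * coef g n))"
      by (simp add: cu algebra_simps)
    also have "\<dots> = (\<Sum>n. \<rho> n * (coef (v N) n * coef g n)) - (\<Sum>n. \<rho> n * (coef (w N) n * coef g n))"
      by (intro suminf_diff[symmetric] summable_rabs_cancel[OF summable_multiplier[OF _ assms(3) bd']] vL2 wL2)
    also have "(\<Sum>n. \<rho> n * (coef (v N) n * coef g n)) \<ge> 0"
      unfolding \<rho>_def by (rule Suc.IH[OF vL2]) (simp add: v_def)
    then have "(\<Sum>n. \<rho> n * (coef (v N) n * coef g n)) - (\<Sum>n. \<rho> n * (coef (w N) n * coef g n)) \<ge>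
        - (1 / p ^ l * (L2_norm \<Omega> (w N) * L2_norm \<Omega> g))"
      using multiplier_bound[where \<rho> = \<rho>, OF wL2[of N] assms(3) bd'] by linarith
    finally show ?thesis .
  qed
  have "(\<lambda>N. - (1 / p ^ l * (L2_norm \<Omega> (w N) * L2_norm \<Omega> g))) \<longlonglongrightarrow> - (1 / p ^ l * (0 * L2_norm \<Omega> g))"
    unfolding w_def u_def by (intro tendsto_intros resolvent_negative_part[OF Suc.prems assms(5)])
  moreover have "(\<lambda>N. \<Sum>n<N. 1 / (p + \<mu> n) ^ Suc l * (coef f n * coef g n)) \<longlonglongrightarrow> (\<Sum>n. 1 / (p + \<mu> n) ^ Suc l * (coef f n * coef g n))"
    by (rule summable_LIMSEQ[OF summable_rabs_cancel[OF summable_multiplier[OF Suc.prems(1) assms(3) bd]]])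
  ultimately show ?case using partial by (intro LIMSEQ_le[of "\<lambda>N. - (1 / p ^ l * (L2_norm \<Omega> (w N) * L2_norm \<Omega> g))" 0]) auto
qed

lemma
  assumes "resolvent_sum_limit \<rho>" "f \<in> L2 \<Omega>" "g \<in> L2 \<Omega>"
  shows resolvent_sum_limit_summable: "summable (\<lambda>n. \<bar>\<rho> (\<mu> n) * (coef f n * coef g n)\<bar>)"
    and resolvent_sum_limit_bound: "\<bar>\<Sum>n. \<rho> (\<mu> n) * (coef f n * coef g n)\<bar> \<le> \<rho> 0 * (L2_norm \<Omega> f * L2_norm \<Omega> g)"
proof -
  have "\<bar>\<rho> (\<mu> n)\<bar> \<le> \<rho> 0" for n
    using resolvent_sum_limit_nonneg[OF assms(1), of "\<mu> n"] resolvent_sum_limit_antimono[OF assms(1), of "\<mu> n"] \<mu>_pos[of n] by simp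
  from summable_multiplier[OF assms(2,3) this] multiplier_bound[OF assms(2,3) this]
  show "summable (\<lambda>n. \<bar>\<rho> (\<mu> n) * (coef f n * coef g n)\<bar>)"
    "\<bar>\<Sum>n. \<rho> (\<mu> n) * (coef f n * coef g n)\<bar> \<le> \<rho> 0 * (L2_norm \<Omega> f * L2_norm \<Omega> g)" .
qed

text \<open>For each approximant the series is a non-negative combination of those in
  \<open>resolvent_power_nonneg\<close>. The approximants decrease in \<nu> and converge at 0, so
  the values \<open>D n 0\<close> bound all of them uniformly, and Tannery's theorem passes to the
  limit.\<close>

lemma positive_multiplier:
  assumes \<rho>: "resolvent_sum_limit \<rho>"
    and f: "f \<in> L2 \<Omega>" "AE x in lebesgue_on \<Omega>. f x \<ge> 0" and g: "g \<in> L2 \<Omega>" "AE x in lebesgue_on \<Omega>. g x \<ge> 0"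
  shows "(\<Sum>n. \<rho> (\<mu> n) * (coef f n * coef g n)) \<ge> 0"
proof -
  obtain p c where pc: "\<forall>n. p n > 0" "\<forall>n l. c n l \<ge> (0::real)"
    "\<forall>\<nu>\<ge>0. (\<lambda>n. \<Sum>l\<le>n. c n l / (p n + \<nu>) ^ (l + 1)) \<longlonglongrightarrow> \<rho> \<nu>"
    using \<rho> unfolding resolvent_sum_limit_def by (elim exE conjE)
  define D where "D = (\<lambda>n \<nu>. \<Sum>l\<le>n. c n l / (p n + \<nu>) ^ (l + 1))"
  have Dlim: "(\<lambda>n. D n \<nu>) \<longlonglongrightarrow> \<rho> \<nu>" if "\<nu> \<ge> 0" for \<nu> using pc(3) that unfolding D_def by blast
  have "Bseq (\<lambda>n. D n 0)" using Dlim[of 0] by (intro convergent_imp_Bseq convergentI) auto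
  then obtain B where B: "\<And>n. \<bar>D n 0\<bar> \<le> B" by (auto simp: Bseq_def)
  have Dbd: "\<bar>D n (\<mu> k)\<bar> \<le> B" for n k
  proof -
    have "0 \<le> D n (\<mu> k)" "D n (\<mu> k) \<le> D n 0"
      unfolding D_def
      using resolvent_sum_nonneg[OF pc(1)[rule_format, of n] pc(2)[rule_format, of n], where \<nu> = "\<mu> k" and n = n]
        resolvent_sum_antimono[OF pc(1)[rule_format, of n] pc(2)[rule_format, of n], where \<nu> = "\<mu> k" and n = n] \<mu>_pos[of k] by auto
    with B[of n] show ?thesis by linarith
  qed
  have nonneg: "(\<Sum>k. D n (\<mu> k) * (coef f k * coef g k)) \<ge> 0" for n
  proof -
    have pm: "\<bar>1 / (p n + \<mu> k) ^ l\<bar> \<le> 1 / p n ^ l" for l k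
      using \<mu>_pos[of k] pc(1) by (simp add: frac_le power_mono less_imp_le add_pos_pos)
    have s: "(\<lambda>k. c n l * (1 / (p n + \<mu> k) ^ (l + 1) * (coef f k * coef g k))) sums
        (c n l * (\<Sum>k. 1 / (p n + \<mu> k) ^ (l + 1) * (coef f k * coef g k)))" for l
      by (intro sums_mult summable_sums summable_rabs_cancel[OF summable_multiplier[OF f(1) g(1) pm]])
    have "(\<lambda>k. \<Sum>l\<le>n. c n l * (1 / (p n + \<mu> k) ^ (l + 1) * (coef f k * coef g k))) sums
       (\<Sum>l\<le>n. c n l * (\<Sum>k. 1 / (p n + \<mu> k) ^ (l + 1) * (coef f k * coef g k)))"
      by (intro sums_sum s)
    moreover have "(\<lambda>k. \<Sum>l\<le>n. c n l * (1 / (p n + \<mu> k) ^ (l + 1) * (coef f k * coef g k))) =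
       (\<lambda>k. D n (\<mu> k) * (coef f k * coef g k))"
      by (simp add: D_def sum_distrib_right)
    ultimately have "(\<Sum>k. D n (\<mu> k) * (coef f k * coef g k)) =
       (\<Sum>l\<le>n. c n l * (\<Sum>k. 1 / (p n + \<mu> k) ^ (l + 1) * (coef f k * coef g k)))"
      by (simp add: sums_iff)
    also have "\<dots> \<ge> 0"
      using pc(1,2) by (intro sum_nonneg mult_nonneg_nonneg resolvent_power_nonneg f g) auto
    finally show ?thesis .
  qed
  define M where "M = (\<lambda>k. \<bar>B * (coef f k * coef g k)\<bar>)"
  have M: "summable M" unfolding M_def by (rule summable_multiplier[OF f(1) g(1) order.refl])
  have "((\<lambda>n. suminf (\<lambda>k. D n (\<mu> k) * (coef f k * coef g k))) \<longlongrightarrow> suminf (\<lambda>k. \<rho> (\<mu> k) * (coef f k * coef g k))) sequentially"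
  proof (rule conjunct2[OF conjunct2[OF tannerys_theorem[OF _ _ M]]])
    show "((\<lambda>n. D n (\<mu> k) * (coef f k * coef g k)) \<longlongrightarrow> \<rho> (\<mu> k) * (coef f k * coef g k)) sequentially" for k
      using \<mu>_pos[of k] by (intro tendsto_intros Dlim) auto
    have "norm (D n (\<mu> k) * (coef f k * coef g k)) \<le> M k" for n k
    proof -
      have "\<bar>D n (\<mu> k)\<bar> \<le> \<bar>B\<bar>" using Dbd[of n k] by linarith
      then show ?thesis unfolding M_def real_norm_def abs_mult[of "D n (\<mu> k)"] abs_mult[of B] by (intro mult_right_mono) auto
    qed
    then show "\<forall>\<^sub>F (k, n) in at_top \<times>\<^sub>F sequentially. norm (D n (\<mu> k) * (coef f k * coef g k)) \<le> M k"
      by (intro always_eventually) auto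
  qed auto
  then show ?thesis by (rule LIMSEQ_le_const) (use nonneg in auto)
qed

end

section \<open>Positivity of the solution\<close>


lemma AE_lebesgue_on_iff:
  "S \<in> sets lebesgue \<Longrightarrow> (AE x in lebesgue_on S. P x) \<longleftrightarrow> (AE x in lborel. x \<in> S \<longrightarrow> P x)"
  by (simp add: AE_restrict_space_iff AE_completion_iff)

text \<open>The exceptional set lies in a Borel null set, to which Fubini's theorem applies whether
  or not \<open>P\<close> is measurable. The sections fix the second coordinate, hence the exchange
  by \<open>AE_commute\<close>.\<close>

lemma AE_lborel_sections:
  fixes P :: "'a::euclidean_space \<times> 'b::euclidean_space \<Rightarrow> bool"
  assumes "AE z in lborel. P z" shows "AE t in lborel. AE x in lborel. P (x, t)"
proof -
  obtain N where N: "N \<in> null_sets (lborel :: ('a \<times> 'b) measure)" "{z. \<not> P z} \<subseteq> N"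
    using assms unfolding eventually_ae_filter by auto
  then have Ns: "N \<in> sets (lborel \<Otimes>\<^sub>M lborel)" unfolding lborel_prod by auto
  have m: "{z \<in> space (lborel \<Otimes>\<^sub>M lborel). z \<notin> N} \<in> sets (lborel \<Otimes>\<^sub>M lborel)"
    using sets.compl_sets[OF Ns] by (simp add: set_diff_eq)
  have "AE z in lborel. z \<notin> N" using N(1) by (rule AE_not_in)
  then have "AE z in lborel \<Otimes>\<^sub>M lborel. z \<notin> N" unfolding lborel_prod .
  from lborel_pair.AE_pair[OF this] have "AE x in lborel. AE t in lborel. (x, t) \<notin> N" .
  then have "AE t in lborel. AE x in lborel. (x, t) \<notin> N"
    using m by (subst (asm) lborel_pair.AE_commute) auto
  then show ?thesis by eventually_elim (use N(2) in \<open>auto elim: eventually_mono\<close>)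
qed

text \<open>Measurability splits \<open>B\<close> into a Borel set, for which Fubini's theorem turns
  null sections into a null set, and a subset of a null set.\<close>

lemma AE_lborel_of_sections:
  fixes B :: "('a::euclidean_space \<times> 'b::euclidean_space) set"
  assumes "B \<in> sets lebesgue" "\<And>t. AE x in lborel. (x, t) \<notin> B" shows "AE z in lborel. z \<notin> B"
proof -
  obtain S N N' where B: "B = S \<union> N" "N \<subseteq> N'" "N' \<in> null_sets lborel" "S \<in> sets lborel"
    using assms(1) by (rule sets_completionE)
  then have Ss: "S \<in> sets (lborel \<Otimes>\<^sub>M lborel)" unfolding lborel_prod by auto
  have m: "{z \<in> space (lborel \<Otimes>\<^sub>M lborel). z \<notin> S} \<in> sets (lborel \<Otimes>\<^sub>M lborel)"
    using sets.compl_sets[OF Ss] by (simp add: set_diff_eq)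
  have "AE t in lborel. AE x in lborel. (x, t) \<notin> S"
  proof (rule AE_I2)
    fix t show "AE x in lborel. (x, t) \<notin> S" using assms(2)[of t] by eventually_elim (use B in auto)
  qed
  then have "AE x in lborel. AE t in lborel. (x, t) \<notin> S"
    using m by (subst lborel_pair.AE_commute) auto
  then have "AE z in lborel \<Otimes>\<^sub>M lborel. z \<notin> S" using m by (intro lborel_pair.AE_pair_measure) auto
  then have "AE z in lborel. z \<notin> S" unfolding lborel_prod .
  moreover have "AE z in lborel. z \<notin> N'" using B(3) by (rule AE_not_in)
  ultimately show ?thesis by eventually_elim (use B in auto)
qed

lemma AE_reflect:
  assumes "AE \<tau> in lborel. P (\<tau>::real)" shows "AE s in lborel. P (t - s)"
proof -
  obtain N where N: "N \<in> null_sets (lborel :: real measure)" "{\<tau>. \<not> P \<tau>} \<subseteq> N"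
    using assms unfolding eventually_ae_filter by auto
  have "N \<in> sets borel" using N(1) by auto
  then have "Measurable.pred borel (\<lambda>\<tau>. \<tau> \<notin> N)" by measurable
  then have "AE s in lborel. t + (-1) * s \<notin> N"
    by (intro AE_borel_affine AE_not_in N(1)) auto
  then show ?thesis by eventually_elim (use N(2) in auto)
qed

context elliptic_problem
begin

lemma L2_sums_multiplier_inner:
  assumes v: "L2_sums \<Omega> (\<lambda>n x. r n * coef a n * \<phi> n x) v" and g: "g \<in> L2 \<Omega>"
  shows "(\<lambda>n. r n * (coef a n * coef g n)) sums L2_inner \<Omega> v g"
proof -
  have "(\<lambda>N. L2_inner \<Omega> (\<lambda>x. \<Sum>n<N. r n * coef a n * \<phi> n x) g) \<longlonglongrightarrow> L2_inner \<Omega> v g"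
    using v g unfolding L2_sums_def by (intro L2_tendsto_inner L2_tendsto_const)
  moreover have "L2_inner \<Omega> (\<lambda>x. \<Sum>n<N. r n * coef a n * \<phi> n x) g = (\<Sum>n<N. r n * (coef a n * coef g n))" for N
    using g by (simp add: L2_inner_sum_left L2_scale \<phi>_L2 L2_inner_scale_left L2_inner_commute[of \<Omega> g] mult.assoc)
  ultimately show ?thesis by (simp add: sums_def)
qed

lemma multiplier_nonneg:
  assumes "resolvent_sum_limit \<rho>" "a \<in> L2 \<Omega>" "AE x in lebesgue_on \<Omega>. a x \<ge> 0"
    "L2_sums \<Omega> (\<lambda>n x. \<rho> (\<mu> n) * coef a n * \<phi> n x) v"
    "g \<in> L2 \<Omega>" "AE x in lebesgue_on \<Omega>. g x \<ge> 0"
  shows "L2_inner \<Omega> v g \<ge> 0"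
  using positive_multiplier[OF assms(1,2,3,5,6)] L2_sums_multiplier_inner[OF assms(4,5)] by (simp add: sums_iff)

text \<open>The bilinear form of \<rho>(L), with L the elliptic operator. It is defined by its
  series because \<rho>(L) f is not constructed as a function.\<close>

definition multiplier_form :: "(real \<Rightarrow> real) \<Rightarrow> (real^'n \<Rightarrow> real) \<Rightarrow> (real^'n \<Rightarrow> real) \<Rightarrow> real" where
  "multiplier_form \<rho> f g = (\<Sum>n. \<rho> (\<mu> n) * (coef f n * coef g n))"

lemma multiplier_form_diff:
  assumes "resolvent_sum_limit \<rho>" "f \<in> L2 \<Omega>" "g \<in> L2 \<Omega>" "h \<in> L2 \<Omega>"
  shows "multiplier_form \<rho> (\<lambda>x. f x - g x) h = multiplier_form \<rho> f h - multiplier_form \<rho> g h"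
proof -
  have "multiplier_form \<rho> (\<lambda>x. f x - g x) h = (\<Sum>n. \<rho> (\<mu> n) * (coef f n * coef h n) - \<rho> (\<mu> n) * (coef g n * coef h n))"
    unfolding multiplier_form_def using assms by (simp add: L2_inner_diff_left \<phi>_L2 algebra_simps)
  also have "\<dots> = multiplier_form \<rho> f h - multiplier_form \<rho> g h"
    unfolding multiplier_form_def
    by (intro suminf_diff[symmetric] summable_rabs_cancel[OF resolvent_sum_limit_summable[OF assms(1)]] assms)
  finally show ?thesis .
qed

lemma multiplier_form_scale:
  assumes "resolvent_sum_limit \<rho>" "f \<in> L2 \<Omega>" "h \<in> L2 \<Omega>"
  shows "multiplier_form \<rho> (\<lambda>x. k * f x) h = k * multiplier_form \<rho> f h"
  unfolding multiplier_form_def L2_inner_scale_left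
  using suminf_mult[OF summable_rabs_cancel[OF resolvent_sum_limit_summable[OF assms]], of k]
  by (simp add: mult_ac)

text \<open>If the non-negative function \<open>v\<close> vanished on a set with indicator \<open>\<eta>\<close>, then the positive form
  would vanish at \<open>(a, \<eta>)\<close>, hence at \<open>(f, \<eta>)\<close> for every \<open>0 \<le> f \<le> k a\<close>; as \<open>a > 0\<close>, such \<open>f\<close>
  approximate \<open>\<eta>\<close>, and the form is strictly positive at \<open>(\<eta>, \<eta>)\<close> unless \<open>\<eta> = 0\<close>.\<close>

lemma multiplier_strictly_positive:
  assumes \<rho>: "resolvent_sum_limit \<rho>" "\<And>n. \<rho> (\<mu> n) > 0"
    and a: "a \<in> L2 \<Omega>" "AE x in lebesgue_on \<Omega>. a x > 0"
    and v: "L2_sums \<Omega> (\<lambda>n x. \<rho> (\<mu> n) * coef a n * \<phi> n x) v"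
  shows "AE x in lebesgue_on \<Omega>. v x > 0"
proof -
  have a0: "AE x in lebesgue_on \<Omega>. a x \<ge> 0" using a(2) by eventually_elim simp
  have vL2: "v \<in> L2 \<Omega>" using v by (auto simp: L2_sums_def L2_tendsto_def)
  have vm: "v \<in> borel_measurable (lebesgue_on \<Omega>)" using vL2 by (rule L2_measurable)
  have v0: "AE x in lebesgue_on \<Omega>. v x \<ge> 0"
    by (rule nonneg_AE_of_inner_nonneg[OF vL2 \<Omega>_lmeasurable]) (auto intro: multiplier_nonneg[OF \<rho>(1) a(1) a0 v])
  define \<eta> :: "real^'n \<Rightarrow> real" where "\<eta> = (\<lambda>x. if v x = 0 then 1 else 0)"
  have \<eta>m: "\<eta> \<in> borel_measurable (lebesgue_on \<Omega>)" unfolding \<eta>_def using vm by measurable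
  have \<eta>: "\<eta> \<in> L2 \<Omega>" by (rule L2_bounded[OF \<eta>m _ \<Omega>_lmeasurable, of 1]) (auto simp: \<eta>_def)
  have \<eta>0: "AE x in lebesgue_on \<Omega>. \<eta> x \<ge> 0" by (auto simp: \<eta>_def)
  let ?b = "multiplier_form \<rho>"
  have b_nonneg: "?b f g \<ge> 0" if "f \<in> L2 \<Omega>" "AE x in lebesgue_on \<Omega>. f x \<ge> 0" "g \<in> L2 \<Omega>" "AE x in lebesgue_on \<Omega>. g x \<ge> 0" for f g
    unfolding multiplier_form_def by (rule positive_multiplier[OF \<rho>(1) that])
  \<comment> \<open>The function \<open>v\<close> represents the form at \<open>a\<close>, and
    \<open>v\<close> and \<eta> are never non-zero at the same point.\<close>
  have ba: "?b a \<eta> = 0"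
  proof -
    have "(\<lambda>x. v x * \<eta> x) = (\<lambda>_. 0)" by (auto simp: \<eta>_def)
    then have "L2_inner \<Omega> v \<eta> = 0" by (simp add: L2_inner_def)
    then show ?thesis using L2_sums_multiplier_inner[OF v \<eta>] by (simp add: multiplier_form_def sums_iff)
  qed
  \<comment> \<open>\<eta> - \<open>h k\<close> is the minimum of \<eta> and k a, so it lies below a
    multiple of \<open>a\<close>; \<open>h k\<close> is the part of \<eta> still to be
    reached.\<close>
  define h where "h = (\<lambda>(k::nat) x. max 0 (\<eta> x - real k * a x))"
  have dL2: "(\<lambda>x. \<eta> x - real k * a x) \<in> L2 \<Omega>" for k by (intro L2_diff L2_scale \<eta> a)
  have hL2: "h k \<in> L2 \<Omega>" for k
  proof (rule L2_dominated[OF dL2[of k]])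
    show "h k \<in> borel_measurable (lebesgue_on \<Omega>)" unfolding h_def using L2_measurable[OF dL2[of k]] by measurable
  qed (auto simp: h_def)
  have b\<eta>: "?b \<eta> \<eta> \<le> ?b (h k) \<eta>" for k
  proof -
    have "?b (\<lambda>x. real k * a x - (\<eta> x - h k x)) \<eta> \<ge> 0"
      by (intro b_nonneg L2_diff L2_scale a \<eta> hL2 \<eta>0) (auto simp: h_def)
    also have "?b (\<lambda>x. real k * a x - (\<eta> x - h k x)) \<eta> = real k * ?b a \<eta> - (?b \<eta> \<eta> - ?b (h k) \<eta>)"
      by (simp only: multiplier_form_diff[OF \<rho>(1)] multiplier_form_scale[OF \<rho>(1)] L2_diff L2_scale a(1) \<eta> hL2)
    finally show ?thesis by (simp add: ba)
  qed
  have hlim: "(\<lambda>k. L2_inner \<Omega> (h k) (h k)) \<longlonglongrightarrow> 0"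
  proof -
    have "(\<lambda>k. LINT x|lebesgue_on \<Omega>. h k x * h k x) \<longlonglongrightarrow> (LINT x|lebesgue_on \<Omega>. 0)"
    proof (rule integral_dominated_convergence)
      show "integrable (lebesgue_on \<Omega>) (\<lambda>x. \<eta> x * \<eta> x)" by (rule L2_mult_integrable[OF \<eta> \<eta>])
      show "(\<lambda>x. h k x * h k x) \<in> borel_measurable (lebesgue_on \<Omega>)" for k
        using L2_mult_integrable[OF hL2 hL2] by auto
      show "AE x in lebesgue_on \<Omega>. (\<lambda>k. h k x * h k x) \<longlonglongrightarrow> 0"
        using a(2)
      proof eventually_elim
        case (elim x)
        \<comment> \<open>Once k a(x) exceeds 1, an upper bound of \<eta>, the function
          \<open>h k\<close> vanishes at \<open>x\<close>.\<close>
        obtain K :: nat where K: "1 < real K * a x" using reals_Archimedean3[OF elim] by blast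
        have "eventually (\<lambda>k. h k x * h k x = 0) sequentially"
          using eventually_ge_at_top[of K]
        proof eventually_elim
          case (elim k)
          have "real K * a x \<le> real k * a x" using elim \<open>a x > 0\<close> by (intro mult_right_mono) auto
          with K have "\<eta> x - real k * a x \<le> 0" by (auto simp: \<eta>_def)
          then show ?case by (simp add: h_def)
        qed
        then show ?case by (rule tendsto_eventually)
      qed
      show "AE x in lebesgue_on \<Omega>. norm (h k x * h k x) \<le> \<eta> x * \<eta> x" for k
        using a(2)
      proof eventually_elim
        case (elim x)
        then have "0 \<le> real k * a x" by simp
        then have "0 \<le> h k x" "h k x \<le> \<eta> x" by (auto simp: h_def \<eta>_def)
        then show ?case by (simp add: mult_mono)
      qed
    qed auto
    then show ?thesis by (simp add: L2_inner_def)
  qed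
  have "(\<lambda>k. \<rho> 0 * (L2_norm \<Omega> (h k) * L2_norm \<Omega> \<eta>)) \<longlonglongrightarrow> \<rho> 0 * (sqrt 0 * L2_norm \<Omega> \<eta>)"
    unfolding L2_norm_def[of \<Omega> "h _"] by (intro tendsto_intros hlim)
  moreover have "?b \<eta> \<eta> \<le> \<rho> 0 * (L2_norm \<Omega> (h k) * L2_norm \<Omega> \<eta>)" for k
    using b\<eta>[of k] resolvent_sum_limit_bound[OF \<rho>(1) hL2[of k] \<eta>] by (simp add: multiplier_form_def abs_le_iff)
  ultimately have "?b \<eta> \<eta> \<le> \<rho> 0 * (sqrt 0 * L2_norm \<Omega> \<eta>)"
    by (intro LIMSEQ_le_const) auto
  then have b0: "?b \<eta> \<eta> \<le> 0" by simp
  have nn: "\<rho> (\<mu> n) * (coef \<eta> n * coef \<eta> n) \<ge> 0" for n using \<rho>(2)[of n] by simp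
  have sm: "summable (\<lambda>n. \<rho> (\<mu> n) * (coef \<eta> n * coef \<eta> n))"
    by (rule summable_rabs_cancel[OF resolvent_sum_limit_summable[OF \<rho>(1) \<eta> \<eta>]])
  have "?b \<eta> \<eta> = 0" using b0 suminf_nonneg[OF sm nn] by (simp add: multiplier_form_def)
  then have "\<rho> (\<mu> n) * (coef \<eta> n * coef \<eta> n) = 0" for n
    using suminf_eq_zero_iff[OF sm nn] by (simp add: multiplier_form_def)
  then have "coef \<eta> n = 0" for n using \<rho>(2)[of n] by (metis mult_eq_0_iff less_irrefl)
  then have "L2_inner \<Omega> \<eta> \<eta> = 0" using Parseval[OF \<eta> \<eta>] by (simp add: sums_iff)
  from L2_norm_zero_AE[OF \<eta> this] v0 show ?thesis
    by eventually_elim (auto simp: \<eta>_def split: if_splits)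
qed

end

locale fractional_diffusion = elliptic_problem \<Omega> A c \<mu> \<phi> + multi_term m \<alpha> q
  for \<Omega> :: "(real^'n::finite) set" and A c \<mu> \<phi> m \<alpha> q
begin

lemma homogeneous_solution_pos:
  assumes "homogeneous_solution \<Omega> m \<alpha> q \<mu> \<phi> a v" "a \<in> L2 \<Omega>" "AE x in lebesgue_on \<Omega>. a x > 0" "t > 0"
  shows "AE x in lebesgue_on \<Omega>. v x t > 0"
proof -
  define e where "e = (\<lambda>\<nu>. 1 - \<nu> * t powr \<alpha> 1 * mode_ML m \<alpha> q \<nu> (1 + \<alpha> 1) t)"
  have "L2_sums \<Omega> (\<lambda>n x. e (\<mu> n) * coef a n * \<phi> n x) (\<lambda>x. v x t)"
    using assms(1,4) unfolding homogeneous_solution_def e_def by blast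
  moreover have "e (\<mu> n) > 0" for n
    unfolding e_def using \<mu>_pos[of n] by (intro initial_multiplier_pos[OF assms(4)]) auto
  ultimately show ?thesis
    using multiplier_strictly_positive[OF resolvent_sum_limit_initial[OF assms(4), folded e_def] _ assms(2,3)]
    by blast
qed

lemma source_solution_nonneg:
  assumes w: "source_solution \<Omega> m \<alpha> q \<mu> \<phi> F w" and t: "t > 0"
    and F: "AE \<tau> in lborel. \<tau> > 0 \<longrightarrow> (\<lambda>x. F x \<tau>) \<in> L2 \<Omega> \<and> (AE x in lebesgue_on \<Omega>. F x \<tau> \<ge> 0)"
  shows "AE x in lebesgue_on \<Omega>. w x t \<ge> 0"
proof -
  define \<rho> where "\<rho> = (\<lambda>s \<nu>. s powr (\<alpha> 1 - 1) * mode_ML m \<alpha> q \<nu> (\<alpha> 1) s)"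
  obtain g where g: "AE s in lebesgue_on {0<..<t}. L2_sums \<Omega>
       (\<lambda>n x. \<rho> s (\<mu> n) * coef (\<lambda>y. F y (t - s)) n * \<phi> n x) (g s)"
    and gi: "has_L2_integral \<Omega> g {0<..<t} (\<lambda>x. w x t)"
    using w t unfolding source_solution_def \<rho>_def by blast
  have wL2: "(\<lambda>x. w x t) \<in> L2 \<Omega>" using gi by (auto simp: has_L2_integral_def)
  \<comment> \<open>The exceptional times of \<open>F\<close> form a null set, which stays null
    under s -> t - s.\<close>
  have Fs: "AE s in lebesgue_on {0<..<t}. (\<lambda>x. F x (t - s)) \<in> L2 \<Omega> \<and> (AE x in lebesgue_on \<Omega>. F x (t - s) \<ge> 0)"
    using AE_reflect[OF F, of t] by (subst AE_lebesgue_on_iff) (auto elim: eventually_mono)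
  have sin: "AE s in lebesgue_on {0<..<t}. s \<in> {0<..<t}"
    by (rule AE_I2) (simp add: space_restrict_space)
  show ?thesis
  proof (rule nonneg_AE_of_inner_nonneg[OF wL2 \<Omega>_lmeasurable])
    fix \<psi> assume \<psi>: "\<psi> \<in> L2 \<Omega>" "\<And>x. \<psi> x \<ge> (0::real)"
    have "AE s in lebesgue_on {0<..<t}. L2_inner \<Omega> (g s) \<psi> \<ge> 0"
      using g Fs sin
    proof eventually_elim
      case (elim s)
      then have "resolvent_sum_limit (\<rho> s)" unfolding \<rho>_def by (intro resolvent_sum_limit_source) auto
      then show ?case using elim \<psi> by (intro multiplier_nonneg[of "\<rho> s" "\<lambda>x. F x (t - s)"]) auto
    qed
    then have "0 \<le> (LINT s|lebesgue_on {0<..<t}. L2_inner \<Omega> (g s) \<psi>)" by (rule integral_nonneg_AE)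
    also have "\<dots> = L2_inner \<Omega> (\<lambda>x. w x t) \<psi>"
      using gi \<psi> by (auto simp: has_L2_integral_def intro: has_bochner_integral_integral_eq)
    finally show "0 \<le> L2_inner \<Omega> (\<lambda>x. w x t) \<psi>" .
  qed
qed

lemma ibvp_solution_pos:
  assumes a: "a \<in> L2 \<Omega>" "AE x in lebesgue_on \<Omega>. a x > 0"
    and F: "F \<in> Linf_L2 \<Omega>" "AE (x, t) in lebesgue_on (\<Omega> \<times> {0<..}). F x t \<ge> 0"
    and u: "ibvp_solution \<Omega> m \<alpha> q \<mu> \<phi> a F u"
  shows "AE (x, t) in lebesgue_on (\<Omega> \<times> {0<..}). u x t > 0"
proof -
  define Q where "Q = \<Omega> \<times> {0::real<..}"
  have "open Q" unfolding Q_def using \<Omega>_open by (intro open_Times) auto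
  then have Q: "Q \<in> sets lebesgue" by auto
  have T: "{0::real<..} \<in> sets lebesgue" by auto
  obtain v w where vw: "homogeneous_solution \<Omega> m \<alpha> q \<mu> \<phi> a v" "source_solution \<Omega> m \<alpha> q \<mu> \<phi> F w"
    and uvw: "AE (x, t) in lebesgue_on Q. u x t = v x t + w x t"
    using u unfolding ibvp_solution_def Q_def by blast
  have "AE t in lborel. t > 0 \<longrightarrow> (\<lambda>x. F x t) \<in> L2 \<Omega>"
  proof -
    have "AE t in lebesgue_on {0<..}. (\<lambda>x. F x t) \<in> L2 \<Omega>"
      using F(1) unfolding Linf_L2_def by (auto elim!: eventually_mono)
    then show ?thesis using T by (subst (asm) AE_lebesgue_on_iff) auto
  qed
  moreover have "AE t in lborel. t > 0 \<longrightarrow> (AE x in lebesgue_on \<Omega>. F x t \<ge> 0)"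
  proof -
    have "AE z in lborel. z \<in> Q \<longrightarrow> (case z of (x, t) \<Rightarrow> F x t \<ge> 0)"
      using F(2) Q unfolding Q_def by (subst (asm) AE_lebesgue_on_iff) auto
    from AE_lborel_sections[OF this] show ?thesis
      by eventually_elim (auto simp: AE_lebesgue_on_iff[OF \<Omega>_sets] Q_def elim: eventually_mono)
  qed
  ultimately have F': "AE t in lborel. t > 0 \<longrightarrow> (\<lambda>x. F x t) \<in> L2 \<Omega> \<and> (AE x in lebesgue_on \<Omega>. F x t \<ge> 0)"
    by eventually_elim auto
  \<comment> \<open>The bad set is formed with v + w and not with \<open>u\<close>: joint
    measurability is given for \<open>v\<close> and \<open>w\<close>, while \<open>u\<close> agrees
    with their sum almost everywhere.\<close>
  define B where "B = {z \<in> Q. \<not> (case z of (x, t) \<Rightarrow> v x t + w x t > 0)}"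
  have "B \<in> sets lebesgue"
  proof -
    have "(\<lambda>z. (case z of (x, t) \<Rightarrow> v x t) + (case z of (x, t) \<Rightarrow> w x t)) \<in> borel_measurable (lebesgue_on Q)"
      using vw by (intro borel_measurable_add) (auto simp: homogeneous_solution_def source_solution_def Q_def)
    then have "{z \<in> space (lebesgue_on Q). (case z of (x, t) \<Rightarrow> v x t) + (case z of (x, t) \<Rightarrow> w x t) \<le> 0} \<in> sets (lebesgue_on Q)"
      by measurable
    also have "{z \<in> space (lebesgue_on Q). (case z of (x, t) \<Rightarrow> v x t) + (case z of (x, t) \<Rightarrow> w x t) \<le> 0} = B"
      by (auto simp: B_def space_restrict_space not_less)
    finally show ?thesis using Q by (simp add: sets_restrict_space_iff)
  qed
  moreover have "AE x in lborel. (x, t) \<notin> B" for t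
  proof (cases "t > 0")
    case True
    have "AE x in lebesgue_on \<Omega>. v x t + w x t > 0"
      using homogeneous_solution_pos[OF vw(1) a True] source_solution_nonneg[OF vw(2) True F']
      by eventually_elim simp
    then show ?thesis
      unfolding AE_lebesgue_on_iff[OF \<Omega>_sets] by eventually_elim (auto simp: B_def Q_def)
  qed (auto simp: B_def Q_def)
  ultimately have "AE z in lborel. z \<notin> B" by (rule AE_lborel_of_sections)
  moreover have "AE z in lborel. z \<in> Q \<longrightarrow> (case z of (x, t) \<Rightarrow> u x t = v x t + w x t)"
    using uvw Q by (subst (asm) AE_lebesgue_on_iff) auto
  ultimately have "AE z in lborel. z \<in> Q \<longrightarrow> (case z of (x, t) \<Rightarrow> u x t > 0)"
    by eventually_elim (auto simp: B_def)
  then show ?thesis using Q unfolding Q_def[symmetric] by (subst AE_lebesgue_on_iff) auto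
qed

end

theorem corollary1p2:
  fixes \<Omega> :: "(real^'n::finite) set"
    and A :: "'n \<Rightarrow> 'n \<Rightarrow> real^'n \<Rightarrow> real" and c :: "real^'n \<Rightarrow> real"
    and m :: nat and \<alpha> q :: "nat \<Rightarrow> real"
    and \<mu> :: "nat \<Rightarrow> real" and \<phi> :: "nat \<Rightarrow> real^'n \<Rightarrow> real"
    and a :: "real^'n \<Rightarrow> real" and F u :: "real^'n \<Rightarrow> real \<Rightarrow> real"
  assumes "CARD('n) \<in> {1, 2, 3}"
    and "smooth_bounded_domain \<Omega>"
    and "m \<ge> 1"
    and "\<And>j. j \<in> {1..m} \<Longrightarrow> 0 < \<alpha> j \<and> \<alpha> j < 1"
    and "\<And>i j. 1 \<le> i \<Longrightarrow> i < j \<Longrightarrow> j \<le> m \<Longrightarrow> \<alpha> j < \<alpha> i"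
    and "\<And>j. j \<in> {1..m} \<Longrightarrow> 0 < q j"
    and "q 1 = 1"
    and "elliptic_coeffs \<Omega> A c"
    and "eigensystem \<Omega> A c \<mu> \<phi>"
    and "a \<in> L2 \<Omega>"
    and "AE x in lebesgue_on \<Omega>. a x > 0"
    and "F \<in> Linf_L2 \<Omega>"
    and "AE (x, t) in lebesgue_on (\<Omega> \<times> {0<..}). F x t \<ge> 0"
    and "ibvp_solution \<Omega> m \<alpha> q \<mu> \<phi> a F u"
  shows "AE (x, t) in lebesgue_on (\<Omega> \<times> {0<..}). u x t > 0"
proof -
  interpret fractional_diffusion \<Omega> A c \<mu> \<phi> m \<alpha> q
    by unfold_locales (fact assms)+
  show ?thesis by (rule ibvp_solution_pos[OF assms(10-14)])
qed

end
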